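(* Let $(B(t))_{t\in[0,1]}$ be a standard Brownian motion, let $M(1):=\min_{s\in[0,1]}B(s)$, and let $(X(t))_{t\in[0,1]}$ be a process with continuous paths whose law on $C[0,1]$ is given by $$\mathbb P\big((X(t))_{t\in[0,1]}\in A\big)=\mathbb E\left[\mathbf 1_{\{(B(t))_{t\in[0,1]}\in A\}}\cdot\frac{B(1)-M(1)}{\mathbb E[-M(1)]}\right]$$ for Borel sets $A\subseteq C[0,1]$. Set $M_X(t):=\min_{s\in[0,t]}X(s)$. Let $c\colon[0,1]\times[0,\infty)\to[0,\infty)$ be defined by $$c(t,x):=\frac{2\,\Phi_{1-t}(x)-1}{x+2\int_x^\infty(1-\Phi_{1-t}(s))\,\mathrm ds}$$ for $(t,x)\ne(1,0)$, with an arbitrary value at $(t,x)=(1,0)$. Then there exists a Brownian motion $(\tilde B(t))_{t\in[0,1]}$ such that $(X(t))_{t\in[0,1]}$ satisfies the stochastic differential equation $$\mathrm dX(t)=c\big(t,X(t)-M_X(t)\big)\,\mathrm dt+\mathrm d\tilde B(t),\qquad t\in[0,1].$$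
   Context: $\Phi_{1-t}$ denotes the distribution function of the normal distribution $\mathcal N(0,1-t)$ with mean $0$ and variance $1-t$ (for $t=1$, the distribution function of the Dirac mass at $0$). $C[0,1]$ is the space of continuous real-valued functions on $[0,1]$ with the supremum norm and its Borel $\sigma$-algebra. The SDE is understood in integrated form: $X(t)=X(0)+\int_0^t c(s,X(s)-M_X(s))\,\mathrm ds+\tilde B(t)$ for all $t\in[0,1]$, almost surely, where $X(0)=0$ almost surely (this follows from the law of $X$). *)

theory Defs
  imports "HOL-Probability.Probability"
begin

text \<open>The space \<open>C[0,1]\<close> with the supremum metric.  Its points are functions on the reals that
  are continuous on \<open>{0..1}\<close> and have the value \<open>undefined\<close> outside of it.\<close>

definition C01 :: "(real \<Rightarrow> real) metric" where
  "C01 = cfunspace (top_of_set {0..1}) euclidean_metric"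

definition C01_borel :: "(real \<Rightarrow> real) measure" where
  "C01_borel = sigma (mspace C01) {U. openin (mtopology_of C01) U}"

text \<open>A process indexed by \<open>[0,1]\<close> is a function \<open>real \<Rightarrow> 'a \<Rightarrow> real\<close> of which only the
  values at times in \<open>{0..1}\<close> matter.\<close>

definition continuous_process :: "'a measure \<Rightarrow> (real \<Rightarrow> 'a \<Rightarrow> real) \<Rightarrow> bool" where
  "continuous_process M X \<longleftrightarrow>
     (\<forall>t\<in>{0..1}. X t \<in> borel_measurable M) \<and>
     (\<forall>\<omega>\<in>space M. continuous_on {0..1} (\<lambda>t. X t \<omega>))"

definition path01 :: "(real \<Rightarrow> 'a \<Rightarrow> real) \<Rightarrow> 'a \<Rightarrow> real \<Rightarrow> real" where
  "path01 X \<omega> = restrict (\<lambda>t. X t \<omega>) {0..1}"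

definition brownian_motion :: "'a measure \<Rightarrow> (real \<Rightarrow> 'a \<Rightarrow> real) \<Rightarrow> bool" where
  "brownian_motion M W \<longleftrightarrow>
     prob_space M \<and>
     continuous_process M W \<and>
     (AE \<omega> in M. W 0 \<omega> = 0) \<and>
     (\<forall>n \<tau>. (\<forall>i\<le>n. \<tau> i \<in> {0..1}) \<and> (\<forall>i<n. \<tau> i \<le> \<tau> (Suc i)) \<longrightarrow>
        prob_space.indep_vars M (\<lambda>_. borel) (\<lambda>i \<omega>. W (\<tau> (Suc i)) \<omega> - W (\<tau> i) \<omega>) {..<n}) \<and>
     (\<forall>s t. 0 \<le> s \<and> s < t \<and> t \<le> 1 \<longrightarrow>
        distributed M lborel (\<lambda>\<omega>. W t \<omega> - W s \<omega>) (normal_density 0 (sqrt (t - s))))"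

text \<open>For a continuous path the infimum is attained, see \<open>running_min_attained\<close> below.\<close>

definition running_min :: "(real \<Rightarrow> 'a \<Rightarrow> real) \<Rightarrow> real \<Rightarrow> 'a \<Rightarrow> real" where
  "running_min X t \<omega> = (INF s\<in>{0..t}. X s \<omega>)"

lemma running_min_attained:
  assumes "continuous_process M X" "\<omega> \<in> space M" "t \<in> {0..1}"
  shows "\<exists>s\<in>{0..t}. running_min X t \<omega> = X s \<omega>"
    and "\<forall>s\<in>{0..t}. running_min X t \<omega> \<le> X s \<omega>"
proof -
  have "continuous_on {0..t} (\<lambda>s. X s \<omega>)"
    using assms by (auto simp: continuous_process_def intro: continuous_on_subset)
  then obtain s where s: "s \<in> {0..t}" "\<forall>r\<in>{0..t}. X s \<omega> \<le> X r \<omega>"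
    using continuous_attains_inf[of "{0..t}" "\<lambda>s. X s \<omega>"] assms(3) by auto
  then have "running_min X t \<omega> = X s \<omega>"
    unfolding running_min_def by (intro cInf_eq_minimum) auto
  with s show "\<exists>s\<in>{0..t}. running_min X t \<omega> = X s \<omega>"
    and "\<forall>s\<in>{0..t}. running_min X t \<omega> \<le> X s \<omega>"
    by auto
qed

text \<open>Distribution function of the centred normal law with variance \<open>v \<ge> 0\<close>; for \<open>v = 0\<close>
  the law is the Dirac mass at \<open>0\<close>.\<close>

definition centred_normal :: "real \<Rightarrow> real measure" where
  "centred_normal v =
     (if v = 0 then return borel 0 else density lborel (normal_density 0 (sqrt v)))"

definition Phi :: "real \<Rightarrow> real \<Rightarrow> real" where
  "Phi v = cdf (centred_normal v)"

text \<open>Meaningful for \<open>t \<in> {0..1}\<close>, \<open>x \<ge> 0\<close> and \<open>(t, x) \<noteq> (1, 0)\<close>; at \<open>(1, 0)\<close> the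
  denominator vanishes.\<close>

definition drift_formula :: "real \<Rightarrow> real \<Rightarrow> real" where
  "drift_formula t x =
     (2 * Phi (1 - t) x - 1) / (x + 2 * (LBINT s:{x..}. 1 - Phi (1 - t) s))"

text \<open>Integrated form of \<open>dX(t) = c(t, X(t) - M\<^sub>X(t)) dt + dW(t)\<close> on \<open>[0,1]\<close>.  Integrability is
  stated explicitly, since the Bochner integral of a non-integrable function is \<open>0\<close>.\<close>

definition solves_SDE ::
  "'a measure \<Rightarrow> (real \<Rightarrow> real \<Rightarrow> real) \<Rightarrow> (real \<Rightarrow> 'a \<Rightarrow> real) \<Rightarrow> (real \<Rightarrow> 'a \<Rightarrow> real) \<Rightarrow> bool" where
  "solves_SDE N c X W \<longleftrightarrow>
     (AE \<omega> in N.
        set_integrable lborel {0..1} (\<lambda>s. c s (X s \<omega> - running_min X s \<omega>)) \<and>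
        (\<forall>t\<in>{0..1}.
           X t \<omega> = X 0 \<omega> + (LBINT s:{0..t}. c s (X s \<omega> - running_min X s \<omega>)) + W t \<omega>))"

end

theory Submission
  imports Defs "HOL-Real_Asymp.Real_Asymp"
begin

text \<open>Write \<open>Y\<close> for \<open>B\<close> minus its running minimum and \<open>Z\<close> for a standard normal variable. By the
  reflection principle the density \<open>B(1) - M(1) = Y(1)\<close> has the conditional expectation
  \<open>D(t) = u(t, Y(t))\<close> with \<open>u(t, x) = E max(x, \<bar>sqrt (1 - t) Z\<bar>)\<close>, which is the denominator of the drift;
  its numerator is the derivative of \<open>u\<close> in \<open>x\<close>. So the claim is Girsanov's theorem for the density
  \<open>D(1)\<close>, with \<open>W(t) = B(t) - \<integral>\<^sub>0\<^sup>t c(s, Y(s)) ds\<close>.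

  No stochastic calculus is needed. For \<open>A\<close> in the past of \<open>s\<close>, a Taylor expansion shows that
  \<open>\<psi>(t) = exp(\<lambda>\<^sup>2 t / 2) E[1\<^sub>A exp(\<i> \<lambda> (W(t) - W(s))) D(1)]\<close> changes by at most a multiple of
  \<open>h powr (3/2)\<close> over a time step \<open>h\<close>, uniformly away from time \<open>1\<close>. Hence \<open>\<psi>\<close> is constant, and the
  uniqueness theorem for characteristic functions gives the law of \<open>W(t) - W(s)\<close> and its independence
  of the past under the new measure. The growth of \<open>-M\<close> does not enter to first order, because \<open>u\<close> has
  vanishing derivative at \<open>x = 0\<close>.\<close>

section \<open>The absolute value of a normal variable\<close>

text \<open>The constants of the Taylor expansion grow like powers of
  \<open>1 / sqrt (1 - t)\<close>, so short steps are summed only over intervals ending at some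
  \<open>b < 1\<close>; the final time is reached by dominated convergence, with the integrable
  weight D(1) as dominating function. What matters in the error exponent is that it exceeds 1: n
  steps of length 1/n then contribute a multiple of \<open>n powr (-1/2)\<close>. The exponent 3/2
  arises because every remainder is at most a multiple of \<rho>^3 (1 + D(t)), where \<rho> is the
  oscillation of B over the step plus sqrt h. As \<rho> is made of future increments, it is
  independent of D(t), and by reflection its third moment has order \<open>h powr (3/2)\<close>.

  X and B live on different probability spaces and are linked only through Borel sets of C[0,1].
  Hence W is a functional of a single path, evaluated at B for computations under the weighted
  measure and at X to obtain the driving noise. The normalisation is consistent: E B(1) = 0 gives E
  D(1) = E(-M(1)).\<close>

lemma std_normal_density_le: "std_normal_density x \<le> 1 / 2"
proof -
  have "2 \<le> sqrt (2 * pi)"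
    using pi_gt3 by (intro real_le_rsqrt) auto
  then have "1 / sqrt (2 * pi) \<le> 1 / 2" by (auto simp: field_simps)
  moreover have "exp (- x\<^sup>2 / 2) \<le> 1" by simp
  ultimately have "(1 / sqrt (2 * pi)) * exp (- x\<^sup>2 / 2) \<le> (1 / 2) * 1"
    by (intro mult_mono) auto
  then show ?thesis by (simp add: std_normal_density_def)
qed

text \<open>The chain rule for \<open>abs_prob (x / r)\<close> in \<open>r\<close> produces a factor
  \<open>x / r\<close>; Gaussian decay absorbs it, which makes the bound uniform in
  \<open>x\<close>.\<close>

lemma abs_times_std_normal_density_le: "\<bar>y * std_normal_density y\<bar> \<le> 1 / 2"
proof -
  have "2 * \<bar>y\<bar> \<le> 1 + y\<^sup>2"
    using sum_squares_bound[of 1 "\<bar>y\<bar>"] by simp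
  also have "\<dots> \<le> 2 * (1 + y\<^sup>2 / 2)" by simp
  also have "\<dots> \<le> 2 * exp (y\<^sup>2 / 2)" using exp_ge_add_one_self[of "y\<^sup>2/2"] by (intro mult_left_mono) auto
  finally have "\<bar>y\<bar> * exp (- y\<^sup>2 / 2) \<le> 1"
    by (simp add: exp_minus field_simps)
  moreover have "2 \<le> sqrt (2 * pi)"
    using pi_gt3 by (intro real_le_rsqrt) auto
  then have "1 / sqrt (2 * pi) \<le> 1 / 2" by (auto simp: field_simps)
  ultimately have "(1 / sqrt (2 * pi)) * (\<bar>y\<bar> * exp (- y\<^sup>2 / 2)) \<le> (1 / 2) * 1"
    by (intro mult_mono) auto
  then show ?thesis by (simp add: std_normal_density_def abs_mult field_simps)
qed

lemma DERIV_std_normal_density: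
  "(std_normal_density has_real_derivative (- x * std_normal_density x)) (at x)"
  unfolding std_normal_density_def[abs_def]
  by (auto intro!: derivative_eq_intros simp: field_simps)

lemma real_distribution_centred_normal:
  assumes "0 \<le> v" shows "real_distribution (centred_normal v)"
proof -
  have "prob_space (centred_normal v)"
    using assms by (auto simp: centred_normal_def intro!: prob_space_return prob_space_normal_density)
  then show ?thesis
    by (auto simp: real_distribution_def real_distribution_axioms_def centred_normal_def)
qed

lemma Phi_eq_std:
  assumes v: "0 < v" shows "Phi v x = Phi 1 (x / sqrt v)"
proof -
  let ?M = "density lborel (normal_density 0 (sqrt v))"
  interpret prob_space ?M using v by (intro prob_space_normal_density) auto
  have "distributed ?M lborel (\<lambda>x. x) (normal_density 0 (sqrt v))"
    by (auto simp: distributed_def distr_id2)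
  then have d: "distributed ?M lborel (\<lambda>x. (x - 0) / sqrt v) std_normal_density"
    using v by (subst (asm) normal_standard_normal_convert) auto
  have "measure (density lborel std_normal_density) {..x / sqrt v} =
     measure (distr ?M lborel (\<lambda>x. (x - 0) / sqrt v)) {..x / sqrt v}"
    by (subst distributed_distr_eq_density[OF d]) simp
  also have "\<dots> = measure ?M {..x}"
    using v by (subst measure_distr) (auto intro!: arg_cong[where f="measure _"] simp: divide_le_cancel)
  finally show ?thesis
    using v by (simp add: Phi_def cdf_def centred_normal_def)
qed

lemma DERIV_Phi_std: "(Phi 1 has_real_derivative std_normal_density x) (at x)"
proof -
  interpret R: real_distribution "centred_normal 1" by (rule real_distribution_centred_normal) simp
  have cont: "continuous_on A std_normal_density" for A
    unfolding std_normal_density_def[abs_def] by (intro continuous_intros) auto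
  \<comment> \<open>The base point only has to lie to the left of \<open>x\<close>: on
    \<open>{?a<..}\<close>, a neighbourhood of \<open>x\<close>, \<open>Phi 1\<close> is this
    integral plus a constant.\<close>
  let ?a = "x - 1"
  have "((\<lambda>y. integral {?a..y} std_normal_density) has_real_derivative std_normal_density x) (at x within {?a..x+1})"
    using cont by (intro integral_has_real_derivative) auto
  then have "((\<lambda>y. integral {?a..y} std_normal_density) has_real_derivative std_normal_density x) (at x)"
    by (subst (asm) at_within_interior) auto
  then have "((\<lambda>y. integral {?a..y} std_normal_density + Phi 1 ?a) has_real_derivative std_normal_density x) (at x)"
    by (auto intro!: derivative_eq_intros)
  moreover have "integral {?a..y} std_normal_density + Phi 1 ?a = Phi 1 y" if y: "?a < y" for y
  proof -
    have "Phi 1 y - Phi 1 ?a = measure (centred_normal 1) {?a<..y}"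
      unfolding Phi_def using y by (rule R.cdf_diff_eq)
    also have "\<dots> = (LBINT z:{?a<..y}. std_normal_density z)"
      unfolding centred_normal_def measure_def set_lebesgue_integral_def
      by (simp add: emeasure_density integral_eq_nn_integral ennreal_mult' ac_simps ennreal_indicator)
    also have "\<dots> = (LBINT z:{?a..y}. std_normal_density z)"
      unfolding set_lebesgue_integral_def
      by (intro integral_cong_AE) (auto intro!: AE_I[where N="{?a}"] simp: indicator_def split: if_splits)
    also have "\<dots> = integral {?a..y} std_normal_density"
      by (intro set_borel_integral_eq_integral(2) borel_integrable_atLeastAtMost'[OF cont])
    finally show ?thesis by simp
  qed
  then have "\<forall>\<^sub>F y in nhds x. integral {?a..y} std_normal_density + Phi 1 ?a = Phi 1 y"
    using eventually_nhds_in_open[of "{?a<..}" x] by (auto elim!: eventually_mono)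
  ultimately show ?thesis by (simp add: DERIV_cong_ev)
qed

text \<open>The density is even, so \<open>Phi 1 y + Phi 1 (- y)\<close> has derivative 0; its
  constant value is read off at infinity.\<close>

lemma Phi_std_minus: "Phi 1 (- x) = 1 - Phi 1 x"
proof -
  interpret R: real_distribution "centred_normal 1" by (rule real_distribution_centred_normal) simp
  have c: "Phi 1 x + Phi 1 (- x) = Phi 1 y + Phi 1 (- y)" for x y
  proof (rule DERIV_isconst_all[of "\<lambda>y. Phi 1 y + Phi 1 (- y)" x y], rule allI)
    show "((\<lambda>y. Phi 1 y + Phi 1 (- y)) has_real_derivative 0) (at x)" for x
      by (auto intro!: derivative_eq_intros DERIV_Phi_std DERIV_chain2[OF DERIV_Phi_std]
        simp: std_normal_density_def)
  qed
  have "((\<lambda>y. Phi 1 y + Phi 1 (- y)) \<longlongrightarrow> 1 + 0) at_top"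
    unfolding Phi_def
    by (intro tendsto_add R.cdf_lim_at_top_prob filterlim_compose[OF R.cdf_lim_at_bot] filterlim_uminus_at_bot_at_top)
  moreover have "(\<lambda>y. Phi 1 y + Phi 1 (- y)) = (\<lambda>y. Phi 1 x + Phi 1 (- x))"
    using c[of _ x] by blast
  ultimately have "((\<lambda>y::real. Phi 1 x + Phi 1 (- x)) \<longlongrightarrow> 1) at_top"
    by simp
  then show ?thesis by (simp add: tendsto_const_iff)
qed

text \<open>With \<open>Z\<close> standard normal, \<open>abs_prob y = P(\<bar>Z\<bar> \<le> y)\<close> and \<open>abs_max_mean y = E max(y, \<bar>Z\<bar>)\<close> for \<open>y \<ge> 0\<close>.\<close>

definition abs_prob :: "real \<Rightarrow> real" where
  "abs_prob y = 2 * Phi 1 y - 1"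

definition abs_max_mean :: "real \<Rightarrow> real" where
  "abs_max_mean y = y * abs_prob y + 2 * std_normal_density y"

lemma DERIV_abs_prob: "(abs_prob has_real_derivative 2 * std_normal_density y) (at y)"
  unfolding abs_prob_def[abs_def] by (auto intro!: derivative_eq_intros DERIV_Phi_std)

text \<open>The term \<open>2 * y * std_normal_density y\<close> from the product rule cancels the
  derivative of \<open>2 * std_normal_density y\<close>.\<close>

lemma DERIV_abs_max_mean: "(abs_max_mean has_real_derivative abs_prob y) (at y)"
  unfolding abs_max_mean_def[abs_def]
  by (auto intro!: derivative_eq_intros DERIV_abs_prob DERIV_std_normal_density)

lemma abs_prob_0: "abs_prob 0 = 0"
  using Phi_std_minus[of 0] by (simp add: abs_prob_def)

lemma abs_prob_lipschitz: "\<bar>abs_prob y - abs_prob z\<bar> \<le> \<bar>y - z\<bar>"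
proof -
  have "norm (abs_prob y - abs_prob z) \<le> 1 * norm (y - z)"
  proof (rule field_differentiable_bound[of UNIV])
    show "norm (2 * std_normal_density x) \<le> 1" for x
      using std_normal_density_le[of x] normal_density_nonneg[of 0 1 x] by (simp only: real_norm_def abs_if split: if_splits) linarith
  qed (auto intro: DERIV_abs_prob)
  then show ?thesis by simp
qed

lemma abs_prob_bounds: assumes "0 \<le> y" shows "0 \<le> abs_prob y" "abs_prob y \<le> 1"
proof -
  interpret R: real_distribution "centred_normal 1" by (rule real_distribution_centred_normal) simp
  show "abs_prob y \<le> 1" using R.cdf_bounded_prob[of y] by (simp add: abs_prob_def Phi_def)
  show "0 \<le> abs_prob y"
    using R.cdf_nondecreasing[of 0 y] assms abs_prob_0 by (simp add: abs_prob_def Phi_def)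
qed

lemma abs_prob_minus: "abs_prob (- y) = - abs_prob y"
  using Phi_std_minus[of y] by (simp add: abs_prob_def)

lemma abs_abs_prob_le_1: "\<bar>abs_prob y\<bar> \<le> 1"
  using abs_prob_bounds[of y] abs_prob_bounds[of "- y"] abs_prob_minus[of y] by (cases "0 \<le> y") auto

lemma abs_max_mean_lipschitz: "\<bar>abs_max_mean y - abs_max_mean z\<bar> \<le> \<bar>y - z\<bar>"
  using field_differentiable_bound[of UNIV abs_max_mean abs_prob 1 y z]
    DERIV_abs_max_mean abs_abs_prob_le_1 by simp

text \<open>The error of the tangent has derivative \<open>abs_prob x - abs_prob y\<close>, bounded
  by \<open>\<bar>z - y\<bar>\<close> on the segment; the mean value theorem supplies the second
  factor.\<close>

lemma abs_max_mean_taylor: "\<bar>abs_max_mean z - abs_max_mean y - abs_prob y * (z - y)\<bar> \<le> (z - y)\<^sup>2"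
proof -
  have "norm ((abs_max_mean z - abs_prob y * z) - (abs_max_mean y - abs_prob y * y)) \<le> \<bar>z - y\<bar> * norm (z - y)"
  proof (rule field_differentiable_bound)
    show "((\<lambda>x. abs_max_mean x - abs_prob y * x) has_real_derivative abs_prob x - abs_prob y)
              (at x within closed_segment y z)" for x
      by (auto intro!: derivative_eq_intros DERIV_subset[OF DERIV_abs_max_mean])
    show "norm (abs_prob x - abs_prob y) \<le> \<bar>z - y\<bar>" if "x \<in> closed_segment y z" for x
      using abs_prob_lipschitz[of x y] that by (auto simp: closed_segment_eq_real_ivl split: if_splits)
  qed auto
  then show ?thesis by (simp add: power2_eq_square algebra_simps abs_mult[symmetric])
qed

text \<open>The function increases on the nonnegative axis from its value 2 / sqrt (2 pi) at 0, and
  sqrt (2 pi) is at most 4. This keeps the denominator of the drift away from zero before time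
  1.\<close>

lemma abs_max_mean_ge: assumes "0 \<le> y" shows "1 / 2 \<le> abs_max_mean y"
proof -
  have "sqrt (2 * pi) \<le> 4"
    using pi_less_4 by (intro real_le_lsqrt) auto
  then have "1 / 2 \<le> abs_max_mean 0"
    by (simp add: abs_max_mean_def std_normal_density_def field_simps)
  also have "\<dots> \<le> abs_max_mean y"
    by (rule DERIV_nonneg_imp_nondecreasing[OF assms]) (metis DERIV_abs_max_mean abs_prob_bounds(1))
  finally show ?thesis .
qed

text \<open>The difference is \<open>2 * std_normal_density y - y * (1 - abs_prob y)\<close>.
  Markov's inequality for the second moment bounds the tail by \<open>2 / y\<^sup>2\<close>, enough
  to beat the factor \<open>y\<close>. The limit is the boundary term at infinity in the tail
  integral of the drift formula.\<close>

lemma abs_max_mean_minus_lim: "((\<lambda>y. abs_max_mean y - y) \<longlongrightarrow> 0) at_top"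
proof -
  let ?M = "density lborel std_normal_density"
  interpret prob_space ?M by (intro prob_space_normal_density) auto
  have int: "integrable ?M (\<lambda>x. x\<^sup>2)" "(\<integral>x. x\<^sup>2 \<partial>?M) = 1"
    using integrable_std_normal_moment[of 2] integral_std_normal_moment_even[of 1]
    by (auto simp: integrable_density integral_density)
  have dens: "((\<lambda>y. std_normal_density y) \<longlongrightarrow> 0) at_top"
    unfolding std_normal_density_def by real_asymp
  have b: "0 \<le> y * (1 - abs_prob y) \<and> y * (1 - abs_prob y) \<le> 2 / y" if y: "0 < y" for y
  proof -
    have "1 - Phi 1 y = measure ?M {x \<in> space ?M. \<not> x \<le> y}"
      by (subst prob_neg) (auto simp: Phi_def cdf_def centred_normal_def atMost_def)
    also have "\<dots> \<le> measure ?M {x \<in> space ?M. x\<^sup>2 \<ge> y\<^sup>2}"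
      using y by (intro finite_measure_mono) (auto intro!: power_mono)
    also have "\<dots> \<le> (\<integral>x. x\<^sup>2 \<partial>?M) / y\<^sup>2"
      using y int by (intro integral_Markov_inequality_measure[where A="{}"]) auto
    finally have "1 - abs_prob y \<le> 2 / y\<^sup>2" unfolding int abs_prob_def by simp
    then have "y * (1 - abs_prob y) \<le> y * (2 / y\<^sup>2)"
      using y by (intro mult_left_mono) auto
    then show ?thesis
      using y abs_prob_bounds[of y] by (auto simp: power2_eq_square)
  qed
  have "((\<lambda>y. y * (1 - abs_prob y)) \<longlongrightarrow> 0) at_top"
  proof (rule tendsto_sandwich[of "\<lambda>_. 0" _ _ "\<lambda>y. 2 / y"])
    show "((\<lambda>y::real. 2 / y) \<longlongrightarrow> 0) at_top" by real_asymp
    show "\<forall>\<^sub>F y in at_top. 0 \<le> y * (1 - abs_prob y)"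
      by (rule eventually_mono[OF eventually_gt_at_top[of 0]]) (use b in blast)
    show "\<forall>\<^sub>F y in at_top. y * (1 - abs_prob y) \<le> 2 / y"
      by (rule eventually_mono[OF eventually_gt_at_top[of 0]]) (use b in blast)
  qed auto
  then have "((\<lambda>y. 2 * std_normal_density y - y * (1 - abs_prob y)) \<longlongrightarrow> 2 * 0 - 0) at_top"
    by (intro tendsto_intros dens)
  then show ?thesis by (simp add: abs_max_mean_def algebra_simps)
qed

text \<open>\<open>max_mean s x = E max(x, s \<bar>Z\<bar>)\<close>; its derivative in \<open>x\<close> is \<open>abs_prob (x / s)\<close>.\<close>

definition max_mean :: "real \<Rightarrow> real \<Rightarrow> real" where
  "max_mean s x = s * abs_max_mean (x / s)"

section \<open>Regularity of \<open>max_mean\<close> in the state and in the scale\<close>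

lemma max_mean_taylor:
  assumes "0 < s"
  shows "\<bar>max_mean s z - max_mean s y - abs_prob (y / s) * (z - y)\<bar> \<le> (z - y)\<^sup>2 / s"
proof -
  have "max_mean s z - max_mean s y - abs_prob (y / s) * (z - y) =
      s * (abs_max_mean (z / s) - abs_max_mean (y / s) - abs_prob (y / s) * (z / s - y / s))"
    using assms by (simp add: max_mean_def field_simps)
  also have "\<bar>\<dots>\<bar> \<le> s * (z / s - y / s)\<^sup>2"
    using assms abs_max_mean_taylor[of "z / s" "y / s"] by (simp add: abs_mult)
  also have "\<dots> = (z - y)\<^sup>2 / s"
    using assms by (simp add: power2_eq_square field_simps)
  finally show ?thesis .
qed

lemma max_mean_lipschitz:
  assumes "0 < s" shows "\<bar>max_mean s y - max_mean s z\<bar> \<le> \<bar>y - z\<bar>"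
proof -
  have "\<bar>max_mean s y - max_mean s z\<bar> = s * \<bar>abs_max_mean (y / s) - abs_max_mean (z / s)\<bar>"
    using assms by (simp add: max_mean_def abs_mult right_diff_distrib[symmetric])
  also have "\<dots> \<le> s * \<bar>y / s - z / s\<bar>"
    using assms abs_max_mean_lipschitz by (intro mult_left_mono) auto
  also have "\<dots> = \<bar>y - z\<bar>"
    using assms by (simp add: diff_divide_distrib[symmetric])
  finally show ?thesis .
qed

lemma abs_prob_scaled_lipschitz:
  assumes "0 < s" shows "\<bar>abs_prob (y / s) - abs_prob (z / s)\<bar> \<le> \<bar>y - z\<bar> / s"
  using abs_prob_lipschitz[of "y / s" "z / s"] assms by (simp add: diff_divide_distrib[symmetric])

text \<open>With \<open>y = x / r\<close> the derivative in the scale \<open>r\<close> is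
  \<open>abs_max_mean y - y * abs_prob y\<close>, that is \<open>2 * std_normal_density y\<close>,
  which is at most 1.\<close>

lemma max_mean_lipschitz_scale:
  assumes "0 < s" "0 < s'" shows "\<bar>max_mean s x - max_mean s' x\<bar> \<le> \<bar>s - s'\<bar>"
proof -
  have "norm (max_mean s x - max_mean s' x) \<le> 1 * norm (s - s')"
  proof (rule field_differentiable_bound[of "{0<..}"])
    fix r :: real assume r: "r \<in> {0<..}"
    have d: "((\<lambda>r. x / r) has_real_derivative - x / r\<^sup>2) (at r)"
      using r by (auto intro!: derivative_eq_intros simp: power2_eq_square)
    have "((\<lambda>r. max_mean r x) has_real_derivative 1 * abs_max_mean (x / r) + abs_prob (x / r) * (- x / r\<^sup>2) * r) (at r)"
      unfolding max_mean_def by (intro DERIV_mult DERIV_ident DERIV_chain2[OF DERIV_abs_max_mean d])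
    also have "1 * abs_max_mean (x / r) + abs_prob (x / r) * (- x / r\<^sup>2) * r = 2 * std_normal_density (x / r)"
      using r unfolding abs_max_mean_def by (simp add: field_simps power2_eq_square)
    finally have "((\<lambda>r. max_mean r x) has_real_derivative 2 * std_normal_density (x / r)) (at r)" .
    then show "((\<lambda>r. max_mean r x) has_real_derivative 2 * std_normal_density (x / r)) (at r within {0<..})"
      by (rule DERIV_subset) simp
    show "norm (2 * std_normal_density (x / r)) \<le> 1"
      using std_normal_density_le[of "x / r"] normal_density_nonneg[of 0 1 "x / r"]
      by (simp only: real_norm_def abs_if split: if_splits) linarith
  qed (use assms in auto)
  then show ?thesis by simp
qed

lemma abs_prob_lipschitz_scale:
  assumes e: "0 < e" "e \<le> s" "e \<le> s'"
  shows "\<bar>abs_prob (x / s) - abs_prob (x / s')\<bar> \<le> \<bar>s - s'\<bar> / e"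
proof -
  have "norm (abs_prob (x / s) - abs_prob (x / s')) \<le> (1 / e) * norm (s - s')"
  proof (rule field_differentiable_bound[of "{e..}"])
    fix r :: real assume r: "r \<in> {e..}"
    with e have r0: "0 < r" by auto
    have d: "((\<lambda>r. x / r) has_real_derivative - x / r\<^sup>2) (at r)"
      using r0 by (auto intro!: derivative_eq_intros simp: power2_eq_square)
    have "((\<lambda>r. abs_prob (x / r)) has_real_derivative 2 * std_normal_density (x / r) * (- x / r\<^sup>2)) (at r)"
      by (intro DERIV_chain2[OF DERIV_abs_prob d])
    also have "2 * std_normal_density (x / r) * (- x / r\<^sup>2) = - (2 * ((x / r) * std_normal_density (x / r))) / r"
      by (simp add: power2_eq_square)
    finally have "((\<lambda>r. abs_prob (x / r)) has_real_derivative - (2 * ((x / r) * std_normal_density (x / r))) / r) (at r)" .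
    then show "((\<lambda>r. abs_prob (x / r)) has_real_derivative - (2 * ((x / r) * std_normal_density (x / r))) / r) (at r within {e..})"
      by (rule DERIV_subset) simp
    have "norm (- (2 * ((x / r) * std_normal_density (x / r))) / r) = (2 * \<bar>(x / r) * std_normal_density (x / r)\<bar>) / r"
      using r0 by (simp add: abs_mult)
    also have "\<dots> \<le> 1 / e"
      using abs_times_std_normal_density_le[of "x / r"] r e by (intro frac_le) auto
    finally show "norm (- (2 * ((x / r) * std_normal_density (x / r))) / r) \<le> 1 / e" .
  qed (use e in auto)
  then show ?thesis by simp
qed

lemma max_mean_ge:
  assumes "0 < s" "0 \<le> x" shows "s / 2 \<le> max_mean s x"
  using mult_left_mono[OF abs_max_mean_ge[of "x / s"], of s] assms by (simp add: max_mean_def)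

lemma max_mean_le:
  assumes "0 < s" "0 \<le> x" shows "max_mean s x \<le> x + s"
proof -
  have "abs_max_mean (x / s) \<le> (x / s) * 1 + 1"
  proof -
    have "0 \<le> x / s" using assms by simp
    then have "x / s * abs_prob (x / s) \<le> x / s * 1"
      by (intro mult_left_mono abs_prob_bounds)
    then show ?thesis
      unfolding abs_max_mean_def using std_normal_density_le[of "x / s"] by linarith
  qed
  then have "s * abs_max_mean (x / s) \<le> s * (x / s + 1)"
    using assms by (intro mult_left_mono) auto
  also have "\<dots> = x + s" using assms by (simp add: field_simps)
  finally show ?thesis by (simp add: max_mean_def)
qed

text \<open>On the nonnegative axis \<open>abs_max_mean y - y\<close> decreases, having derivative
  \<open>abs_prob y - 1\<close>, and it tends to 0.\<close>

lemma abs_max_mean_ge_self: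
  assumes "0 \<le> y" shows "y \<le> abs_max_mean y"
proof -
  have "0 \<le> abs_max_mean y - y"
  proof (rule tendsto_le[OF _ tendsto_const abs_max_mean_minus_lim])
    have "abs_max_mean z - z \<le> abs_max_mean y - y" if "y \<le> z" for z
      using that
    proof (rule DERIV_nonpos_imp_nonincreasing)
      show "\<exists>d. ((\<lambda>y. abs_max_mean y - y) has_real_derivative d) (at x) \<and> d \<le> 0" if "y \<le> x" for x
        using abs_prob_bounds[of x] that assms
        by (intro exI[of _ "abs_prob x - 1"]) (auto intro!: derivative_eq_intros DERIV_abs_max_mean)
    qed
    then show "\<forall>\<^sub>F z in at_top. abs_max_mean z - z \<le> abs_max_mean y - y"
      using eventually_ge_at_top[of y] by (rule eventually_mono[rotated])
  qed simp
  then show ?thesis by simp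
qed

lemma max_mean_ge_self:
  "0 < s \<Longrightarrow> 0 \<le> x \<Longrightarrow> x \<le> max_mean s x"
  using mult_left_mono[OF abs_max_mean_ge_self[of "x / s"], of s] by (auto simp: max_mean_def)

section \<open>The drift in closed form\<close>

lemma Phi_eq_abs_prob: "0 < v \<Longrightarrow> 2 * Phi v x - 1 = abs_prob (x / sqrt v)"
  using Phi_eq_std[of v x] by (simp add: abs_prob_def)

lemma borel_measurable_abs_prob [measurable]: "abs_prob \<in> borel_measurable borel"
  by (intro borel_measurable_continuous_onI continuous_at_imp_continuous_on ballI DERIV_isCont[OF DERIV_abs_prob])

lemma borel_measurable_abs_max_mean [measurable]: "abs_max_mean \<in> borel_measurable borel"
  by (intro borel_measurable_continuous_onI continuous_at_imp_continuous_on ballI DERIV_isCont[OF DERIV_abs_max_mean])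

text \<open>\<open>y - max_mean (sqrt v) y\<close> is an antiderivative of the integrand that
  vanishes at infinity. The result serves twice: for the denominator of the drift and, after
  Tonelli, for the mean in \<open>expectation_max_max_drop\<close>.\<close>

lemma nn_integral_Phi_tail:
  assumes v: "0 < v" and x: "0 \<le> x"
  shows "(\<integral>\<^sup>+ s. ennreal (2 * (1 - Phi v s)) * indicator {x..} s \<partial>lborel) = ennreal (max_mean (sqrt v) x - x)"
proof -
  define \<sigma> where "\<sigma> = sqrt v"
  have s: "0 < \<sigma>" using v by (simp add: \<sigma>_def)
  have eq: "2 * (1 - Phi v y) = 1 - abs_prob (y / \<sigma>)" for y
    using Phi_eq_abs_prob[OF v, of y] by (simp add: \<sigma>_def)
  have "(\<integral>\<^sup>+ y. ennreal (1 - abs_prob (y / \<sigma>)) * indicator {x..} y \<partial>lborel) = 0 - (x - max_mean \<sigma> x)"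
  proof (rule nn_integral_FTC_atLeast)
    show "(\<lambda>y. 1 - abs_prob (y / \<sigma>)) \<in> borel_measurable borel" by simp
    show "((\<lambda>y. y - max_mean \<sigma> y) has_real_derivative 1 - abs_prob (y / \<sigma>)) (at y)" for y
      unfolding max_mean_def using s
      by (auto intro!: derivative_eq_intros DERIV_chain2[OF DERIV_abs_max_mean])
    show "0 \<le> 1 - abs_prob (y / \<sigma>)" if "x \<le> y" for y
      using that x s abs_prob_bounds[of "y / \<sigma>"] by auto
    have "filterlim (\<lambda>y. y / \<sigma>) at_top at_top"
      using s by real_asymp
    from filterlim_compose[OF abs_max_mean_minus_lim this]
    have "((\<lambda>y. - \<sigma> * (abs_max_mean (y / \<sigma>) - y / \<sigma>)) \<longlongrightarrow> - \<sigma> * 0) at_top"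
      by (intro tendsto_intros)
    also have "(\<lambda>y. - \<sigma> * (abs_max_mean (y / \<sigma>) - y / \<sigma>)) = (\<lambda>y. y - max_mean \<sigma> y)"
      using s by (auto simp: max_mean_def right_diff_distrib)
    finally show "((\<lambda>y. y - max_mean \<sigma> y) \<longlongrightarrow> 0) at_top" by simp
  qed
  then show ?thesis by (simp only: eq \<sigma>_def) simp
qed

lemma drift_denominator:
  assumes v: "0 < v" and x: "0 \<le> x"
  shows "x + 2 * (LBINT s:{x..}. 1 - Phi v s) = max_mean (sqrt v) x"
proof -
  have le: "Phi v s \<le> 1" for s
    using real_distribution.cdf_bounded_prob[OF real_distribution_centred_normal[of v]] v
    by (simp add: Phi_def)
  have "mono (Phi v)"
    unfolding Phi_def
    using finite_borel_measure.cdf_nondecreasing[OF real_distribution.finite_borel_measure_M[OF real_distribution_centred_normal[of v]]] v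
    by (auto simp: mono_def)
  then have [measurable]: "Phi v \<in> borel_measurable borel" by (rule borel_measurable_mono)
  let ?I = "LBINT s:{x..}. 2 * (1 - Phi v s)"
  have "?I = enn2real (\<integral>\<^sup>+ s. ennreal (2 * (1 - Phi v s)) * indicator {x..} s \<partial>lborel)"
    unfolding set_lebesgue_integral_def using le
    by (subst integral_eq_nn_integral) (auto simp: ennreal_mult' ac_simps ennreal_indicator indicator_def
      intro!: arg_cong[where f=enn2real] nn_integral_cong)
  also have "\<dots> = max_mean (sqrt v) x - x"
    using max_mean_ge_self[of "sqrt v" x] v x by (subst nn_integral_Phi_tail) auto
  finally have "?I = max_mean (sqrt v) x - x" .
  moreover have "?I = 2 * (LBINT s:{x..}. 1 - Phi v s)"
    by (rule set_integral_mult_right)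
  ultimately show ?thesis by simp
qed


text \<open>The drift coefficient; at \<open>t \<ge> 1\<close> it is \<open>0\<close>, which differs from the drift formula only on a
  null set of times.\<close>

definition drift :: "real \<Rightarrow> real \<Rightarrow> real" where
  "drift t x = (if t < 1 then abs_prob (x / sqrt (1 - t)) / max_mean (sqrt (1 - t)) x else 0)"

lemma drift_formula_eq:
  "t < 1 \<Longrightarrow> 0 \<le> x \<Longrightarrow> drift_formula t x = drift t x"
  using drift_denominator[of "1 - t" x] Phi_eq_abs_prob[of "1 - t" x]
  by (simp only: drift_formula_def drift_def if_True diff_gt_0_iff_gt)

lemma borel_measurable_max_mean [measurable]: "max_mean s \<in> borel_measurable borel"
  unfolding max_mean_def[abs_def] by measurable

lemma borel_measurable_drift [measurable]: "case_prod drift \<in> borel_measurable (borel \<Otimes>\<^sub>M borel)"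
  unfolding drift_def[abs_def] max_mean_def by measurable

lemma drift_nonneg: "0 \<le> x \<Longrightarrow> 0 \<le> drift t x"
  using abs_prob_bounds(1)[of "x / sqrt (1 - t)"] max_mean_ge_self[of "sqrt (1 - t)" x]
  by (cases "t < 1") (simp_all add: drift_def)

text \<open>The parameter \<open>e\<close> has two uses: \<open>e = sqrt (1 - t)\<close> yields a
  bound that is integrable up to time 1, a fixed \<open>e\<close> one that is uniform over a time
  step.\<close>

lemma drift_le:
  assumes "0 \<le> x" "0 < e" "t < 1 \<Longrightarrow> e \<le> sqrt (1 - t)" shows "drift t x \<le> 2 / e"
proof (cases "t < 1")
  case True
  have "e / 2 \<le> max_mean (sqrt (1 - t)) x"
    using max_mean_ge[of "sqrt (1 - t)" x] assms True by auto
  then have "abs_prob (x / sqrt (1 - t)) / max_mean (sqrt (1 - t)) x \<le> 1 / (e / 2)"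
    using abs_prob_bounds[of "x / sqrt (1 - t)"] assms True by (intro frac_le) auto
  then show ?thesis using True by (simp add: drift_def)
qed (use assms in \<open>auto simp: drift_def\<close>)

lemma sqrt_diff_le:
  assumes "0 < e" "e \<le> sqrt a" "e \<le> sqrt b" shows "\<bar>sqrt a - sqrt b\<bar> \<le> \<bar>a - b\<bar> / e"
proof -
  have "0 < sqrt a" "0 < sqrt b" using assms by linarith+
  then have pos: "0 < a" "0 < b" by simp_all
  have "\<bar>sqrt a - sqrt b\<bar> * e \<le> \<bar>sqrt a - sqrt b\<bar> * (sqrt a + sqrt b)"
    using assms pos by (intro mult_left_mono) auto
  also have "\<dots> = \<bar>(sqrt a - sqrt b) * (sqrt a + sqrt b)\<bar>"
    using pos by (simp add: abs_mult)
  also have "(sqrt a - sqrt b) * (sqrt a + sqrt b) = a - b"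
    using pos by (simp add: algebra_simps)
  finally show ?thesis using assms by (simp add: field_simps)
qed

lemma drift_lipschitz:
  assumes e: "0 < e" "e \<le> sqrt (1 - t)" "e \<le> sqrt (1 - t')" and x: "0 \<le> x" "0 \<le> x'"
    and t: "t < 1" "t' < 1"
  shows "\<bar>drift t x - drift t' x'\<bar> \<le> 6 / e\<^sup>2 * (\<bar>sqrt (1 - t) - sqrt (1 - t')\<bar> + \<bar>x - x'\<bar>)"
proof -
  define s s' where "s = sqrt (1 - t)" and "s' = sqrt (1 - t')"
  define a a' b b' where "a = abs_prob (x / s)" and "a' = abs_prob (x' / s')"
    and "b = max_mean s x" and "b' = max_mean s' x'"
  define d where "d = \<bar>s - s'\<bar> + \<bar>x - x'\<bar>"
  have s: "0 < s" "0 < s'" "e \<le> s" "e \<le> s'" using e t by (auto simp: s_def s'_def)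
  have b: "e / 2 \<le> b" "e / 2 \<le> b'"
    using max_mean_ge[of s x] max_mean_ge[of s' x'] s x by (auto simp: b_def b'_def)
  have a': "0 \<le> a'" "a' \<le> 1" using abs_prob_bounds[of "x' / s'"] s x by (auto simp: a'_def)
  have d0: "0 \<le> d" by (simp add: d_def)
  have "\<bar>a - a'\<bar> \<le> \<bar>abs_prob (x / s) - abs_prob (x / s')\<bar> + \<bar>abs_prob (x / s') - abs_prob (x' / s')\<bar>"
    by (simp add: a_def a'_def)
  also have "\<dots> \<le> \<bar>s - s'\<bar> / e + \<bar>x - x'\<bar> / s'"
    using s e by (intro add_mono abs_prob_lipschitz_scale abs_prob_scaled_lipschitz) auto
  also have "\<dots> \<le> \<bar>s - s'\<bar> / e + \<bar>x - x'\<bar> / e"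
    using s e by (intro add_mono divide_left_mono) auto
  finally have aa: "\<bar>a - a'\<bar> \<le> d / e" by (simp add: d_def add_divide_distrib)
  have "\<bar>b - b'\<bar> \<le> \<bar>max_mean s x - max_mean s' x\<bar> + \<bar>max_mean s' x - max_mean s' x'\<bar>"
    by (simp add: b_def b'_def)
  also have "\<dots> \<le> d"
    unfolding d_def using s by (intro add_mono max_mean_lipschitz_scale max_mean_lipschitz) auto
  finally have bb: "\<bar>b - b'\<bar> \<le> d" .
  have pos: "0 < b" "0 < b'" using b e by auto
  have "a / b - a' / b' = (a - a') / b + a' * (b' - b) / (b * b')"
    using pos by (simp add: field_simps)
  then have "\<bar>a / b - a' / b'\<bar> \<le> \<bar>(a - a') / b\<bar> + \<bar>a' * (b' - b) / (b * b')\<bar>"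
    by (simp only: abs_triangle_ineq)
  also have "\<dots> = \<bar>a - a'\<bar> / b + a' * \<bar>b - b'\<bar> / (b * b')"
    using pos a' by (simp add: abs_mult abs_minus_commute)
  \<comment> \<open>The numerators differ by at most \<open>d / e\<close>, the denominators by at
    most \<open>d\<close>, and the denominators are at least \<open>e / 2\<close>. The two terms
    contribute 2 and 4 to the constant 6.\<close>
  also have "\<dots> \<le> (d / e) / (e / 2) + (1 * d) / ((e / 2) * (e / 2))"
    using pos a' b e aa bb d0 by (intro add_mono frac_le mult_mono mult_pos_pos) simp_all
  also have "\<dots> = 6 / e\<^sup>2 * d" using e by (simp add: field_simps power2_eq_square)
  finally show ?thesis
    using t by (simp add: drift_def a_def a'_def b_def b'_def s_def s'_def d_def)
qed

section \<open>Paths and their running minimum\<close>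

text \<open>Only increments of \<open>f\<close> from time \<open>a\<close> on enter. For Brownian
  motion this makes the quantity independent of the past, and the reflection principle gives its
  law.\<close>

definition max_drop :: "(real \<Rightarrow> real) \<Rightarrow> real \<Rightarrow> real \<Rightarrow> real" where
  "max_drop f a b = (SUP u\<in>{a..b}. f a - f u)"

lemma max_drop_cong:
  assumes "\<And>u. u \<in> {a..b} \<Longrightarrow> f u = g u" "a \<le> b" shows "max_drop f a b = max_drop g a b"
  unfolding max_drop_def using assms by (intro SUP_cong) auto

lemma bdd_above_drop:
  fixes f :: "real \<Rightarrow> real"
  assumes "continuous_on {a..b} f" shows "bdd_above ((\<lambda>u. c - f u) ` {a..b})"
proof -
  have "continuous_on {a..b} (\<lambda>u. c - f u)" using assms by (intro continuous_intros)
  then have "compact ((\<lambda>u. c - f u) ` {a..b})" by (intro compact_continuous_image) auto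
  then show ?thesis by (intro bounded_imp_bdd_above compact_imp_bounded)
qed

lemma less_max_drop_iff:
  assumes "continuous_on {a..b} f" "a \<le> b"
  shows "c < max_drop f a b \<longleftrightarrow> (\<exists>u\<in>{a..b}. c < f a - f u)"
  unfolding max_drop_def using assms by (intro less_cSUP_iff bdd_above_drop) auto

lemma max_drop_le_iff:
  assumes "continuous_on {a..b} f" "a \<le> b"
  shows "max_drop f a b \<le> c \<longleftrightarrow> (\<forall>u\<in>{a..b}. f a - f u \<le> c)"
  using less_max_drop_iff[OF assms, of c] by (meson not_le)

lemma drop_le_max_drop:
  assumes "continuous_on {a..b} f" "u \<in> {a..b}" shows "f a - f u \<le> max_drop f a b"
  using max_drop_le_iff[OF assms(1), of "max_drop f a b"] assms(2) by auto

lemma max_drop_nonneg: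
  assumes "continuous_on {a..b} f" "a \<le> b" shows "0 \<le> max_drop f a b"
  using drop_le_max_drop[of a b f a] assms by auto

lemma max_drop_mono:
  assumes "continuous_on {a..c} f" "a \<le> b" "b \<le> c" shows "max_drop f a b \<le> max_drop f a c"
proof -
  have "continuous_on {a..b} f" using assms(1) by (rule continuous_on_subset) (use assms in auto)
  then show ?thesis
    using assms by (auto simp: max_drop_le_iff intro!: drop_le_max_drop)
qed

text \<open>Both sides are shown to have the same upper bounds, by splitting the supremum at
  \<open>b\<close>.\<close>

lemma max_drop_split:
  assumes f: "continuous_on {a..c} f" and "a \<le> b" "b \<le> c"
  shows "max_drop f a c = max (max_drop f a b) (f a - f b + max_drop f b c)"
proof -
  have c: "continuous_on {a..b} f" "continuous_on {b..c} f"
    using f by (rule continuous_on_subset; use assms in auto)+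
  have un: "{a..c} = {a..b} \<union> {b..c}" using assms by auto
  have le: "max_drop f a c \<le> x \<longleftrightarrow> max (max_drop f a b) (f a - f b + max_drop f b c) \<le> x" for x
  proof -
    have "max_drop f b c \<le> x - (f a - f b) \<longleftrightarrow> (\<forall>u\<in>{b..c}. f b - f u \<le> x - (f a - f b))"
      using c assms by (intro max_drop_le_iff) auto
    then have "f a - f b + max_drop f b c \<le> x \<longleftrightarrow> (\<forall>u\<in>{b..c}. f a - f u \<le> x)"
      by (simp add: algebra_simps)
    then show ?thesis
      using assms c by (simp add: max_drop_le_iff un ball_Un)
  qed
  show ?thesis using le[of "max_drop f a c"] le[of "max (max_drop f a b) (f a - f b + max_drop f b c)"]
    by (meson antisym order_refl)
qed

text \<open>For continuous paths this is the height above the running minimum. It is written through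
  increments, so that a vertical shift of the path has no effect.\<close>

definition above_min :: "(real \<Rightarrow> real) \<Rightarrow> real \<Rightarrow> real" where
  "above_min f t = f t - f 0 + max_drop f 0 t"

lemma above_min_eq:
  assumes "continuous_on {0..t} f" "0 \<le> t" shows "f t - (INF u\<in>{0..t}. f u) = above_min f t"
proof -
  have "max_drop f 0 t = - (INF u\<in>{0..t}. f u - f 0)"
    unfolding max_drop_def Inf_real_def by (simp add: image_image)
  also have "(INF u\<in>{0..t}. f u - f 0) = (INF u\<in>{0..t}. f u) - f 0"
  proof (rule antisym)
    obtain s where s: "s \<in> {0..t}" "\<forall>r\<in>{0..t}. f s \<le> f r"
      using continuous_attains_inf[of "{0..t}" f] assms by auto
    have "(INF u\<in>{0..t}. f u) = f s" "(INF u\<in>{0..t}. f u - f 0) = f s - f 0"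
      using s by (auto intro!: cInf_eq_minimum)
    then show "(INF u\<in>{0..t}. f u - f 0) \<le> (INF u\<in>{0..t}. f u) - f 0"
        "(INF u\<in>{0..t}. f u) - f 0 \<le> (INF u\<in>{0..t}. f u - f 0)" by auto
  qed
  finally show ?thesis by (simp add: above_min_def)
qed

lemma above_min_nonneg:
  assumes "continuous_on {0..t} f" "0 \<le> t" shows "0 \<le> above_min f t"
  using drop_le_max_drop[of 0 t f t] assms by (auto simp: above_min_def)

text \<open>A Lindley-type recursion: the past up to \<open>t\<close> enters only through
  \<open>above_min f t\<close>, and the rest consists of increments after \<open>t\<close>. It is
  the Markov property of the reflected path in deterministic form.\<close>

lemma above_min_step:
  assumes "continuous_on {0..r} f" "0 \<le> t" "t \<le> r"
  shows "above_min f r = f r - f t + max (above_min f t) (max_drop f t r)"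
  using max_drop_split[of 0 r f t] assms by (auto simp: above_min_def max_def)

section \<open>Grid approximation and joint measurability\<close>

lemma grid_point_in:
  fixes a b :: real
  assumes "a \<le> b" "k \<le> n"
  shows "a + (b - a) * (real k / real n) \<in> {a..b}"
proof -
  have "real k / real n \<le> 1" "0 \<le> real k / real n" using assms(2) by (auto simp: divide_le_eq_1)
  then have "(b - a) * (real k / real n) \<le> (b - a) * 1" "0 \<le> (b - a) * (real k / real n)"
    using assms(1) by (intro mult_left_mono mult_nonneg_nonneg; simp)+
  then show ?thesis by simp
qed

lemma floor_grid_tendsto:
  fixes x :: real
  shows "(\<lambda>n. of_int \<lfloor>real n * x\<rfloor> / real n) \<longlonglongrightarrow> x"
proof (rule tendsto_sandwich[of "\<lambda>n. x - 1 / real n" _ _ "\<lambda>n. x"])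
  have "x - 1 / real n \<le> of_int \<lfloor>real n * x\<rfloor> / real n \<and> of_int \<lfloor>real n * x\<rfloor> / real n \<le> x" if "0 < n" for n
  proof -
    have "real n * x - 1 \<le> of_int \<lfloor>real n * x\<rfloor>" "of_int \<lfloor>real n * x\<rfloor> \<le> real n * x" by linarith+
    from this[THEN divide_right_mono, of "real n"] that show ?thesis
      by (simp add: diff_divide_distrib)
  qed
  then have "\<forall>\<^sub>F n in sequentially. x - 1 / real n \<le> of_int \<lfloor>real n * x\<rfloor> / real n \<and>
      of_int \<lfloor>real n * x\<rfloor> / real n \<le> x"
    by (rule eventually_mono[OF eventually_gt_at_top[of 0]])
  then show "\<forall>\<^sub>F n in sequentially. x - 1 / real n \<le> of_int \<lfloor>real n * x\<rfloor> / real n"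
    "\<forall>\<^sub>F n in sequentially. of_int \<lfloor>real n * x\<rfloor> / real n \<le> x"
    by (simp_all add: eventually_conj_iff)
  show "(\<lambda>n. x - 1 / real n) \<longlonglongrightarrow> x" by real_asymp
qed auto

text \<open>By continuity a strict inequality at one point survives at nearby grid points. The
  \<open>eventually\<close> form gives convergence of probabilities along grids, the countable
  existential form gives measurability.\<close>

lemma max_drop_eq_grid:
  assumes f: "continuous_on {a..b} f" and ab: "a \<le> b"
  shows "c < max_drop f a b \<longleftrightarrow> (\<forall>\<^sub>F n in sequentially. \<exists>k\<in>{..n}. c < f a - f (a + (b - a) * (real k / real n)))" (is "?A")
    and "c < max_drop f a b \<longleftrightarrow> (\<exists>n. \<exists>k\<in>{..n}. c < f a - f (a + (b - a) * (real k / real n)))" (is "?B")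
proof -
  note in_ab = grid_point_in[OF ab]
  have ev: "\<forall>\<^sub>F n in sequentially. \<exists>k\<in>{..n}. c < f a - f (a + (b - a) * (real k / real n))"
    if "c < max_drop f a b"
  proof -
    from that obtain u where u: "u \<in> {a..b}" "c < f a - f u"
      using less_max_drop_iff[OF f ab] by auto
    \<comment> \<open>If \<open>a = b\<close>, division by zero makes \<open>q = 0\<close>, and
      \<open>u = a + (b - a) * q\<close> still holds because \<open>u = a\<close>.\<close>
    define q where "q = (u - a) / (b - a)"
    have q: "0 \<le> q" "q \<le> 1" "u = a + (b - a) * q"
      using u by (auto simp: q_def divide_le_eq_1)
    define k where "k n = nat \<lfloor>real n * q\<rfloor>" for n
    have k: "k n \<le> n" for n
    proof -
      have "\<lfloor>real n * q\<rfloor> \<le> \<lfloor>real n * 1\<rfloor>" using q by (intro floor_mono mult_left_mono) auto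
      then show ?thesis by (auto simp: k_def)
    qed
    have "(\<lambda>n. real (k n) / real n) \<longlonglongrightarrow> q"
      using floor_grid_tendsto[of q] q by (simp add: k_def)
    then have "(\<lambda>n. a + (b - a) * (real (k n) / real n)) \<longlonglongrightarrow> u"
      unfolding q(3) by (intro tendsto_intros)
    then have "(\<lambda>n. f (a + (b - a) * (real (k n) / real n))) \<longlonglongrightarrow> f u"
      using u in_ab[OF k] by (intro continuous_on_tendsto_compose[OF f]) auto
    then have "(\<lambda>n. f a - f (a + (b - a) * (real (k n) / real n))) \<longlonglongrightarrow> f a - f u"
      by (intro tendsto_intros)
    from order_tendstoD(1)[OF this u(2)] show ?thesis
      by eventually_elim (use k in auto)
  qed
  have conv: "c < max_drop f a b" if "\<exists>n. \<exists>k\<in>{..n}. c < f a - f (a + (b - a) * (real k / real n))"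
    using that less_max_drop_iff[OF f ab] in_ab by blast
  show "?A" "?B"
    using ev conv eventually_happens'[OF sequentially_bot] by blast+
qed

text \<open>Rounding the time down to the grid of mesh \<open>1 / n\<close> leaves countably many
  measurable pieces, and these approximations converge by continuity. Clamping the time to
  \<open>{0..T}\<close> keeps all evaluations inside the range where \<open>F\<close> is measurable
  for \<open>G\<close>.\<close>

lemma borel_measurable_stopped_process:
  fixes F :: "real \<Rightarrow> 'a \<Rightarrow> real"
  assumes F: "\<And>u. u \<in> {0..T} \<Longrightarrow> F u \<in> borel_measurable G"
    and cont: "\<And>\<omega>. \<omega> \<in> space G \<Longrightarrow> continuous_on {0..T} (\<lambda>u. F u \<omega>)" and T: "0 \<le> T"
  shows "(\<lambda>(s, \<omega>). F (max 0 (min T s)) \<omega>) \<in> borel_measurable (borel \<Otimes>\<^sub>M G)"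
proof -
  let ?r = "\<lambda>n s. of_int \<lfloor>real n * s\<rfloor> / real n"
  have meas: "(\<lambda>(s, \<omega>). F (max 0 (min T (?r n s))) \<omega>) \<in> borel_measurable (borel \<Otimes>\<^sub>M G)" for n
  proof -
    have F': "(\<lambda>x. F (max 0 (min T (of_int i / real n))) (snd x)) \<in> borel_measurable (borel \<Otimes>\<^sub>M G)" for i :: int
      by (rule measurable_compose[OF measurable_snd]) (use T in \<open>auto intro!: F\<close>)
    have "(\<lambda>x. F (max 0 (min T (?r n (fst x)))) (snd x)) \<in> borel_measurable (borel \<Otimes>\<^sub>M G)"
      by (rule measurable_compose_countable[where g="\<lambda>x. \<lfloor>real n * fst x\<rfloor>", OF F']) measurable
    then show ?thesis by (simp add: case_prod_beta')
  qed
  have lim: "(\<lambda>n. (\<lambda>(s, \<omega>). F (max 0 (min T (?r n s))) \<omega>) x) \<longlonglongrightarrow> (\<lambda>(s, \<omega>). F (max 0 (min T s)) \<omega>) x"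
    if "x \<in> space (borel \<Otimes>\<^sub>M G)" for x
  proof -
    from that have x: "snd x \<in> space G" by (auto simp: space_pair_measure)
    have "(\<lambda>n. ?r n (fst x)) \<longlonglongrightarrow> fst x" by (rule floor_grid_tendsto)
    then have "(\<lambda>n. max 0 (min T (?r n (fst x)))) \<longlonglongrightarrow> max 0 (min T (fst x))"
      by (intro tendsto_intros)
    then have "(\<lambda>n. F (max 0 (min T (?r n (fst x)))) (snd x)) \<longlonglongrightarrow> F (max 0 (min T (fst x))) (snd x)"
      using T by (intro continuous_on_tendsto_compose[OF cont[OF x]]) auto
    then show ?thesis
      by (simp add: case_prod_beta')
  qed
  show ?thesis by (rule borel_measurable_LIMSEQ_metric[OF meas lim])
qed

text \<open>Measurability is asked of increments only, since for the sigma-algebra of future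
  increments the values of the process itself are in general not measurable.\<close>

lemma borel_measurable_max_drop:
  fixes F :: "real \<Rightarrow> 'a \<Rightarrow> real"
  assumes F: "\<And>u. u \<in> {a..b} \<Longrightarrow> (\<lambda>\<omega>. F a \<omega> - F u \<omega>) \<in> borel_measurable G"
    and cont: "\<And>\<omega>. \<omega> \<in> space G \<Longrightarrow> continuous_on {a..b} (\<lambda>u. F u \<omega>)" and ab: "a \<le> b"
  shows "(\<lambda>\<omega>. max_drop (\<lambda>u. F u \<omega>) a b) \<in> borel_measurable G"
proof (rule borel_measurable_iff_greater[THEN iffD2], rule allI)
  fix c
  note in_ab = grid_point_in[OF ab]
  have "{\<omega> \<in> space G. c < max_drop (\<lambda>u. F u \<omega>) a b} =
      (\<Union>n. \<Union>k\<in>{..n}. {\<omega> \<in> space G. c < F a \<omega> - F (a + (b - a) * (real k / real n)) \<omega>})"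
    by (intro set_eqI) (use max_drop_eq_grid(2)[OF cont ab] in blast)
  also have "\<dots> \<in> sets G"
    using F[OF in_ab] by (intro sets.countable_UN' sets.finite_UN) (auto intro!: borel_measurable_less)
  finally show "{\<omega> \<in> space G. c < max_drop (\<lambda>u. F u \<omega>) a b} \<in> sets G" .
qed

text \<open>The grid of the interval from 0 to \<open>s\<close> moves with \<open>s\<close>, so each
  grid value is a composition with the jointly measurable stopped process.\<close>

lemma borel_measurable_stopped_above_min:
  fixes F :: "real \<Rightarrow> 'a \<Rightarrow> real"
  assumes F: "\<And>u. u \<in> {0..T} \<Longrightarrow> F u \<in> borel_measurable G"
    and cont: "\<And>\<omega>. \<omega> \<in> space G \<Longrightarrow> continuous_on {0..T} (\<lambda>u. F u \<omega>)" and T: "0 \<le> T"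
  shows "(\<lambda>(s, \<omega>). above_min (\<lambda>u. F u \<omega>) (max 0 (min T s))) \<in> borel_measurable (borel \<Otimes>\<^sub>M G)"
proof -
  note [measurable] = borel_measurable_stopped_process[OF F cont T, unfolded case_prod_beta']
  have ms: "(\<lambda>x. F (max 0 (min T (g x))) (snd x)) \<in> borel_measurable (borel \<Otimes>\<^sub>M G)"
    if [measurable]: "g \<in> borel_measurable (borel \<Otimes>\<^sub>M G)" for g
  proof -
    have "(\<lambda>x. (g x, snd x)) \<in> measurable (borel \<Otimes>\<^sub>M G) (borel \<Otimes>\<^sub>M G)" by measurable
    from measurable_compose[OF this borel_measurable_stopped_process[OF F cont T]]
    show ?thesis by simp
  qed
  have "(\<lambda>x. max_drop (\<lambda>u. F (max 0 (min T u)) (snd x)) 0 (max 0 (min T (fst x)))) \<in> borel_measurable (borel \<Otimes>\<^sub>M G)"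
  proof (rule borel_measurable_iff_greater[THEN iffD2], rule allI)
    fix c
    have c: "continuous_on {0..max 0 (min T s)} (\<lambda>u. F (max 0 (min T u)) \<omega>)" if "\<omega> \<in> space G" for s \<omega>
      using cont[OF that] T
      by (intro continuous_on_compose2[OF cont[OF that], where f="\<lambda>u. max 0 (min T u)"] continuous_intros) auto
    have "{x \<in> space (borel \<Otimes>\<^sub>M G). c < max_drop (\<lambda>u. F (max 0 (min T u)) (snd x)) 0 (max 0 (min T (fst x)))} =
      (\<Union>n. \<Union>k\<in>{..n}. {x \<in> space (borel \<Otimes>\<^sub>M G). c < F (max 0 (min T 0)) (snd x) -
         F (max 0 (min T (0 + (max 0 (min T (fst x)) - 0) * (real k / real n)))) (snd x)})"
    proof -
      have "c < max_drop (\<lambda>u. F (max 0 (min T u)) (snd x)) 0 (max 0 (min T (fst x))) \<longleftrightarrow>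
        (\<exists>n. \<exists>k\<in>{..n}. c < F (max 0 (min T 0)) (snd x) -
         F (max 0 (min T (0 + (max 0 (min T (fst x)) - 0) * (real k / real n)))) (snd x))"
        if "x \<in> space (borel \<Otimes>\<^sub>M G)" for x
        by (rule max_drop_eq_grid(2)[OF c]) (use that in \<open>auto simp: space_pair_measure\<close>)
      then show ?thesis by blast
    qed
    also have "\<dots> \<in> sets (borel \<Otimes>\<^sub>M G)"
      by (intro sets.countable_UN image_subsetI borel_measurable_less borel_measurable_diff ms) auto
    finally show "{x \<in> space (borel \<Otimes>\<^sub>M G). c < max_drop (\<lambda>u. F (max 0 (min T u)) (snd x)) 0 (max 0 (min T (fst x)))}
      \<in> sets (borel \<Otimes>\<^sub>M G)" .
  qed
  moreover have "max_drop (\<lambda>u. F (max 0 (min T u)) \<omega>) 0 (max 0 (min T s)) = max_drop (\<lambda>u. F u \<omega>) 0 (max 0 (min T s))" for s \<omega>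
  proof -
    have "max 0 (min T u) = u" if "u \<in> {0..max 0 (min T s)}" for u
    proof -
      have "max 0 (min T s) \<le> T" using T by simp
      then show ?thesis using that by (auto simp: max_absorb2 min_absorb2)
    qed
    then show ?thesis by (intro max_drop_cong) auto
  qed
  ultimately have [measurable]: "(\<lambda>x. max_drop (\<lambda>u. F u (snd x)) 0 (max 0 (min T (fst x)))) \<in> borel_measurable (borel \<Otimes>\<^sub>M G)"
    by (simp only:)
  have [measurable]: "(\<lambda>x. F 0 (snd x)) \<in> borel_measurable (borel \<Otimes>\<^sub>M G)"
    using F T by (intro measurable_compose[OF measurable_snd]) auto
  show ?thesis
    unfolding above_min_def case_prod_beta' by measurable
qed

section \<open>Independence of past and future\<close>

lemma sets_Collect_mem:
  assumes "f \<in> measurable N T" "A \<in> sets T" shows "{x \<in> space N. f x \<in> A} \<in> sets N"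
proof -
  have "f -` A \<inter> space N \<in> sets N" using assms by (rule measurable_sets)
  then show ?thesis by (simp add: vimage_def Int_def conj_commute)
qed

lemma borel_measurable_sum_coordinates:
  assumes "J \<subseteq> K"
  shows "(\<lambda>p. \<Sum>i\<in>J. p i :: real) \<in> borel_measurable (PiM K (\<lambda>_. borel))"
proof -
  have "(\<lambda>p. p i) \<in> borel_measurable (PiM K (\<lambda>_. borel :: real measure))" if "i \<in> J" for i
    using that assms by (intro measurable_component_singleton) auto
  from borel_measurable_sum[where f="\<lambda>i p. p i", OF this] show ?thesis by simp
qed

text \<open>Conditions on finitely many coordinates at once, so that the generating family is closed
  under intersection, as the extension of independence to sigma-algebras requires.\<close>

definition finite_cylinders :: "'a measure \<Rightarrow> (real \<Rightarrow> 'a \<Rightarrow> real) \<Rightarrow> real set \<Rightarrow> 'a set set" where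
  "finite_cylinders M F I =
     {{\<omega> \<in> space M. \<forall>j\<in>J. F j \<omega> \<in> X j} | J X. finite J \<and> J \<subseteq> I \<and> (\<forall>j. X j \<in> sets borel)}"

definition generated :: "'a measure \<Rightarrow> (real \<Rightarrow> 'a \<Rightarrow> real) \<Rightarrow> real set \<Rightarrow> 'a measure" where
  "generated M F I = sigma (space M) (finite_cylinders M F I)"

lemma finite_cylinders_Pow: "finite_cylinders M F I \<subseteq> Pow (space M)"
  by (auto simp: finite_cylinders_def)

lemma space_generated [simp]: "space (generated M F I) = space M"
  by (simp add: generated_def space_measure_of_conv)

lemma sets_generated: "sets (generated M F I) = sigma_sets (space M) (finite_cylinders M F I)"
  by (simp add: generated_def sets_measure_of finite_cylinders_Pow)

lemma Int_stable_finite_cylinders: "Int_stable (finite_cylinders M F I)"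
proof (rule Int_stableI)
  fix a b assume "a \<in> finite_cylinders M F I" "b \<in> finite_cylinders M F I"
  then obtain J X J' X' where
    J: "a = {\<omega> \<in> space M. \<forall>j\<in>J. F j \<omega> \<in> X j}" "finite J" "J \<subseteq> I" "\<forall>j. X j \<in> sets borel" and
    J': "b = {\<omega> \<in> space M. \<forall>j\<in>J'. F j \<omega> \<in> X' j}" "finite J'" "J' \<subseteq> I" "\<forall>j. X' j \<in> sets borel"
    by (auto simp: finite_cylinders_def)
  let ?Y = "\<lambda>j. (if j \<in> J then X j else UNIV) \<inter> (if j \<in> J' then X' j else UNIV)"
  have "a \<inter> b = {\<omega> \<in> space M. \<forall>j\<in>J \<union> J'. F j \<omega> \<in> ?Y j}"
    using J(1) J'(1) by auto
  moreover have "\<forall>j. ?Y j \<in> sets borel" using J J' by auto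
  ultimately show "a \<inter> b \<in> finite_cylinders M F I"
    unfolding finite_cylinders_def using J J' by (intro CollectI exI[of _ "J \<union> J'"] exI[of _ ?Y]) auto
qed

lemma measurable_generated:
  assumes "u \<in> I" shows "F u \<in> borel_measurable (generated M F I)"
proof (rule measurableI)
  fix A :: "real set" assume A: "A \<in> sets borel"
  have "F u -` A \<inter> space (generated M F I) = {\<omega> \<in> space M. \<forall>j\<in>{u}. F j \<omega> \<in> (\<lambda>_. A) j}" by auto
  also have "\<dots> \<in> finite_cylinders M F I"
    unfolding finite_cylinders_def using A assms by (intro CollectI exI[of _ "{u}"] exI[of _ "\<lambda>_. A"]) auto
  finally show "F u -` A \<inter> space (generated M F I) \<in> sets (generated M F I)"
    by (auto simp: sets_generated)
qed simp

lemma sets_generated_subset: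
  assumes "space N = space M" "\<And>u. u \<in> I \<Longrightarrow> F u \<in> borel_measurable N"
  shows "sets (generated M F I) \<subseteq> sets N"
  unfolding sets_generated assms(1)[symmetric]
proof (rule sets.sigma_sets_subset, rule subsetI)
  fix a assume "a \<in> finite_cylinders M F I"
  then obtain J X where
    J: "a = {\<omega> \<in> space M. \<forall>j\<in>J. F j \<omega> \<in> X j}" "finite J" "J \<subseteq> I" "\<forall>j. X j \<in> sets borel"
    by (auto simp: finite_cylinders_def)
  have "{\<omega> \<in> space N. F j \<omega> \<in> X j} \<in> sets N" if "j \<in> J" for j
    using that J by (intro sets_Collect_mem[OF assms(2)]) auto
  then have "{\<omega> \<in> space N. \<forall>j\<in>J. F j \<omega> \<in> X j} \<in> sets N"
    using J by (intro sets.sets_Collect_finite_All) auto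
  then show "a \<in> sets N" using J assms(1) by simp
qed

lemma measurable_from_generated:
  assumes "f \<in> measurable (generated M F I) T" "space N = space M" "\<And>u. u \<in> I \<Longrightarrow> F u \<in> borel_measurable N"
  shows "f \<in> measurable N T"
  by (rule subsetD[OF measurable_mono[of T T "generated M F I" N] assms(1)])
    (use assms(2) sets_generated_subset[OF assms(2,3)] in simp_all)

text \<open>The starting value is 0 everywhere rather than almost surely, so that each
  \<open>B j\<close> equals a sum of increments on the whole space. A general Brownian motion is
  reduced to this case by subtracting \<open>B 0\<close>.\<close>

locale brownian_from_0 = prob_space M for M :: "'a measure" +
  fixes B :: "real \<Rightarrow> 'a \<Rightarrow> real"
  assumes bm: "brownian_motion M B" and B_0: "\<And>\<omega>. \<omega> \<in> space M \<Longrightarrow> B 0 \<omega> = 0"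
begin

lemma B_measurable: "t \<in> {0..1} \<Longrightarrow> B t \<in> borel_measurable M"
  using bm by (auto simp: brownian_motion_def continuous_process_def)

lemma B_continuous: "\<omega> \<in> space M \<Longrightarrow> I \<subseteq> {0..1} \<Longrightarrow> continuous_on I (\<lambda>t. B t \<omega>)"
  using bm continuous_on_subset[of "{0..1}" "\<lambda>t. B t \<omega>" I] by (simp add: brownian_motion_def continuous_process_def)

lemma B_increment: "0 \<le> s \<Longrightarrow> s < t \<Longrightarrow> t \<le> 1 \<Longrightarrow>
    distributed M lborel (\<lambda>\<omega>. B t \<omega> - B s \<omega>) (normal_density 0 (sqrt (t - s)))"
  using bm by (auto simp: brownian_motion_def)

definition past :: "real \<Rightarrow> 'a measure" where
  "past t = generated M B {0..t}"

definition future :: "real \<Rightarrow> 'a measure" where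
  "future t = generated M (\<lambda>u \<omega>. B u \<omega> - B t \<omega>) {t..1}"

lemma space_past [simp]: "space (past t) = space M" and space_future [simp]: "space (future t) = space M"
  by (simp_all add: past_def future_def)

lemma B_past: "0 \<le> u \<Longrightarrow> u \<le> t \<Longrightarrow> B u \<in> borel_measurable (past t)"
  unfolding past_def by (rule measurable_generated) auto

lemma B_future: "t \<le> u \<Longrightarrow> u \<le> 1 \<Longrightarrow> (\<lambda>\<omega>. B u \<omega> - B t \<omega>) \<in> borel_measurable (future t)"
  unfolding future_def by (rule measurable_generated[of u "{t..1}" "\<lambda>u \<omega>. B u \<omega> - B t \<omega>"]) auto

lemma past_mono: "f \<in> measurable (past s) T \<Longrightarrow> s \<le> t \<Longrightarrow> f \<in> measurable (past t) T"
  unfolding past_def[of s] by (erule measurable_from_generated) (auto intro: B_past)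

lemma past_measurable: "f \<in> measurable (past s) T \<Longrightarrow> s \<le> 1 \<Longrightarrow> f \<in> measurable M T"
  unfolding past_def by (erule measurable_from_generated) (auto intro: B_measurable)

lemma future_measurable: "f \<in> measurable (future s) T \<Longrightarrow> 0 \<le> s \<Longrightarrow> s \<le> 1 \<Longrightarrow> f \<in> measurable M T"
  unfolding future_def by (erule measurable_from_generated) (auto intro!: borel_measurable_diff B_measurable)

text \<open>Independence of increments is available along increasing time sequences, whereas a
  cylinder comes with an unordered finite set of times.\<close>

lemma sorted_partition:
  fixes L :: "real set"
  assumes L: "finite L" "L \<subseteq> {0..1}" "0 \<in> L"
  obtains \<tau> :: "nat \<Rightarrow> real" and n where "\<tau> ` {..n} = L" "strict_mono_on {..n} \<tau>" "\<tau> 0 = 0"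
proof -
  define xs where "xs = sorted_list_of_set L"
  have xs: "set xs = L" "sorted_wrt (<) xs" using L by (auto simp: xs_def)
  have ne: "xs \<noteq> []" using xs L by auto
  have "(\<lambda>i. xs ! i) ` {..length xs - 1} = L"
  proof -
    have "{..length xs - 1} = {0..<length xs}" using ne by (cases xs) auto
    then show ?thesis using xs(1) nth_image[of "length xs" xs] by simp
  qed
  moreover have "strict_mono_on {..length xs - 1} (\<lambda>i. xs ! i)"
  proof (rule strict_mono_onI)
    fix r s assume "r \<in> {..length xs - 1}" "s \<in> {..length xs - 1}" "r < s"
    moreover from this have "s < length xs" using ne by (cases xs) auto
    ultimately show "xs ! r < xs ! s" using xs(2) by (simp add: sorted_wrt_iff_nth_less)
  qed
  moreover have "xs ! 0 = 0"
  proof -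
    obtain i where i: "i < length xs" "xs ! i = 0" using L xs by (metis in_set_conv_nth)
    have "xs ! 0 \<in> {0..1}" using L xs ne by (metis length_greater_0_conv nth_mem subsetD)
    moreover have "xs ! 0 \<le> xs ! i"
    proof (cases "i = 0")
      case False
      then have "xs ! 0 < xs ! i" using xs(2) i(1) by (auto simp only: sorted_wrt_iff_nth_less)
      then show ?thesis by simp
    qed simp
    ultimately show ?thesis using i by auto
  qed
  ultimately show ?thesis by (rule that)
qed

text \<open>Cylinders suffice. On a common time grid a past cylinder is a condition on the
  increments before \<open>t\<close>, a future cylinder one on the increments after
  \<open>t\<close>, and these are disjoint blocks of an independent family.\<close>

lemma indep_past_future:
  assumes t: "0 \<le> t" "t \<le> 1"
  shows "indep_set (sets (past t)) (sets (future t))"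
  unfolding past_def future_def sets_generated
proof (intro indep_set_sigma_sets Int_stable_finite_cylinders indep_setI)
  have "sets (past t) \<subseteq> events"
    using t unfolding past_def by (intro sets_generated_subset) (auto intro: B_measurable)
  then show "finite_cylinders M B {0..t} \<subseteq> events"
    by (auto simp: past_def sets_generated)
  have "sets (future t) \<subseteq> events"
    using t unfolding future_def by (intro sets_generated_subset) (auto intro!: borel_measurable_diff B_measurable)
  then show "finite_cylinders M (\<lambda>u \<omega>. B u \<omega> - B t \<omega>) {t..1} \<subseteq> events"
    by (auto simp: future_def sets_generated)
  fix a b
  assume "a \<in> finite_cylinders M B {0..t}"
  then obtain J X where
    J: "a = {\<omega> \<in> space M. \<forall>j\<in>J. B j \<omega> \<in> X j}" "finite J" "J \<subseteq> {0..t}" and X [measurable]: "\<And>j. X j \<in> sets borel"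
    by (auto simp: finite_cylinders_def)
  assume "b \<in> finite_cylinders M (\<lambda>u \<omega>. B u \<omega> - B t \<omega>) {t..1}"
  then obtain K Y where
    K: "b = {\<omega> \<in> space M. \<forall>j\<in>K. B j \<omega> - B t \<omega> \<in> Y j}" "finite K" "K \<subseteq> {t..1}" and Y [measurable]: "\<And>j. Y j \<in> sets borel"
    by (auto simp: finite_cylinders_def)
  \<comment> \<open>Including 0 makes the increments telescope to \<open>B j\<close>; including
    \<open>t\<close> makes the cut between past and future a grid point.\<close>
  let ?L = "J \<union> K \<union> {0, t}"
  have L: "finite ?L" "?L \<subseteq> {0..1}" "0 \<in> ?L" using J K t by auto
  obtain \<tau> :: "nat \<Rightarrow> real" and n where \<tau>: "\<tau> ` {..n} = ?L" "strict_mono_on {..n} \<tau>" "\<tau> 0 = 0"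
    using L by (rule sorted_partition)
  have mono: "\<tau> i < \<tau> j \<longleftrightarrow> i < j" if "i \<le> n" "j \<le> n" for i j
    using strict_mono_on_less[OF \<tau>(2)] that by auto
  have "\<exists>i. i \<le> n \<and> \<tau> i = x" if "x \<in> ?L" for x
    using that unfolding \<tau>(1)[symmetric] by auto
  then obtain idx where idx: "\<And>x. x \<in> ?L \<Longrightarrow> idx x \<le> n \<and> \<tau> (idx x) = x" by metis
  define m where "m = idx t"
  have m: "m \<le> n" "\<tau> m = t" using idx[of t] by (auto simp: m_def)
  have idxJ: "idx j \<le> m" if "j \<in> J" for j
    using mono[of m "idx j"] idx[of j] that J(3) m by fastforce
  have idxK: "m \<le> idx j" if "j \<in> K" for j
    using mono[of "idx j" m] idx[of j] that K(3) m by fastforce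
  let ?I = "\<lambda>i \<omega>. B (\<tau> (Suc i)) \<omega> - B (\<tau> i) \<omega>"
  have "\<tau> i \<in> {0..1}" if "i \<le> n" for i
  proof -
    have "\<tau> i \<in> ?L" using \<tau>(1) that by blast
    then show ?thesis using J K t by auto
  qed
  moreover have "\<tau> i \<le> \<tau> (Suc i)" if "i < n" for i using mono[of i "Suc i"] that by auto
  ultimately have ind: "indep_vars (\<lambda>_. borel) ?I {..<n}"
    using bm unfolding brownian_motion_def by blast
  \<comment> \<open>The cylinders expressed by increments: partial sums started at time 0 for the
    past, at time \<open>t\<close> for the future.\<close>
  define P where "P = {p \<in> space (PiM {..<m} (\<lambda>_. borel)). \<forall>j\<in>J. (\<Sum>i<idx j. p i :: real) \<in> X j}"
  define Q where "Q = {p \<in> space (PiM {m..<n} (\<lambda>_. borel)). \<forall>j\<in>K. (\<Sum>i=m..<idx j. p i :: real) \<in> Y j}"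
  have P: "P \<in> sets (PiM {..<m} (\<lambda>_. borel))" unfolding P_def
  proof (intro sets.sets_Collect_finite_All J sets_Collect_mem[OF _ X])
    show "(\<lambda>p. \<Sum>i<idx j. p i :: real) \<in> borel_measurable (PiM {..<m} (\<lambda>_. borel))" if "j \<in> J" for j
      using idxJ[OF that] by (intro borel_measurable_sum_coordinates) auto
  qed
  have Q: "Q \<in> sets (PiM {m..<n} (\<lambda>_. borel))" unfolding Q_def
  proof (intro sets.sets_Collect_finite_All K sets_Collect_mem[OF _ Y])
    show "(\<lambda>p. \<Sum>i=m..<idx j. p i :: real) \<in> borel_measurable (PiM {m..<n} (\<lambda>_. borel))" if "j \<in> K" for j
      using idx[of j] that by (intro borel_measurable_sum_coordinates) auto
  qed
  have "indep_var (PiM {..<m} (\<lambda>_. borel)) (\<lambda>\<omega>. restrict (\<lambda>i. ?I i \<omega>) {..<m})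
      (PiM {m..<n} (\<lambda>_. borel)) (\<lambda>\<omega>. restrict (\<lambda>i. ?I i \<omega>) {m..<n})"
    using m by (intro indep_var_restrict[OF ind]) auto
  then have eq: "prob ((\<lambda>\<omega>. (restrict (\<lambda>i. ?I i \<omega>) {..<m}, restrict (\<lambda>i. ?I i \<omega>) {m..<n})) -` (P \<times> Q) \<inter> space M) =
     prob ((\<lambda>\<omega>. restrict (\<lambda>i. ?I i \<omega>) {..<m}) -` P \<inter> space M) * prob ((\<lambda>\<omega>. restrict (\<lambda>i. ?I i \<omega>) {m..<n}) -` Q \<inter> space M)"
    by (intro indep_varD[OF _ P Q])
  have sumJ: "(\<Sum>i<idx j. restrict (\<lambda>i. ?I i \<omega>) {..<m} i) = B j \<omega>" if "j \<in> J" "\<omega> \<in> space M" for j \<omega>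
  proof -
    have "(\<Sum>i<idx j. restrict (\<lambda>i. ?I i \<omega>) {..<m} i) = (\<Sum>i<idx j. ?I i \<omega>)"
      using idxJ[OF that(1)] by (intro sum.cong) auto
    also have "\<dots> = B (\<tau> (idx j)) \<omega> - B (\<tau> 0) \<omega>" by (rule sum_lessThan_telescope)
    also have "\<dots> = B j \<omega>" using idx[of j] that \<tau>(3) B_0 by auto
    finally show ?thesis .
  qed
  have sumK: "(\<Sum>i=m..<idx j. restrict (\<lambda>i. ?I i \<omega>) {m..<n} i) = B j \<omega> - B t \<omega>" if "j \<in> K" for j \<omega>
  proof -
    have "(\<Sum>i=m..<idx j. restrict (\<lambda>i. ?I i \<omega>) {m..<n} i) = (\<Sum>i=m..<idx j. ?I i \<omega>)"
      using idx[of j] that by (intro sum.cong) auto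
    also have "\<dots> = B (\<tau> (idx j)) \<omega> - B (\<tau> m) \<omega>" using idxK[OF that] by (rule sum_Suc_diff')
    also have "\<dots> = B j \<omega> - B t \<omega>" using idx[of j] that m by auto
    finally show ?thesis .
  qed
  have a: "(\<lambda>\<omega>. restrict (\<lambda>i. ?I i \<omega>) {..<m}) -` P \<inter> space M = a"
    unfolding P_def J(1) by (auto simp: space_PiM sumJ simp del: restrict_apply)
  have b: "(\<lambda>\<omega>. restrict (\<lambda>i. ?I i \<omega>) {m..<n}) -` Q \<inter> space M = b"
    unfolding Q_def K(1) by (auto simp: space_PiM sumK simp del: restrict_apply)
  have "(\<lambda>\<omega>. (restrict (\<lambda>i. ?I i \<omega>) {..<m}, restrict (\<lambda>i. ?I i \<omega>) {m..<n})) -` (P \<times> Q) \<inter> space M = a \<inter> b"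
    unfolding a[symmetric] b[symmetric] by auto
  then show "prob (a \<inter> b) = prob a * prob b" using eq a b by simp
qed

lemma indep_var_past_future:
  assumes t: "0 \<le> t" "t \<le> 1" and V: "V \<in> measurable (past t) S" and U: "U \<in> measurable (future t) T"
  shows "indep_var S V T U"
proof -
  have "sigma_sets (space M) {V -` A \<inter> space M |A. A \<in> sets S} \<subseteq> sets (past t)"
    using V by (intro sets.sigma_sets_subset[of _ "past t", simplified]) (auto dest: measurable_sets)
  moreover have "sigma_sets (space M) {U -` A \<inter> space M |A. A \<in> sets T} \<subseteq> sets (future t)"
    using U by (intro sets.sigma_sets_subset[of _ "future t", simplified]) (auto dest: measurable_sets)
  ultimately have "indep_set (sigma_sets (space M) {V -` A \<inter> space M |A. A \<in> sets S})
      (sigma_sets (space M) {U -` A \<inter> space M |A. A \<in> sets T})"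
    using indep_past_future[OF t] unfolding indep_sets2_eq by blast
  then show ?thesis
    unfolding indep_var_eq using past_measurable[OF V t(2)] future_measurable[OF U t] by simp
qed

lemma prob_past_future:
  assumes "0 \<le> t" "t \<le> 1" "a \<in> sets (past t)" "b \<in> sets (future t)"
  shows "prob (a \<inter> b) = prob a * prob b"
  using indep_setD[OF indep_past_future[OF assms(1,2)] assms(3,4)] .

lemma indep_integral:
  fixes V U :: "'a \<Rightarrow> 'c::{real_normed_field, banach, second_countable_topology}"
  assumes t: "0 \<le> t" "t \<le> 1" and "V \<in> borel_measurable (past t)" "U \<in> borel_measurable (future t)"
    and "integrable M V" "integrable M U"
  shows "(\<integral>\<omega>. V \<omega> * U \<omega> \<partial>M) = (\<integral>\<omega>. V \<omega> \<partial>M) * (\<integral>\<omega>. U \<omega> \<partial>M)"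
    and "integrable M (\<lambda>\<omega>. V \<omega> * U \<omega>)"
  using indep_var_lebesgue_integral[OF indep_var_past_future[OF t assms(3,4)] assms(5,6)]
    indep_var_integrable[OF indep_var_past_future[OF t assms(3,4)] assms(5,6)] by auto

lemma
  assumes "0 \<le> s" "s < t" "t \<le> 1"
  shows increment_power_integrable: "integrable M (\<lambda>\<omega>. \<bar>B t \<omega> - B s \<omega>\<bar> ^ k)"
    and increment_mean: "(\<integral>\<omega>. B t \<omega> - B s \<omega> \<partial>M) = 0"
    and increment_square: "(\<integral>\<omega>. (B t \<omega> - B s \<omega>)\<^sup>2 \<partial>M) = t - s"
    and increment_cube: "(\<integral>\<omega>. \<bar>B t \<omega> - B s \<omega>\<bar> ^ 3 \<partial>M) \<le> 2 * sqrt (t - s) ^ 3"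
proof -
  note D = B_increment[OF assms]
  have s: "0 < sqrt (t - s)" using assms by simp
  show "integrable M (\<lambda>\<omega>. \<bar>B t \<omega> - B s \<omega>\<bar> ^ k)"
    using integrable_normal_moment_abs[OF s, of 0 k] by (subst distributed_integrable[OF D, symmetric]) auto
  show m: "(\<integral>\<omega>. B t \<omega> - B s \<omega> \<partial>M) = 0"
    using normal_distributed_expectation[OF s D] .
  show "(\<integral>\<omega>. (B t \<omega> - B s \<omega>)\<^sup>2 \<partial>M) = t - s"
    using normal_distributed_variance[OF s D] m assms by simp
  \<comment> \<open>The third absolute moment of a centred normal variable is
    \<open>2 * sqrt (2 / pi)\<close> times the cube of its standard deviation.\<close>
  have "sqrt (2 / pi) \<le> 1" using pi_gt3 by (intro real_le_lsqrt) auto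
  moreover have "(\<integral>\<omega>. \<bar>B t \<omega> - B s \<omega>\<bar> ^ 3 \<partial>M) = 2 * sqrt (t - s) ^ 3 * sqrt (2 / pi)"
    using integral_normal_moment_abs_odd[OF s, of 0 1]
    by (subst distributed_integral[OF D, symmetric]) (auto simp: eval_nat_numeral)
  ultimately show "(\<integral>\<omega>. \<bar>B t \<omega> - B s \<omega>\<bar> ^ 3 \<partial>M) \<le> 2 * sqrt (t - s) ^ 3"
    using assms by (simp add: mult_left_le)
qed

end

section \<open>The reflection principle\<close>

lemma Phi_minus: assumes "0 < v" shows "Phi v (- x) = 1 - Phi v x"
  using Phi_std_minus[of "x / sqrt v"] Phi_eq_std[OF assms, of x] Phi_eq_std[OF assms, of "- x"] by simp

lemma isCont_Phi: assumes "0 < v" shows "isCont (Phi v) x"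
proof -
  have "isCont (\<lambda>x. Phi 1 (x / sqrt v)) x"
    using assms by (intro isCont_o2[OF _ DERIV_isCont[OF DERIV_Phi_std]] continuous_intros) auto
  then show ?thesis by (subst (asm) Phi_eq_std[OF assms, symmetric])
qed

lemma (in prob_space) prob_tendsto_of_eventually:
  assumes A: "\<And>n. A n \<in> events" "C \<in> events"
    and ev: "\<And>\<omega>. \<omega> \<in> space M \<Longrightarrow> \<forall>\<^sub>F n in sequentially. \<omega> \<in> A n \<longleftrightarrow> \<omega> \<in> C"
  shows "(\<lambda>n. prob (A n)) \<longlonglongrightarrow> prob C"
proof -
  have "(\<lambda>n. \<integral>\<omega>. indicator (A n) \<omega> \<partial>M) \<longlonglongrightarrow> (\<integral>\<omega>. indicator C \<omega> \<partial>M :: real)"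
  proof (rule integral_dominated_convergence[where w="\<lambda>_. 1"])
    show "AE \<omega> in M. (\<lambda>n. indicator (A n) \<omega> :: real) \<longlonglongrightarrow> indicator C \<omega>"
    proof (rule AE_I2)
      fix \<omega> assume "\<omega> \<in> space M"
      from ev[OF this] have "\<forall>\<^sub>F n in sequentially. indicator (A n) \<omega> = (indicator C \<omega> :: real)"
        by eventually_elim (auto simp: indicator_def)
      then show "(\<lambda>n. indicator (A n) \<omega> :: real) \<longlonglongrightarrow> indicator C \<omega>"
        by (rule tendsto_eventually)
    qed
  qed (use A in \<open>auto simp: indicator_def\<close>)
  then show ?thesis using A by (simp add: measure_def[symmetric])
qed

context brownian_from_0
begin

lemma prob_increment:
  assumes "0 \<le> s" "s < t" "t \<le> 1"
  shows "prob {\<omega> \<in> space M. B t \<omega> - B s \<omega> \<le> x} = Phi (t - s) x"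
    and "prob {\<omega> \<in> space M. B t \<omega> - B s \<omega> < x} = Phi (t - s) x"
proof -
  note D = B_increment[OF assms]
  have v: "0 < t - s" "t - s \<noteq> 0" using assms by auto
  have m: "(\<lambda>\<omega>. B t \<omega> - B s \<omega>) \<in> borel_measurable M"
    using assms by (intro borel_measurable_diff B_measurable) auto
  have "prob {\<omega> \<in> space M. B t \<omega> - B s \<omega> \<le> x} = measure (distr M lborel (\<lambda>\<omega>. B t \<omega> - B s \<omega>)) {..x}"
    using m by (subst measure_distr) (auto intro!: arg_cong[where f=prob])
  then show "prob {\<omega> \<in> space M. B t \<omega> - B s \<omega> \<le> x} = Phi (t - s) x"
    using v by (simp add: distributed_distr_eq_density[OF D] centred_normal_def Phi_def cdf_def)
  have "prob {\<omega> \<in> space M. B t \<omega> - B s \<omega> < x} = measure (distr M lborel (\<lambda>\<omega>. B t \<omega> - B s \<omega>)) {..<x}"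
    using m by (subst measure_distr) (auto intro!: arg_cong[where f=prob])
  also have "\<dots> = measure (centred_normal (t - s)) {..<x}"
    using v by (simp add: distributed_distr_eq_density[OF D] centred_normal_def)
  also have "\<dots> = measure (centred_normal (t - s)) {..x}"
  proof -
    have "AE y in lborel. y \<noteq> x" by (rule AE_lborel_singleton)
    then have "AE y in centred_normal (t - s). y \<in> {..<x} \<longleftrightarrow> y \<in> {..x}"
      using v unfolding centred_normal_def by (simp add: AE_density) (auto elim!: eventually_mono)
    then show ?thesis
      unfolding measure_def by (intro arg_cong[where f=enn2real] emeasure_eq_AE) (auto simp: centred_normal_def)
  qed
  finally show "prob {\<omega> \<in> space M. B t \<omega> - B s \<omega> < x} = Phi (t - s) x"
    by (simp add: Phi_def cdf_def)
qed

lemma prob_drop_greater: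
  assumes "0 \<le> s" "s < t" "t \<le> 1"
  shows "prob {\<omega> \<in> space M. a < B s \<omega> - B t \<omega>} = 1 - Phi (t - s) a"
proof -
  have "{\<omega> \<in> space M. a < B s \<omega> - B t \<omega>} = {\<omega> \<in> space M. B t \<omega> - B s \<omega> < - a}" by auto
  then show ?thesis using prob_increment(2)[OF assms, of "- a"] assms by (simp add: Phi_minus)
qed

lemma prob_drop_pos:
  assumes "0 \<le> s" "s < t" "t \<le> 1"
  shows "prob {\<omega> \<in> space M. 0 < B s \<omega> - B t \<omega>} = 1 / 2"
  using prob_drop_greater[OF assms, of 0] Phi_minus[of "t - s" 0] assms by simp

lemma B_sets_Collect:
  assumes "u \<in> {0..1}" "v \<in> {0..1}"
  shows "{\<omega> \<in> space M. c < B u \<omega> - B v \<omega>} \<in> events" "{\<omega> \<in> space M. B u \<omega> - B v \<omega> \<le> c} \<in> events"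
    "{\<omega> \<in> space M. c \<le> B u \<omega> - B v \<omega>} \<in> events"
  using B_measurable[OF assms(1)] B_measurable[OF assms(2)] by measurable

lemma drop_past:
  assumes "0 \<le> u" "u \<le> r" "0 \<le> v" "v \<le> r"
  shows "{\<omega> \<in> space M. c < B u \<omega> - B v \<omega>} \<in> sets (past r)" "{\<omega> \<in> space M. B u \<omega> - B v \<omega> \<le> c} \<in> sets (past r)"
proof -
  have [measurable]: "B u \<in> borel_measurable (past r)" "B v \<in> borel_measurable (past r)"
    using assms by (auto intro: B_past)
  have "{\<omega> \<in> space (past r). c < B u \<omega> - B v \<omega>} \<in> sets (past r)" "{\<omega> \<in> space (past r). B u \<omega> - B v \<omega> \<le> c} \<in> sets (past r)"
    by measurable
  then show "{\<omega> \<in> space M. c < B u \<omega> - B v \<omega>} \<in> sets (past r)" "{\<omega> \<in> space M. B u \<omega> - B v \<omega> \<le> c} \<in> sets (past r)"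
    by simp_all
qed

lemma drop_future:
  assumes "0 \<le> r" "r \<le> t" "t \<le> 1"
  shows "{\<omega> \<in> space M. 0 < B r \<omega> - B t \<omega>} \<in> sets (future r)" "{\<omega> \<in> space M. 0 \<le> B r \<omega> - B t \<omega>} \<in> sets (future r)"
proof -
  have [measurable]: "(\<lambda>\<omega>. B t \<omega> - B r \<omega>) \<in> borel_measurable (future r)"
    using assms by (auto intro: B_future)
  have "{\<omega> \<in> space (future r). (B t \<omega> - B r \<omega>) < 0} \<in> sets (future r)" "{\<omega> \<in> space (future r). (B t \<omega> - B r \<omega>) \<le> 0} \<in> sets (future r)"
    by measurable
  then show "{\<omega> \<in> space M. 0 < B r \<omega> - B t \<omega>} \<in> sets (future r)" "{\<omega> \<in> space M. 0 \<le> B r \<omega> - B t \<omega>} \<in> sets (future r)"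
    by simp_all
qed

text \<open>The event of a grid drop above \<open>a\<close> is decomposed by the first grid time at
  which it occurs, which is an event in the past of that time; the increment from there to
  \<open>t\<close> is independent of it and symmetric. Ending no higher than at the passage has
  probability at least 1/2 and gives a final drop above \<open>a\<close>. Conversely, a final drop
  above \<open>a + \<eta>\<close> needs either a single step larger than \<open>\<eta>\<close> or a
  strict descent after the passage, which has conditional probability 1/2.\<close>

lemma reflection_grid:
  fixes n :: nat
  assumes st: "0 \<le> s" "s < t" "t \<le> 1" and n: "0 < n" and a: "0 \<le> a" and eta: "0 \<le> \<eta>"
  defines "g k \<equiv> s + (t - s) * (real k / real n)"
  defines "Y k \<omega> \<equiv> B s \<omega> - B (g k) \<omega>"
  shows "prob {\<omega> \<in> space M. \<exists>k\<in>{..n}. a < Y k \<omega>} \<le> 2 * prob {\<omega> \<in> space M. a < B s \<omega> - B t \<omega>}"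
    and "prob {\<omega> \<in> space M. a + \<eta> < B s \<omega> - B t \<omega>} \<le>
      prob {\<omega> \<in> space M. \<exists>k\<in>{..<n}. \<eta> < Y (Suc k) \<omega> - Y k \<omega>} + 1 / 2 * prob {\<omega> \<in> space M. \<exists>k\<in>{..n}. a < Y k \<omega>}"
proof -
  have g: "g k \<in> {s..t}" if "k \<le> n" for k
    unfolding g_def using grid_point_in[of s t k n] that st by auto
  have g01: "g k \<in> {0..1}" if "k \<le> n" for k using g[OF that] st by auto
  have g_mono: "g j \<le> g k" if "j \<le> k" for j k
    unfolding g_def using that st by (intro add_left_mono mult_left_mono divide_right_mono) auto
  have gn: "g n = t" "g 0 = s" using n by (auto simp: g_def)
  have g_less: "g k < t" if "k < n" for k
  proof -
    have "(t - s) * (real k / real n) < (t - s) * 1"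
      using that st n by (intro mult_strict_left_mono) auto
    then show ?thesis by (simp add: g_def)
  qed
  define T where "T k = {\<omega> \<in> space M. a < Y k \<omega> \<and> (\<forall>j\<in>{..<k}. Y j \<omega> \<le> a)}" for k
  have T_past: "T k \<in> sets (past (g k))" if "k \<le> n" for k
  proof -
    have "{\<omega> \<in> space M. a < Y k \<omega>} \<in> sets (past (g k))"
      unfolding Y_def using g[OF that] st by (intro drop_past) auto
    moreover have "{\<omega> \<in> space (past (g k)). \<forall>j\<in>{..<k}. Y j \<omega> \<le> a} \<in> sets (past (g k))"
    proof (intro sets.sets_Collect_finite_All)
      fix j assume "j \<in> {..<k}"
      then have "g j \<le> g k" "0 \<le> g j" "s \<le> g k" using g_mono[of j k] g[of j] g[of k] that st by auto
      then show "{\<omega> \<in> space (past (g k)). Y j \<omega> \<le> a} \<in> sets (past (g k))"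
        unfolding Y_def using drop_past(2)[of s "g k" "g j" a] st by simp
    qed simp
    moreover have "T k = {\<omega> \<in> space M. a < Y k \<omega>} \<inter> {\<omega> \<in> space (past (g k)). \<forall>j\<in>{..<k}. Y j \<omega> \<le> a}"
      by (auto simp: T_def)
    ultimately show ?thesis by auto
  qed
  have T_ev: "T k \<in> events" if "k \<le> n" for k
  proof -
    have "sets (past (g k)) \<subseteq> events"
      unfolding past_def using g01[OF that] by (intro sets_generated_subset) (auto intro: B_measurable)
    then show ?thesis using T_past[OF that] by auto
  qed
  have disj: "disjoint_family_on T {..n}"
    proof -
    have False if "\<omega> \<in> T j" "\<omega> \<in> T k" "j < k" for \<omega> j k
      using that by (auto simp: T_def not_less[symmetric])
    then show ?thesis unfolding disjoint_family_on_def by (metis disjoint_iff nat_neq_iff)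
  qed
  have UN: "{\<omega> \<in> space M. \<exists>k\<in>{..n}. a < Y k \<omega>} = (\<Union>k\<in>{..n}. T k)"
  proof (intro set_eqI iffI)
    fix \<omega> assume \<omega>: "\<omega> \<in> {\<omega> \<in> space M. \<exists>k\<in>{..n}. a < Y k \<omega>}"
    define k where "k = (LEAST k. a < Y k \<omega>)"
    from \<omega> obtain k' where k': "k' \<le> n" "a < Y k' \<omega>" by auto
    have "a < Y k \<omega>" unfolding k_def using k'(2) by (rule LeastI)
    moreover have "Y j \<omega> \<le> a" if "j < k" for j using not_less_Least[of j "\<lambda>k. a < Y k \<omega>"] that by (auto simp: k_def)
    moreover have "k \<le> n" using Least_le[of "\<lambda>k. a < Y k \<omega>", OF k'(2)] k' by (simp add: k_def)
    ultimately show "\<omega> \<in> (\<Union>k\<in>{..n}. T k)" using \<omega> by (auto simp: T_def)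
  qed (auto simp: T_def)
  have sum_T: "prob {\<omega> \<in> space M. \<exists>k\<in>{..n}. a < Y k \<omega>} = (\<Sum>k\<le>n. prob (T k))"
    unfolding UN using disj T_ev by (intro finite_measure_finite_Union) auto
  \<comment> \<open>At \<open>k = n\<close> the remaining increment is 0, so the weak event is
    certain and the strict one empty. Hence the weak event serves the upper bound over
    \<open>k \<le> n\<close> and the strict one the sum over \<open>k < n\<close>.\<close>
  let ?N = "\<lambda>k. {\<omega> \<in> space M. 0 \<le> B (g k) \<omega> - B t \<omega>}"
  let ?P = "\<lambda>k. {\<omega> \<in> space M. 0 < B (g k) \<omega> - B t \<omega>}"
  have N_ev: "?N k \<in> events" "?P k \<in> events" if "k \<le> n" for k
    using B_sets_Collect[of "g k" t 0] g01[OF that] st by auto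
  have half: "prob (T k) \<le> 2 * prob (T k \<inter> ?N k)" if k: "k \<le> n" for k
  proof -
    have "1 / 2 \<le> prob (?N k)"
    proof (cases "k = n")
      case True
      then have "?N k = space M" using gn by auto
      then show ?thesis by (simp add: prob_space)
    next
      case False
      then have "1 / 2 = prob (?P k)"
        using prob_drop_pos[of "g k" t] g01[OF k] g_less[of k] k st by auto
      also have "\<dots> \<le> prob (?N k)" using N_ev[OF k] by (intro finite_measure_mono) auto
      finally show ?thesis .
    qed
    then have "prob (T k) * (1 / 2) \<le> prob (T k) * prob (?N k)" by (intro mult_left_mono) auto
    also have "\<dots> = prob (T k \<inter> ?N k)"
      using g01[OF k] g[OF k] st by (intro prob_past_future[of "g k", symmetric] T_past k drop_future) auto
    finally show ?thesis by simp
  qed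
  have "prob {\<omega> \<in> space M. \<exists>k\<in>{..n}. a < Y k \<omega>} \<le> (\<Sum>k\<le>n. 2 * prob (T k \<inter> ?N k))"
    unfolding sum_T using half by (intro sum_mono) auto
  also have "\<dots> = 2 * prob (\<Union>k\<in>{..n}. T k \<inter> ?N k)"
    unfolding sum_distrib_left[symmetric]
    using disj T_ev N_ev by (subst finite_measure_finite_Union) (auto simp: disjoint_family_on_def)
  also have "\<dots> \<le> 2 * prob {\<omega> \<in> space M. a < B s \<omega> - B t \<omega>}"
    using B_sets_Collect[of s t] st by (intro mult_left_mono finite_measure_mono) (auto simp: T_def Y_def)
  finally show "prob {\<omega> \<in> space M. \<exists>k\<in>{..n}. a < Y k \<omega>} \<le> 2 * prob {\<omega> \<in> space M. a < B s \<omega> - B t \<omega>}" .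

  let ?O = "{\<omega> \<in> space M. \<exists>k\<in>{..<n}. \<eta> < Y (Suc k) \<omega> - Y k \<omega>}"
  have O_ev: "?O \<in> events"
  proof -
    have "{\<omega> \<in> space M. \<eta> < Y (Suc k) \<omega> - Y k \<omega>} \<in> events" if "k < n" for k
      using B_sets_Collect(1)[of "g k" "g (Suc k)" \<eta>] g01[of k] g01[of "Suc k"] that by (simp add: Y_def)
    then show ?thesis by (intro sets.sets_Collect_finite_Ex) auto
  qed
  have sub: "{\<omega> \<in> space M. a + \<eta> < B s \<omega> - B t \<omega>} \<subseteq> ?O \<union> (\<Union>k\<in>{..<n}. T k \<inter> ?P k)"
  proof
    fix \<omega> assume \<omega>: "\<omega> \<in> {\<omega> \<in> space M. a + \<eta> < B s \<omega> - B t \<omega>}"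
    then have Yn: "a + \<eta> < Y n \<omega>" by (simp add: Y_def gn)
    show "\<omega> \<in> ?O \<union> (\<Union>k\<in>{..<n}. T k \<inter> ?P k)"
    proof (cases "\<omega> \<in> ?O")
      case False
      have "\<omega> \<in> (\<Union>k\<in>{..n}. T k)" using \<omega> Yn eta unfolding UN[symmetric] by (auto intro!: bexI[of _ n])
      then obtain k where k: "k \<le> n" "\<omega> \<in> T k" by auto
      have "k \<noteq> 0"
      proof
        assume "k = 0" then show False using k a by (simp add: T_def Y_def gn)
      qed
      then obtain k' where k': "k = Suc k'" by (cases k) auto
      \<comment> \<open>Before the passage the drop was at most \<open>a\<close>, and no step
        exceeds \<open>\<eta>\<close>. So at the passage the drop is at most
        \<open>a + \<eta>\<close>, still below its final value.\<close>
      have "Y k \<omega> - Y k' \<omega> \<le> \<eta>" using False \<omega> k k' by (auto simp: not_less)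
      moreover have "Y k' \<omega> \<le> a" using k k' by (auto simp: T_def)
      ultimately have le: "Y k \<omega> \<le> a + \<eta>" by simp
      then have "k \<noteq> n" using Yn by auto
      moreover have "0 < B (g k) \<omega> - B t \<omega>" using le Yn by (simp add: Y_def gn)
      ultimately show ?thesis using k \<omega> by auto
    qed simp
  qed
  have disj': "disjoint_family_on T {..<n}" by (rule disjoint_family_on_mono[OF _ disj]) auto
  show "prob {\<omega> \<in> space M. a + \<eta> < B s \<omega> - B t \<omega>} \<le>
      prob ?O + 1 / 2 * prob {\<omega> \<in> space M. \<exists>k\<in>{..n}. a < Y k \<omega>}"
  proof -
    have "prob {\<omega> \<in> space M. a + \<eta> < B s \<omega> - B t \<omega>} \<le> prob (?O \<union> (\<Union>k\<in>{..<n}. T k \<inter> ?P k))"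
      using sub O_ev T_ev N_ev by (intro finite_measure_mono sets.Un sets.finite_UN sets.Int) auto
    also have "\<dots> \<le> prob ?O + prob (\<Union>k\<in>{..<n}. T k \<inter> ?P k)"
      using O_ev T_ev N_ev by (intro measure_Un_le sets.finite_UN sets.Int) auto
    also have "prob (\<Union>k\<in>{..<n}. T k \<inter> ?P k) = (\<Sum>k<n. prob (T k \<inter> ?P k))"
      using disj' T_ev N_ev
      by (intro finite_measure_finite_Union) (auto simp: disjoint_family_on_def)
    also have "\<dots> = (\<Sum>k<n. 1 / 2 * prob (T k))"
    proof (intro sum.cong refl)
      fix k assume "k \<in> {..<n}"
      then have k: "k \<le> n" "k < n" by auto
      have "prob (T k \<inter> ?P k) = prob (T k) * prob (?P k)"
        using g01[OF k(1)] g[OF k(1)] st k by (intro prob_past_future[of "g k"] T_past drop_future) auto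
      also have "prob (?P k) = 1 / 2"
        using prob_drop_pos[of "g k" t] g01[OF k(1)] g_less[OF k(2)] st by auto
      finally show "prob (T k \<inter> ?P k) = 1 / 2 * prob (T k)" by simp
    qed
    also have "\<dots> \<le> 1 / 2 * (\<Sum>k\<le>n. prob (T k))"
      unfolding sum_distrib_left by (intro sum_mono2) auto
    finally show ?thesis by (simp add: sum_T)
  qed
qed

lemma max_drop_future:
  assumes "0 \<le> s" "s \<le> t" "t \<le> 1"
  shows "(\<lambda>\<omega>. max_drop (\<lambda>u. B u \<omega>) s t) \<in> borel_measurable (future s)"
proof (rule borel_measurable_max_drop[OF _ _ assms(2)])
  fix u assume "u \<in> {s..t}"
  then have "(\<lambda>\<omega>. - (B u \<omega> - B s \<omega>)) \<in> borel_measurable (future s)"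
    using assms by (intro borel_measurable_uminus B_future) auto
  then show "(\<lambda>\<omega>. B s \<omega> - B u \<omega>) \<in> borel_measurable (future s)" by simp
qed (use assms in \<open>auto intro!: B_continuous\<close>)

lemma max_drop_measurable:
  assumes "0 \<le> s" "s \<le> t" "t \<le> 1"
  shows "(\<lambda>\<omega>. max_drop (\<lambda>u. B u \<omega>) s t) \<in> borel_measurable M"
  using future_measurable[OF max_drop_future[OF assms]] assms by simp

text \<open>The two grid bounds are taken to the limit of vanishing mesh: steps above
  \<open>\<eta>\<close> disappear by uniform continuity of each path, and afterwards
  \<open>\<eta>\<close> tends to 0 by continuity of \<open>Phi\<close>.\<close>

theorem reflection:
  assumes st: "0 \<le> s" "s < t" "t \<le> 1" and a: "0 \<le> a"
  shows "prob {\<omega> \<in> space M. a < max_drop (\<lambda>u. B u \<omega>) s t} = 2 * (1 - Phi (t - s) a)"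
proof (rule antisym)
  define g where "g n k = s + (t - s) * (real k / real n)" for n k
  have g: "g n k \<in> {s..t}" if "k \<le> n" for n k
    unfolding g_def using grid_point_in[of s t k n] that st by auto
  have g01: "g n k \<in> {0..1}" if "k \<le> n" for n k using g[OF that] st by auto
  let ?S = "{\<omega> \<in> space M. a < max_drop (\<lambda>u. B u \<omega>) s t}"
  let ?Sn = "\<lambda>n. {\<omega> \<in> space M. \<exists>k\<in>{..n}. a < B s \<omega> - B (g n k) \<omega>}"
  have cont: "continuous_on {s..t} (\<lambda>u. B u \<omega>)" if "\<omega> \<in> space M" for \<omega>
    using st that by (intro B_continuous) auto
  have S_ev: "?S \<in> events"
  proof -
    note [measurable] = max_drop_measurable[OF st(1) less_imp_le[OF st(2)] st(3)]
    show ?thesis by measurable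
  qed
  have Sn_ev: "?Sn n \<in> events" for n
    using B_sets_Collect(1)[of s _ a] g01 st by (intro sets.sets_Collect_finite_Ex) auto
  \<comment> \<open>The grid lemma requires at least one step, hence the index
    \<open>Suc n\<close>.\<close>
  have upper: "prob (?Sn (Suc n)) \<le> 2 * (1 - Phi (t - s) a)" for n
    using reflection_grid(1)[OF st, of "Suc n" a 0] a prob_drop_greater[OF st, of a] by (simp add: g_def)
  have "(\<lambda>n. prob (?Sn (Suc n))) \<longlonglongrightarrow> prob ?S"
  proof (rule prob_tendsto_of_eventually[OF Sn_ev S_ev])
    fix \<omega> assume \<omega>: "\<omega> \<in> space M"
    note grid = max_drop_eq_grid[OF cont[OF \<omega>] less_imp_le[OF st(2)], of a, folded g_def]
    show "\<forall>\<^sub>F n in sequentially. \<omega> \<in> ?Sn (Suc n) \<longleftrightarrow> \<omega> \<in> ?S"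
    proof (cases "a < max_drop (\<lambda>u. B u \<omega>) s t")
      case True
      have "\<forall>\<^sub>F n in sequentially. \<exists>k\<in>{..Suc n}. a < B s \<omega> - B (g (Suc n) k) \<omega>"
        using grid(1) True by (intro eventually_sequentially_Suc[THEN iffD2]) auto
      then show ?thesis by eventually_elim (use \<omega> True in auto)
    next
      case False
      then show ?thesis using grid(2) \<omega> by (intro always_eventually allI) blast
    qed
  qed
  then show "prob ?S \<le> 2 * (1 - Phi (t - s) a)"
    by (rule LIMSEQ_le_const2) (use upper in auto)
  let ?O = "\<lambda>\<eta> n. {\<omega> \<in> space M. \<exists>k\<in>{..<n}. \<eta> < B (g n k) \<omega> - B (g n (Suc k)) \<omega>}"
  have O_ev: "?O \<eta> n \<in> events" for n \<eta>
    using B_sets_Collect(1)[of _ _ \<eta>] g01 by (intro sets.sets_Collect_finite_Ex) auto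
  have O_lim: "(\<lambda>n. prob (?O \<eta> (Suc n))) \<longlonglongrightarrow> prob {}" if eta: "0 < \<eta>" for \<eta>
  proof (rule prob_tendsto_of_eventually[OF O_ev])
    fix \<omega> assume \<omega>: "\<omega> \<in> space M"
    have "uniformly_continuous_on {s..t} (\<lambda>u. B u \<omega>)"
      using cont[OF \<omega>] by (intro compact_uniformly_continuous) auto
    then obtain d where d: "0 < d"
      "\<And>u u'. u \<in> {s..t} \<Longrightarrow> u' \<in> {s..t} \<Longrightarrow> dist u' u < d \<Longrightarrow> dist (B u' \<omega>) (B u \<omega>) < \<eta>"
      using eta unfolding uniformly_continuous_on_def by metis
    have "(\<lambda>n. (t - s) / real (Suc n)) \<longlonglongrightarrow> 0" by real_asymp
    then have "\<forall>\<^sub>F n in sequentially. (t - s) / real (Suc n) < d"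
      using d(1) by (rule order_tendstoD)
    then show "\<forall>\<^sub>F n in sequentially. \<omega> \<in> ?O \<eta> (Suc n) \<longleftrightarrow> \<omega> \<in> {}"
    proof eventually_elim
      case (elim n)
      have "B (g (Suc n) k) \<omega> - B (g (Suc n) (Suc k)) \<omega> \<le> \<eta>" if k: "k < Suc n" for k
      proof -
        have "g (Suc n) (Suc k) - g (Suc n) k = (t - s) * (real (Suc k) / real (Suc n) - real k / real (Suc n))"
          by (simp only: g_def right_diff_distrib)
        also have "\<dots> = (t - s) / real (Suc n)"
          by (simp add: diff_divide_distrib[symmetric])
        finally have "dist (g (Suc n) (Suc k)) (g (Suc n) k) = (t - s) / real (Suc n)"
          using st by (simp add: dist_real_def)
        then have "dist (B (g (Suc n) (Suc k)) \<omega>) (B (g (Suc n) k) \<omega>) < \<eta>"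
          using elim g[of k "Suc n"] g[of "Suc k" "Suc n"] k by (intro d(2)) auto
        then show ?thesis by (simp add: dist_real_def)
      qed
      then show ?case by (auto simp: not_less)
    qed
  qed simp
  have lower: "2 * (1 - Phi (t - s) (a + \<eta>)) \<le> prob ?S" if eta: "0 < \<eta>" for \<eta>
  proof -
    have "1 - Phi (t - s) (a + \<eta>) \<le> prob (?O \<eta> (Suc n)) + 1 / 2 * prob ?S" for n
    proof -
      have "prob (?Sn (Suc n)) \<le> prob ?S"
        using max_drop_eq_grid(2)[OF cont less_imp_le[OF st(2)], of _ a, folded g_def] S_ev
        by (intro finite_measure_mono) blast+
      then show ?thesis
        using reflection_grid(2)[OF st, of "Suc n" a \<eta>] a eta prob_drop_greater[OF st, of "a + \<eta>"]
        by (simp add: g_def)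
    qed
    moreover have "(\<lambda>n. prob (?O \<eta> (Suc n)) + 1 / 2 * prob ?S) \<longlonglongrightarrow> prob {} + 1 / 2 * prob ?S"
      by (intro tendsto_intros O_lim eta)
    ultimately have "1 - Phi (t - s) (a + \<eta>) \<le> prob {} + 1 / 2 * prob ?S"
      by (intro LIMSEQ_le_const) auto
    then show ?thesis by simp
  qed
  have "(\<lambda>n. 2 * (1 - Phi (t - s) (a + 1 / real (Suc n)))) \<longlonglongrightarrow> 2 * (1 - Phi (t - s) (a + 0))"
    using st by (intro tendsto_intros isCont_tendsto_compose[OF isCont_Phi]) (simp, real_asymp)
  then show "2 * (1 - Phi (t - s) a) \<le> prob ?S"
    by (intro LIMSEQ_le_const2) (use lower in \<open>auto intro!: exI[of _ 0]\<close>)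
qed

text \<open>Both distribution functions are computed, one by reflection and one by symmetry of the
  increment. The equality carries the moments of the normal law over to the largest drop.\<close>

lemma max_drop_distr:
  assumes st: "0 \<le> s" "s < t" "t \<le> 1"
  shows "distr M borel (\<lambda>\<omega>. max_drop (\<lambda>u. B u \<omega>) s t) = distr M borel (\<lambda>\<omega>. \<bar>B t \<omega> - B s \<omega>\<bar>)"
proof (rule cdf_unique)
  let ?S = "\<lambda>\<omega>. max_drop (\<lambda>u. B u \<omega>) s t" and ?D = "\<lambda>\<omega>. \<bar>B t \<omega> - B s \<omega>\<bar>"
  have S: "?S \<in> borel_measurable M" using st by (intro max_drop_measurable) auto
  have [measurable]: "B t \<in> borel_measurable M" "B s \<in> borel_measurable M" using st by (auto intro: B_measurable)
  have D: "?D \<in> borel_measurable M" by measurable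
  show "real_distribution (distr M borel ?S)" "real_distribution (distr M borel ?D)"
    using S D by auto
  have cdf: "cdf (distr M borel f) x = prob {\<omega> \<in> space M. f \<omega> \<le> x}" if "f \<in> borel_measurable M" for f x
    using that by (simp add: cdf_def measure_distr vimage_def Int_def conj_commute)
  show "cdf (distr M borel ?S) = cdf (distr M borel ?D)"
  proof
    fix x
    show "cdf (distr M borel ?S) x = cdf (distr M borel ?D) x"
    proof (cases "0 \<le> x")
      case False
      have "0 \<le> ?S \<omega>" if "\<omega> \<in> space M" for \<omega>
        using st that by (intro max_drop_nonneg B_continuous) auto
      then have "{\<omega> \<in> space M. ?S \<omega> \<le> x} = {}" using False by force
      moreover have "{\<omega> \<in> space M. ?D \<omega> \<le> x} = {}" using False by force
      ultimately show ?thesis by (simp only: cdf[OF S] cdf[OF D])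
    next
      case True
      have "prob {\<omega> \<in> space M. ?S \<omega> \<le> x} = prob {\<omega> \<in> space M. \<not> x < ?S \<omega>}" by (simp add: not_less)
      also have "\<dots> = 1 - prob {\<omega> \<in> space M. x < ?S \<omega>}"
        using S by (intro prob_neg) measurable
      also have "\<dots> = 2 * Phi (t - s) x - 1" by (simp add: reflection[OF st True])
      finally have 1: "prob {\<omega> \<in> space M. ?S \<omega> \<le> x} = 2 * Phi (t - s) x - 1" .
      have "{\<omega> \<in> space M. B t \<omega> - B s \<omega> \<le> x} = {\<omega> \<in> space M. ?D \<omega> \<le> x} \<union> {\<omega> \<in> space M. B t \<omega> - B s \<omega> < - x}"
        using True by auto
      then have "prob {\<omega> \<in> space M. B t \<omega> - B s \<omega> \<le> x} =
          prob {\<omega> \<in> space M. ?D \<omega> \<le> x} + prob {\<omega> \<in> space M. B t \<omega> - B s \<omega> < - x}"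
        by (simp only:) (intro finite_measure_Union, (measurable)[2], use True in auto)
      then have 2: "prob {\<omega> \<in> space M. ?D \<omega> \<le> x} = 2 * Phi (t - s) x - 1"
        using prob_increment[OF st, of x] prob_increment[OF st, of "- x"] Phi_minus[of "t - s" x] st by simp
      show ?thesis using 1 2 by (simp add: cdf[OF S] cdf[OF D])
    qed
  qed
qed

lemma
  assumes st: "0 \<le> s" "s < t" "t \<le> 1"
  shows max_drop_power_integrable: "integrable M (\<lambda>\<omega>. max_drop (\<lambda>u. B u \<omega>) s t ^ k)"
    and max_drop_power_integral: "(\<integral>\<omega>. max_drop (\<lambda>u. B u \<omega>) s t ^ k \<partial>M) = (\<integral>\<omega>. \<bar>B t \<omega> - B s \<omega>\<bar> ^ k \<partial>M)"
proof -
  let ?S = "\<lambda>\<omega>. max_drop (\<lambda>u. B u \<omega>) s t" and ?D = "\<lambda>\<omega>. \<bar>B t \<omega> - B s \<omega>\<bar>"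
  have S: "?S \<in> borel_measurable M" using st by (intro max_drop_measurable) auto
  have [measurable]: "B t \<in> borel_measurable M" "B s \<in> borel_measurable M" using st by (auto intro: B_measurable)
  have D: "?D \<in> borel_measurable M" by measurable
  have "integrable (distr M borel ?D) (\<lambda>x. x ^ k)"
    using D increment_power_integrable[OF st, of k] by (simp add: integrable_distr_eq)
  then have "integrable (distr M borel ?S) (\<lambda>x. x ^ k)" by (simp add: max_drop_distr[OF st])
  then show "integrable M (\<lambda>\<omega>. ?S \<omega> ^ k)" using S by (simp add: integrable_distr_eq)
  have "(\<integral>x. x ^ k \<partial>distr M borel ?S) = (\<integral>x. x ^ k \<partial>distr M borel ?D)"
    by (simp add: max_drop_distr[OF st])
  then show "(\<integral>\<omega>. ?S \<omega> ^ k \<partial>M) = (\<integral>\<omega>. ?D \<omega> ^ k \<partial>M)"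
    using S D by (simp add: integral_distr)
qed

end

section \<open>Drift and innovation of a path\<close>

text \<open>An antiderivative is \<open>- 4 * sqrt (1 - s)\<close>. The function dominates the drift
  along every continuous path, which settles integrability up to time 1.\<close>

lemma inv_sqrt_integrable: "set_integrable lborel {0..1} (\<lambda>s. if s < 1 then 2 / sqrt (1 - s) else 0)"
proof -
  let ?f = "\<lambda>s::real. if s < 1 then 2 / sqrt (1 - s) else 0"
  have "(?f has_integral (- 4 * sqrt (1 - 1)) - (- 4 * sqrt (1 - 0))) {0..1}"
  proof (rule fundamental_theorem_of_calculus_interior)
    show "continuous_on {0..1} (\<lambda>s::real. - 4 * sqrt (1 - s))" by (intro continuous_intros)
    fix x :: real assume "x \<in> {0<..<1}"
    then show "((\<lambda>s. - 4 * sqrt (1 - s)) has_vector_derivative ?f x) (at x)"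
      by (auto intro!: derivative_eq_intros simp: has_real_derivative_iff_has_vector_derivative[symmetric] field_simps)
  qed simp
  then have "((\<lambda>s. indicator {0..1} s * ?f s) has_integral 4) UNIV"
  proof -
    assume "(?f has_integral (- 4 * sqrt (1 - 1)) - (- 4 * sqrt (1 - 0))) {0..1}"
    then have "((\<lambda>s. if s \<in> {0..1} then ?f s else 0) has_integral 4) UNIV"
      by (subst has_integral_restrict_UNIV) simp
    also have "(\<lambda>s. if s \<in> {0..1} then ?f s else 0) = (\<lambda>s. indicator {0..1} s * ?f s)"
      by (auto simp: fun_eq_iff indicator_def)
    finally show ?thesis .
  qed
  then have "(\<integral>\<^sup>+ s. ennreal (indicator {0..1} s * ?f s) \<partial>lborel) = 4"
    by (intro nn_integral_has_integral_lborel[THEN trans]) auto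
  then show ?thesis
    unfolding set_integrable_def by (intro integrableI_nonneg) auto
qed

definition drift_integral :: "(real \<Rightarrow> real) \<Rightarrow> real \<Rightarrow> real \<Rightarrow> real" where
  "drift_integral f a b = (LBINT s:{a..b}. drift s (above_min f s))"

text \<open>Measured from \<open>f 0\<close>, so that it starts at 0 and does not change when the
  path is shifted.\<close>

definition innovation :: "(real \<Rightarrow> real) \<Rightarrow> real \<Rightarrow> real" where
  "innovation f t = f t - f 0 - drift_integral f 0 t"

text \<open>The horizon \<open>T\<close> and the sigma-algebra \<open>G\<close> are left free:
  \<open>past t\<close> with \<open>T = t\<close> gives adaptedness, the Borel sets of path space
  with \<open>T = 1\<close> allow the transfer to \<open>X\<close>.\<close>

lemma drift_process_measurable:
  fixes F :: "real \<Rightarrow> 'a \<Rightarrow> real"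
  assumes F: "\<And>u. u \<in> {0..T} \<Longrightarrow> F u \<in> borel_measurable G"
    and cont: "\<And>\<omega>. \<omega> \<in> space G \<Longrightarrow> continuous_on {0..T} (\<lambda>u. F u \<omega>)" and T: "0 \<le> T"
    and ab: "0 \<le> a" "b \<le> T"
  shows "(\<lambda>(s, \<omega>). indicator {a..b} s *\<^sub>R drift s (above_min (\<lambda>u. F u \<omega>) s)) \<in> borel_measurable (borel \<Otimes>\<^sub>M G)"
proof -
  note [measurable] = borel_measurable_stopped_above_min[OF F cont T, unfolded case_prod_beta']
  have "(\<lambda>x. (fst x, above_min (\<lambda>u. F u (snd x)) (max 0 (min T (fst x))))) \<in> measurable (borel \<Otimes>\<^sub>M G) (borel \<Otimes>\<^sub>M borel)"
    by measurable
  from measurable_compose[OF this borel_measurable_drift]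
  have [measurable]: "(\<lambda>x. drift (fst x) (above_min (\<lambda>u. F u (snd x)) (max 0 (min T (fst x))))) \<in> borel_measurable (borel \<Otimes>\<^sub>M G)"
    by simp
  have "(\<lambda>x. indicator {a..b} (fst x) *\<^sub>R drift (fst x) (above_min (\<lambda>u. F u (snd x)) (max 0 (min T (fst x)))))
      \<in> borel_measurable (borel \<Otimes>\<^sub>M G)" by measurable
  also have "(\<lambda>x. indicator {a..b} (fst x) *\<^sub>R drift (fst x) (above_min (\<lambda>u. F u (snd x)) (max 0 (min T (fst x))))) =
    (\<lambda>(s, \<omega>). indicator {a..b} s *\<^sub>R drift s (above_min (\<lambda>u. F u \<omega>) s))"
    using ab by (auto simp: fun_eq_iff indicator_def min_absorb2 max_absorb2)
  finally show ?thesis .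
qed

lemma drift_integral_measurable:
  fixes F :: "real \<Rightarrow> 'a \<Rightarrow> real"
  assumes F: "\<And>u. u \<in> {0..T} \<Longrightarrow> F u \<in> borel_measurable G"
    and cont: "\<And>\<omega>. \<omega> \<in> space G \<Longrightarrow> continuous_on {0..T} (\<lambda>u. F u \<omega>)" and T: "0 \<le> T"
    and ab: "0 \<le> a" "b \<le> T"
  shows "(\<lambda>\<omega>. drift_integral (\<lambda>u. F u \<omega>) a b) \<in> borel_measurable G"
proof -
  note m = measurable_compose[OF measurable_pair_swap' drift_process_measurable[OF F cont T ab], unfolded case_prod_beta', simplified]
  have "(\<lambda>\<omega>. \<integral>s. indicator {a..b} s *\<^sub>R drift s (above_min (\<lambda>u. F u \<omega>) s) \<partial>lborel) \<in> borel_measurable G"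
  proof (rule lborel.borel_measurable_lebesgue_integral)
    have "(\<lambda>x. indicator {a..b} (snd x) *\<^sub>R drift (snd x) (above_min (\<lambda>u. F u (fst x)) (snd x))) \<in> borel_measurable (G \<Otimes>\<^sub>M lborel)"
      using m by (simp cong: measurable_cong_sets)
    then show "(\<lambda>(\<omega>, s). indicator {a..b} s *\<^sub>R drift s (above_min (\<lambda>u. F u \<omega>) s)) \<in> borel_measurable (G \<Otimes>\<^sub>M lborel)"
      by (simp add: case_prod_beta')
  qed
  then show ?thesis by (simp add: drift_integral_def set_lebesgue_integral_def)
qed

lemma innovation_measurable:
  fixes F :: "real \<Rightarrow> 'a \<Rightarrow> real"
  assumes F: "\<And>u. u \<in> {0..T} \<Longrightarrow> F u \<in> borel_measurable G"
    and cont: "\<And>\<omega>. \<omega> \<in> space G \<Longrightarrow> continuous_on {0..T} (\<lambda>u. F u \<omega>)" and t: "0 \<le> t" "t \<le> T"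
  shows "(\<lambda>\<omega>. innovation (\<lambda>u. F u \<omega>) t) \<in> borel_measurable G"
  unfolding innovation_def using t
  by (intro borel_measurable_diff F drift_integral_measurable[OF F cont]) auto

section \<open>Estimates along one continuous path\<close>

context
  fixes f :: "real \<Rightarrow> real"
  assumes f: "continuous_on {0..1} f"
begin

lemma path_continuous: "0 \<le> a \<Longrightarrow> b \<le> 1 \<Longrightarrow> continuous_on {a..b} f"
  by (rule continuous_on_subset[OF f]) auto

lemma path_above_min_nonneg: "0 \<le> t \<Longrightarrow> t \<le> 1 \<Longrightarrow> 0 \<le> above_min f t"
  by (intro above_min_nonneg path_continuous) auto

lemma drift_path_integrable:
  assumes "0 \<le> a" "b \<le> 1" shows "set_integrable lborel {a..b} (\<lambda>s. drift s (above_min f s))"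
proof -
  have "set_integrable lborel {0..1} (\<lambda>s. drift s (above_min f s))"
    unfolding set_integrable_def
  proof (rule Bochner_Integration.integrable_bound[OF inv_sqrt_integrable[unfolded set_integrable_def]])
    \<comment> \<open>The path is read as a process on a one-point space, which reduces
      measurability in \<open>s\<close> to the joint statement.\<close>
    have "(\<lambda>(s, \<omega>). indicator {0..1} s *\<^sub>R drift s (above_min (\<lambda>u. (\<lambda>u (_::unit). f u) u \<omega>) s)) \<in>
        borel_measurable (borel \<Otimes>\<^sub>M count_space UNIV)"
      by (rule drift_process_measurable[where T=1]) (use f in auto)
    moreover have "(\<lambda>s. (s, ())) \<in> measurable lborel (borel \<Otimes>\<^sub>M count_space UNIV)" by simp
    ultimately show "(\<lambda>s. indicator {0..1} s *\<^sub>R drift s (above_min f s)) \<in> borel_measurable lborel"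
      using measurable_compose by fastforce
    show "AE s in lborel. norm (indicator {0..1} s *\<^sub>R drift s (above_min f s)) \<le>
        norm (indicator {0..1} s *\<^sub>R (if s < 1 then 2 / sqrt (1 - s) else 0))"
    proof (intro AE_I2)
      fix s :: real
      show "norm (indicator {0..1} s *\<^sub>R drift s (above_min f s)) \<le>
        norm (indicator {0..1} s *\<^sub>R (if s < 1 then 2 / sqrt (1 - s) else 0))"
      proof (cases "0 \<le> s \<and> s < 1")
        case True
        then have "drift s (above_min f s) \<le> 2 / sqrt (1 - s)"
          by (intro drift_le path_above_min_nonneg) auto
        then show ?thesis using True drift_nonneg[OF path_above_min_nonneg[of s], of s] by simp
      qed (auto simp: indicator_def drift_def)
    qed
  qed
  then show ?thesis by (rule set_integrable_subset) (use assms in auto)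
qed

lemma drift_integral_split:
  assumes "0 \<le> a" "a \<le> b" "b \<le> c" "c \<le> 1"
  shows "drift_integral f a c = drift_integral f a b + drift_integral f b c"
proof -
  have "{a..c} = {a..b} \<union> {b..c}" using assms by auto
  moreover have "(LBINT s:{a..b} \<union> {b..c}. drift s (above_min f s)) =
      (LBINT s:{a..b}. drift s (above_min f s)) + (LBINT s:{b..c}. drift s (above_min f s))"
  proof (rule set_integral_Un_AE)
    have "AE s in lborel. s \<noteq> b" by (rule AE_lborel_singleton)
    then show "AE s in lborel. \<not> (s \<in> {a..b} \<and> s \<in> {b..c})" by eventually_elim auto
  qed (use assms in \<open>auto intro: drift_path_integrable\<close>)
  ultimately show ?thesis by (simp add: drift_integral_def)
qed

lemma innovation_diff:
  assumes "0 \<le> a" "a \<le> b" "b \<le> 1"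
  shows "innovation f b - innovation f a = f b - f a - drift_integral f a b"
  using drift_integral_split[of 0 a b] assms by (simp add: innovation_def)

lemma innovation_0: "innovation f 0 = 0"
proof -
  have "drift_integral f 0 0 = 0"
    unfolding drift_integral_def set_lebesgue_integral_def
  proof (rule integral_eq_zero_AE)
    show "AE s in lborel. indicator {0..0} s *\<^sub>R drift s (above_min f s) = 0"
      using AE_lborel_singleton[of "0::real"] by eventually_elim simp
  qed
  then show ?thesis by (simp add: innovation_def)
qed

lemma innovation_continuous: "continuous_on {0..1} (innovation f)"
proof -
  have i: "(\<lambda>s. drift s (above_min f s)) integrable_on {0..1}"
    by (rule set_borel_integral_eq_integral(1)[OF drift_path_integrable]) auto
  have "drift_integral f 0 t = integral {0..t} (\<lambda>s. drift s (above_min f s))" if "t \<in> {0..1}" for t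
    unfolding drift_integral_def using that
    by (intro set_borel_integral_eq_integral(2) drift_path_integrable) auto
  moreover have "continuous_on {0..1} (\<lambda>t. integral {0..t} (\<lambda>s. drift s (above_min f s)))"
    by (rule indefinite_integral_continuous_1[OF i])
  ultimately have "continuous_on {0..1} (\<lambda>t. drift_integral f 0 t)"
    by (subst continuous_on_cong[OF refl]) auto
  then show ?thesis unfolding innovation_def by (intro continuous_intros f)
qed

text \<open>Everything that happens in one step is measured by \<open>\<rho>\<close>, which bounds
  the path increments within the step; its summand \<open>sqrt h\<close> turns \<open>h\<close> into
  a quantity of second order. The bound \<open>e\<close> keeps the scales of the whole step away
  from 0, so that the constants depend on \<open>e\<close> only.\<close>

lemma path_step:
  assumes t: "0 \<le> t" "0 < h" "h \<le> 1" "t + h < 1" and e: "0 < e" "e \<le> 1" "e \<le> sqrt (1 - (t + h))"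
  defines "S \<equiv> max_drop f t (t + h)" and "S' \<equiv> max_drop (\<lambda>u. - f u) t (t + h)"
  defines "\<rho> \<equiv> S + S' + sqrt h"
  defines "x \<equiv> above_min f t" and "x' \<equiv> above_min f (t + h)"
  defines "\<sigma> \<equiv> sqrt (1 - t)" and "\<sigma>' \<equiv> sqrt (1 - (t + h))"
  defines "D \<equiv> max_mean \<sigma> x" and "D' \<equiv> max_mean \<sigma>' x'" and "g \<equiv> abs_prob (x / \<sigma>)"
  defines "\<Delta> \<equiv> f (t + h) - f t" and "C \<equiv> drift_integral f t (t + h)"
  shows "h \<le> \<rho>\<^sup>2" "h \<le> \<rho>" "\<bar>\<Delta>\<bar> \<le> \<rho>" "0 \<le> C" "C \<le> 2 / e * h"
    "\<bar>C - h * drift t x\<bar> \<le> 18 / e ^ 3 * \<rho> ^ 3"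
    "\<bar>D' - D - g * \<Delta>\<bar> \<le> 6 / e * \<rho>\<^sup>2" "\<bar>D' - D\<bar> \<le> 3 / e * \<rho>"
proof -
  have fc: "continuous_on {t..t + h} f" using t by (intro path_continuous) auto
  then have fc': "continuous_on {t..t + h} (\<lambda>u. - f u)" by (intro continuous_intros)
  have S0: "0 \<le> S" "0 \<le> S'" unfolding S_def S'_def using t fc fc' by (auto intro!: max_drop_nonneg)
  have sq: "sqrt h * sqrt h = h" "0 \<le> sqrt h" "sqrt h \<le> 1" using t by auto
  have 1: "sqrt h \<le> \<rho>" using S0 by (simp add: \<rho>_def)
  have rho0: "0 \<le> \<rho>" using order_trans[OF sq(2) 1] .
  have "sqrt h * sqrt h \<le> \<rho> * \<rho>" using 1 rho0 sq(2) by (intro mult_mono)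
  then show 2: "h \<le> \<rho>\<^sup>2" using sq by (simp add: power2_eq_square)
  have "sqrt h * sqrt h \<le> 1 * sqrt h" using sq by (intro mult_right_mono) auto
  then show 3: "h \<le> \<rho>" using 1 sq by simp
  have inc: "\<bar>f r - f t\<bar> \<le> S + S'" if "r \<in> {t..t + h}" for r
    using drop_le_max_drop[OF fc that] drop_le_max_drop[OF fc' that] S0 by (auto simp: S_def S'_def)
  have S_rho: "S + S' \<le> \<rho>" unfolding \<rho>_def using sq(2) by linarith
  have "\<bar>\<Delta>\<bar> \<le> S + S'" using inc[of "t + h"] t by (simp add: \<Delta>_def)
  then show 4: "\<bar>\<Delta>\<bar> \<le> \<rho>" using S_rho by linarith
  have x0: "0 \<le> x" "0 \<le> x'" unfolding x_def x'_def using t by (auto intro!: path_above_min_nonneg)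
  have step: "above_min f r = f r - f t + max x (max_drop f t r)" if "r \<in> {t..t + h}" for r
    unfolding x_def using that t by (intro above_min_step path_continuous) auto
  have Sr: "0 \<le> max_drop f t r" "max_drop f t r \<le> S" if r: "r \<in> {t..t + h}" for r
  proof -
    have c: "continuous_on {t..r} f" by (rule continuous_on_subset[OF fc]) (use r in auto)
    show "0 \<le> max_drop f t r" using r by (intro max_drop_nonneg c) auto
    show "max_drop f t r \<le> S" unfolding S_def using r by (intro max_drop_mono fc) auto
  qed
  have dist: "\<bar>above_min f r - x\<bar> \<le> 2 * \<rho>" if r: "r \<in> {t..t + h}" for r
  proof -
    have "\<bar>max x (max_drop f t r) - x\<bar> \<le> S" using Sr[OF r] x0 by (auto simp: max_def)
    then show ?thesis using inc[OF r] S_rho S0 unfolding step[OF r] by linarith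
  qed
  have sig: "e \<le> sqrt (1 - r)" if "r \<in> {t..t + h}" for r
  proof -
    have "sqrt (1 - (t + h)) \<le> sqrt (1 - r)" using that by auto
    then show ?thesis using e(3) by linarith
  qed
  have sig_t: "e \<le> \<sigma>" "e \<le> \<sigma>'" "0 < \<sigma>" "0 < \<sigma>'"
    using sig[of t] sig[of "t + h"] e t by (auto simp: \<sigma>_def \<sigma>'_def)
  have lt1: "r < 1" if "r \<in> {t..t + h}" for r using that t by auto
  have C_int: "C = (LBINT s:{t..t + h}. drift s (above_min f s))" by (simp add: C_def drift_integral_def)
  have int: "set_integrable lborel {t..t + h} (\<lambda>s. drift s (above_min f s))"
    using t by (intro drift_path_integrable) auto
  have const: "set_integrable lborel {t..t + h} (\<lambda>s. c :: real)" "(LBINT s:{t..t + h}. c) = c * h" for c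
    using t by (auto simp: set_integrable_def set_lebesgue_integral_def)
  have am0: "0 \<le> above_min f r" if "r \<in> {t..t + h}" for r using that t by (intro path_above_min_nonneg) auto
  have "0 * h \<le> C" unfolding C_int const(2)[symmetric]
    by (intro set_integral_mono const int drift_nonneg am0)
  then show "0 \<le> C" by simp
  show 6: "C \<le> 2 / e * h" unfolding C_int const(2)[symmetric]
    using e sig am0 by (intro set_integral_mono const int drift_le) auto
  have h_e: "h / e \<le> \<rho> / e" "1 \<le> 1 / e" using e 3 by (auto intro: divide_right_mono)
  have rho_e: "\<rho> \<le> \<rho> / e" using mult_left_mono[OF h_e(2) rho0] by simp
  have drift_diff: "\<bar>drift r (above_min f r) - drift t x\<bar> \<le> 18 / e ^ 3 * \<rho>" if r: "r \<in> {t..t + h}" for r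
  proof -
    have "\<bar>sqrt (1 - r) - sqrt (1 - t)\<bar> \<le> \<bar>(1 - r) - (1 - t)\<bar> / e"
      using e sig[OF r] sig[of t] t by (intro sqrt_diff_le) auto
    also have "\<dots> \<le> h / e" using r e by (intro divide_right_mono) auto
    finally have s: "\<bar>sqrt (1 - r) - sqrt (1 - t)\<bar> \<le> \<rho> / e" using h_e by linarith
    have "\<bar>drift r (above_min f r) - drift t x\<bar> \<le> 6 / e\<^sup>2 * (\<bar>sqrt (1 - r) - sqrt (1 - t)\<bar> + \<bar>above_min f r - x\<bar>)"
      using e sig[OF r] sig[of t] t lt1[OF r] am0[OF r] x0 by (intro drift_lipschitz) auto
    \<comment> \<open>The scale contributes \<open>\<rho> / e\<close> and the state
      \<open>2 * \<rho>\<close>, which is at most \<open>2 * (\<rho> / e)\<close> as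
      \<open>e \<le> 1\<close>; this gives 18 = 6 * 3.\<close>
    also have "\<dots> \<le> 6 / e\<^sup>2 * (\<rho> / e + 2 * (\<rho> / e))"
      using s dist[OF r] rho_e by (intro mult_left_mono add_mono) auto
    also have "\<dots> = 18 / e ^ 3 * \<rho>" using e by (simp add: power2_eq_square power3_eq_cube)
    finally show ?thesis .
  qed
  have dd: "- (18 / e ^ 3 * \<rho>) \<le> drift r (above_min f r) - drift t x"
    "drift r (above_min f r) - drift t x \<le> 18 / e ^ 3 * \<rho>" if "r \<in> {t..t + h}" for r
    using drift_diff[OF that] by linarith+
  have "C - h * drift t x = (LBINT s:{t..t + h}. drift s (above_min f s) - drift t x)"
    unfolding C_int by (subst set_integral_diff(2)[OF int const(1)]) (simp add: const)
  moreover have "(LBINT s:{t..t + h}. drift s (above_min f s) - drift t x) \<le> 18 / e ^ 3 * \<rho> * h"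
    unfolding const(2)[symmetric] by (intro set_integral_mono set_integral_diff(1) int const(1) dd)
  moreover have "(- (18 / e ^ 3 * \<rho>)) * h \<le> (LBINT s:{t..t + h}. drift s (above_min f s) - drift t x)"
    unfolding const(2)[symmetric] by (intro set_integral_mono set_integral_diff(1) int const(1) dd)
  ultimately have "\<bar>C - h * drift t x\<bar> \<le> 18 / e ^ 3 * \<rho> * h" by (simp add: abs_le_iff)
  also have "\<dots> \<le> 18 / e ^ 3 * \<rho> * \<rho>\<^sup>2" using 2 rho0 e by (intro mult_left_mono) auto
  also have "\<dots> = 18 / e ^ 3 * \<rho> ^ 3" by (simp add: power2_eq_square power3_eq_cube)
  finally show "\<bar>C - h * drift t x\<bar> \<le> 18 / e ^ 3 * \<rho> ^ 3" .
  have ss: "\<bar>\<sigma>' - \<sigma>\<bar> \<le> h / e"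
    using sqrt_diff_le[of e "1 - (t + h)" "1 - t"] e sig_t t by (simp add: \<sigma>_def \<sigma>'_def)
  have d1: "\<bar>max_mean \<sigma>' x' - max_mean \<sigma> x'\<bar> \<le> h / e"
    using max_mean_lipschitz_scale[of \<sigma>' \<sigma> x'] sig_t ss by linarith
  have xx: "\<bar>x' - x\<bar> \<le> 2 * \<rho>" using dist[of "t + h"] t by (simp add: x'_def)
  have "\<bar>max_mean \<sigma> x' - max_mean \<sigma> x\<bar> \<le> 2 * \<rho>"
    using max_mean_lipschitz[OF sig_t(3), of x' x] xx by linarith
  then have "\<bar>D' - D\<bar> \<le> h / e + 2 * \<rho>" using d1 unfolding D_def D'_def by linarith
  also have "\<dots> \<le> 3 / e * \<rho>" using h_e rho_e by simp
  finally show "\<bar>D' - D\<bar> \<le> 3 / e * \<rho>" .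
  have "\<bar>max_mean \<sigma> x' - max_mean \<sigma> x - g * (x' - x)\<bar> \<le> (x' - x)\<^sup>2 / \<sigma>"
    unfolding g_def by (rule max_mean_taylor[OF sig_t(3)])
  also have "\<dots> \<le> (2 * \<rho>)\<^sup>2 / e"
    using sig_t e power_mono[OF xx, of 2] by (intro frac_le) auto
  finally have d2: "\<bar>max_mean \<sigma> x' - max_mean \<sigma> x - g * (x' - x)\<bar> \<le> 4 * \<rho>\<^sup>2 / e" by (simp add: power_mult_distrib)
  \<comment> \<open>The push \<open>x' - x - \<Delta>\<close> is nonzero only if the drop
    \<open>S\<close> exceeds \<open>x\<close>. Then \<open>x\<close> is at most
    \<open>\<rho>\<close> and, since \<open>abs_prob\<close> vanishes at 0, \<open>g\<close> is of
    order \<open>\<rho>\<close> as well; the product has second order.\<close>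
  have d3: "\<bar>g * (x' - x - \<Delta>)\<bar> \<le> \<rho>\<^sup>2 / e"
  proof -
    have L: "x' - x - \<Delta> = max 0 (S - x)"
      using step[of "t + h"] t by (simp add: x'_def \<Delta>_def S_def max_def)
    show ?thesis
    proof (cases "x < S")
      case False
      then show ?thesis using L rho0 e by simp
    next
      case True
      have "0 \<le> g" unfolding g_def using x0 sig_t by (intro abs_prob_bounds) auto
      moreover have "g \<le> x / \<sigma>" using abs_prob_scaled_lipschitz[OF sig_t(3), of x 0] x0 abs_prob_0
        by (simp add: g_def)
      moreover have "x / \<sigma> \<le> S / e" using True x0 sig_t e by (intro frac_le) auto
      moreover have "S / e \<le> \<rho> / e" using S0 S_rho e by (intro divide_right_mono) auto
      ultimately have g: "0 \<le> g" "g \<le> \<rho> / e" by auto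
      have "0 \<le> S - x" "S - x \<le> \<rho>" using True x0 S0 S_rho by auto
      then have "g * (S - x) \<le> \<rho> / e * \<rho>" "0 \<le> g * (S - x)"
        using mult_mono[OF g(2), of "S - x" \<rho>] g by auto
      moreover have "g * (x' - x - \<Delta>) = g * (S - x)" using L True by simp
      ultimately show ?thesis by (simp only:) (simp add: power2_eq_square)
    qed
  qed
  \<comment> \<open>Change of scale, Taylor remainder in the state, and push at the minimum. They
    contribute 1, 4 and 1 to the constant 6.\<close>
  have "D' - D - g * \<Delta> = (max_mean \<sigma>' x' - max_mean \<sigma> x') + (max_mean \<sigma> x' - max_mean \<sigma> x - g * (x' - x)) + g * (x' - x - \<Delta>)"
    by (simp add: D_def D'_def algebra_simps)
  also have "\<bar>\<dots>\<bar> \<le> h / e + 4 * \<rho>\<^sup>2 / e + \<rho>\<^sup>2 / e" using d1 d2 d3 by linarith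
  also have "\<dots> \<le> \<rho>\<^sup>2 / e + 4 * \<rho>\<^sup>2 / e + \<rho>\<^sup>2 / e" using 2 e by (intro add_mono divide_right_mono) auto
  finally show "\<bar>D' - D - g * \<Delta>\<bar> \<le> 6 / e * \<rho>\<^sup>2" by simp
qed

end

section \<open>The martingale property of the density\<close>

lemma complex_of_real_measurable: "complex_of_real \<in> borel_measurable borel"
  by (intro borel_measurable_continuous_onI continuous_intros)

text \<open>The joint law of independent variables is a product, so Fubini integrates out the second
  variable while the first is frozen.\<close>

lemma (in prob_space) indep_var_integral_freeze:
  fixes f :: "'b \<Rightarrow> 'b \<Rightarrow> 'd :: {banach, second_countable_topology}"
  assumes ind: "indep_var S X T Y"
    and f: "case_prod f \<in> borel_measurable (S \<Otimes>\<^sub>M T)"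
    and int: "integrable M (\<lambda>\<omega>. f (X \<omega>) (Y \<omega>))"
  shows "(\<integral>\<omega>. f (X \<omega>) (Y \<omega>) \<partial>M) = (\<integral>\<omega>. (\<integral>\<omega>'. f (X \<omega>) (Y \<omega>') \<partial>M) \<partial>M)"
proof -
  have X [measurable]: "X \<in> measurable M S" and Y [measurable]: "Y \<in> measurable M T"
    and eq: "distr M S X \<Otimes>\<^sub>M distr M T Y = distr M (S \<Otimes>\<^sub>M T) (\<lambda>x. (X x, Y x))"
    using ind unfolding indep_var_distribution_eq by auto
  interpret PX: prob_space "distr M S X" by (rule prob_space_distr) fact
  interpret PY: prob_space "distr M T Y" by (rule prob_space_distr) fact
  interpret P: pair_sigma_finite "distr M S X" "distr M T Y" ..
  note [measurable] = f
  have XY [measurable]: "(\<lambda>x. (X x, Y x)) \<in> measurable M (S \<Otimes>\<^sub>M T)" by measurable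
  have "(\<integral>\<omega>. f (X \<omega>) (Y \<omega>) \<partial>M) = (\<integral>p. case_prod f p \<partial>distr M (S \<Otimes>\<^sub>M T) (\<lambda>x. (X x, Y x)))"
    by (subst integral_distr[OF XY f]) simp
  also have "\<dots> = (\<integral>x. (\<integral>y. case_prod f (x, y) \<partial>distr M T Y) \<partial>distr M S X)"
    unfolding eq[symmetric]
  proof (rule P.integral_fst'[symmetric])
    show "integrable (distr M S X \<Otimes>\<^sub>M distr M T Y) (case_prod f)"
      unfolding eq using int by (subst integrable_distr_eq[OF XY f]) simp
  qed
  also have "\<dots> = (\<integral>x. (\<integral>\<omega>'. f x (Y \<omega>') \<partial>M) \<partial>distr M S X)"
    by (intro Bochner_Integration.integral_cong refl) (simp add: integral_distr)
  also have "\<dots> = (\<integral>\<omega>. (\<integral>\<omega>'. f (X \<omega>) (Y \<omega>') \<partial>M) \<partial>M)"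
    by (intro integral_distr X borel_measurable_lebesgue_integral) measurable
  finally show ?thesis .
qed

context brownian_from_0
begin

lemma path_cont: "\<omega> \<in> space M \<Longrightarrow> continuous_on {0..1} (\<lambda>u. B u \<omega>)"
  by (rule B_continuous) auto

lemma max_drop_past:
  assumes "0 \<le> t" "t \<le> 1" shows "(\<lambda>\<omega>. max_drop (\<lambda>u. B u \<omega>) 0 t) \<in> borel_measurable (past t)"
proof (rule borel_measurable_max_drop[OF _ _ assms(1)])
  show "(\<lambda>\<omega>. B 0 \<omega> - B u \<omega>) \<in> borel_measurable (past t)" if "u \<in> {0..t}" for u
    using that by (intro borel_measurable_diff B_past) auto
qed (use assms in \<open>auto intro!: B_continuous\<close>)

lemma above_min_past:
  assumes "0 \<le> t" "t \<le> 1" shows "(\<lambda>\<omega>. above_min (\<lambda>u. B u \<omega>) t) \<in> borel_measurable (past t)"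
  unfolding above_min_def using assms
  by (intro borel_measurable_add borel_measurable_diff B_past max_drop_past) auto

lemma innovation_past:
  assumes "0 \<le> t" "t \<le> 1" shows "(\<lambda>\<omega>. innovation (\<lambda>u. B u \<omega>) t) \<in> borel_measurable (past t)"
  using assms by (intro innovation_measurable[where T=t] B_past) (auto intro!: B_continuous)

lemma B_integrable:
  assumes "0 \<le> s" "s \<le> t" "t \<le> 1" shows "integrable M (\<lambda>\<omega>. B t \<omega> - B s \<omega>)"
proof (cases "s = t")
  case False
  then have "integrable M (\<lambda>\<omega>. \<bar>B t \<omega> - B s \<omega>\<bar>)"
    using increment_power_integrable[of s t 1] assms by simp
  then show ?thesis
    by (rule integrable_abs_cancel) (use assms in \<open>auto intro!: borel_measurable_diff B_measurable\<close>)
qed simp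

lemma max_drop_integrable:
  assumes "0 \<le> s" "s < t" "t \<le> 1" shows "integrable M (\<lambda>\<omega>. max_drop (\<lambda>u. B u \<omega>) s t)"
  using max_drop_power_integrable[OF assms, of 1] by simp

text \<open>The increment of \<open>B\<close> has mean zero, so only the largest drop contributes,
  and it grows with \<open>t\<close>. The case \<open>t = 1\<close> matches the mean of the weight
  with the normalising constant.\<close>

lemma above_min_integrable:
  assumes "0 \<le> t" "t \<le> 1"
  shows "integrable M (\<lambda>\<omega>. above_min (\<lambda>u. B u \<omega>) t)"
    and "(\<integral>\<omega>. above_min (\<lambda>u. B u \<omega>) t \<partial>M) \<le> (\<integral>\<omega>. max_drop (\<lambda>u. B u \<omega>) 0 1 \<partial>M)"
    and "t = 1 \<Longrightarrow> (\<integral>\<omega>. above_min (\<lambda>u. B u \<omega>) t \<partial>M) = (\<integral>\<omega>. max_drop (\<lambda>u. B u \<omega>) 0 1 \<partial>M)"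
proof -
  have i1: "integrable M (\<lambda>\<omega>. B t \<omega> - B 0 \<omega>)" using assms by (intro B_integrable) auto
  have i2: "integrable M (\<lambda>\<omega>. max_drop (\<lambda>u. B u \<omega>) 0 1)" by (intro max_drop_integrable) auto
  have m0: "0 \<le> max_drop (\<lambda>u. B u \<omega>) 0 t" if "\<omega> \<in> space M" for \<omega>
    using assms that by (intro max_drop_nonneg B_continuous) auto
  have le: "max_drop (\<lambda>u. B u \<omega>) 0 t \<le> max_drop (\<lambda>u. B u \<omega>) 0 1" if "\<omega> \<in> space M" for \<omega>
    using assms that by (intro max_drop_mono B_continuous) auto
  have i3: "integrable M (\<lambda>\<omega>. max_drop (\<lambda>u. B u \<omega>) 0 t)"
  proof (rule Bochner_Integration.integrable_bound[OF i2])
    show "AE \<omega> in M. norm (max_drop (\<lambda>u. B u \<omega>) 0 t) \<le> norm (max_drop (\<lambda>u. B u \<omega>) 0 1)"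
    proof (rule AE_I2)
      fix \<omega> assume "\<omega> \<in> space M"
      then show "norm (max_drop (\<lambda>u. B u \<omega>) 0 t) \<le> norm (max_drop (\<lambda>u. B u \<omega>) 0 1)"
        using m0[of \<omega>] le[of \<omega>] by simp
    qed
  qed (use assms in \<open>auto intro!: max_drop_measurable\<close>)
  show "integrable M (\<lambda>\<omega>. above_min (\<lambda>u. B u \<omega>) t)"
    unfolding above_min_def using i1 i3 by (intro Bochner_Integration.integrable_add) auto
  have z: "(\<integral>\<omega>. B t \<omega> - B 0 \<omega> \<partial>M) = 0"
    using increment_mean[of 0 t] assms by (cases "t = 0") auto
  have eq: "(\<integral>\<omega>. above_min (\<lambda>u. B u \<omega>) t \<partial>M) = (\<integral>\<omega>. max_drop (\<lambda>u. B u \<omega>) 0 t \<partial>M)"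
    unfolding above_min_def by (subst Bochner_Integration.integral_add[OF i1 i3]) (simp add: z)
  then show "(\<integral>\<omega>. above_min (\<lambda>u. B u \<omega>) t \<partial>M) \<le> (\<integral>\<omega>. max_drop (\<lambda>u. B u \<omega>) 0 1 \<partial>M)"
    using integral_mono[OF i3 i2 le] by simp
  show "t = 1 \<Longrightarrow> (\<integral>\<omega>. above_min (\<lambda>u. B u \<omega>) t \<partial>M) = (\<integral>\<omega>. max_drop (\<lambda>u. B u \<omega>) 0 1 \<partial>M)"
    using eq by simp
qed

text \<open>The excess of the drop \<open>S\<close> over \<open>x\<close> is the length of the
  interval from \<open>x\<close> to \<open>S\<close>. Tonelli and the reflection principle turn its
  mean into the Gaussian tail integral.\<close>

lemma expectation_max_max_drop:
  assumes t: "0 \<le> t" "t < 1" and x: "0 \<le> x"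
  shows "(\<integral>\<omega>. max x (max_drop (\<lambda>u. B u \<omega>) t 1) \<partial>M) = max_mean (sqrt (1 - t)) x"
proof -
  let ?S = "\<lambda>\<omega>. max_drop (\<lambda>u. B u \<omega>) t 1"
  have S [measurable]: "?S \<in> borel_measurable M" using t by (intro max_drop_measurable) auto
  have i: "integrable M ?S" using t by (intro max_drop_integrable) auto
  interpret PS: pair_sigma_finite M lborel ..
  have "(\<integral>\<^sup>+\<omega>. ennreal (max 0 (?S \<omega> - x)) \<partial>M) = (\<integral>\<^sup>+\<omega>. (\<integral>\<^sup>+s. indicator {p. x \<le> snd p \<and> snd p < fst p} (?S \<omega>, s) \<partial>lborel) \<partial>M)"
  proof (intro nn_integral_cong)
    fix \<omega>
    have "(\<integral>\<^sup>+s. indicator {p. x \<le> snd p \<and> snd p < fst p} (?S \<omega>, s) \<partial>lborel) = (\<integral>\<^sup>+s. indicator {x..<?S \<omega>} s \<partial>lborel)"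
      by (intro nn_integral_cong) (auto simp: indicator_def)
    also have "\<dots> = ennreal (max 0 (?S \<omega> - x))"
      by (cases "x \<le> ?S \<omega>") (auto simp: max_def)
    finally show "ennreal (max 0 (?S \<omega> - x)) = (\<integral>\<^sup>+s. indicator {p. x \<le> snd p \<and> snd p < fst p} (?S \<omega>, s) \<partial>lborel)" ..
  qed
  also have "\<dots> = (\<integral>\<^sup>+s. (\<integral>\<^sup>+\<omega>. indicator {p. x \<le> snd p \<and> snd p < fst p} (?S \<omega>, s) \<partial>M) \<partial>lborel)"
    by (intro PS.Fubini'[symmetric]) measurable
  also have "\<dots> = (\<integral>\<^sup>+s. ennreal (2 * (1 - Phi (1 - t) s)) * indicator {x..} s \<partial>lborel)"
  proof (intro nn_integral_cong)
    fix s
    have "(\<integral>\<^sup>+\<omega>. indicator {p. x \<le> snd p \<and> snd p < fst p} (?S \<omega>, s) \<partial>M) =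
        (\<integral>\<^sup>+\<omega>. indicator {x..} s * indicator {\<omega> \<in> space M. s < ?S \<omega>} \<omega> \<partial>M)"
      by (intro nn_integral_cong) (auto simp: indicator_def)
    also have "\<dots> = indicator {x..} s * emeasure M {\<omega> \<in> space M. s < ?S \<omega>}"
      by (subst nn_integral_cmult) auto
    also have "\<dots> = ennreal (2 * (1 - Phi (1 - t) s)) * indicator {x..} s"
      using reflection[of t 1 s] t x by (auto simp: indicator_def emeasure_eq_measure)
    finally show "(\<integral>\<^sup>+\<omega>. indicator {p. x \<le> snd p \<and> snd p < fst p} (?S \<omega>, s) \<partial>M) = 
        ennreal (2 * (1 - Phi (1 - t) s)) * indicator {x..} s" .
  qed
  also have "\<dots> = ennreal (max_mean (sqrt (1 - t)) x - x)"
    using t x by (intro nn_integral_Phi_tail) auto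
  finally have nn: "(\<integral>\<^sup>+\<omega>. ennreal (max 0 (?S \<omega> - x)) \<partial>M) = ennreal (max_mean (sqrt (1 - t)) x - x)" .
  have i': "integrable M (\<lambda>\<omega>. max 0 (?S \<omega> - x))"
    using i by (intro integrable_max Bochner_Integration.integrable_diff) auto
  have "(\<integral>\<omega>. max 0 (?S \<omega> - x) \<partial>M) = max_mean (sqrt (1 - t)) x - x"
    using nn max_mean_ge_self[of "sqrt (1 - t)" x] t x by (subst integral_eq_nn_integral) auto
  moreover have "(\<integral>\<omega>. max x (?S \<omega>) \<partial>M) = (\<integral>\<omega>. x + max 0 (?S \<omega> - x) \<partial>M)"
    by (intro Bochner_Integration.integral_cong) (auto simp: max_def)
  ultimately show ?thesis using i' by (simp add: prob_space)
qed

lemma max_mean_above_min_integrable: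
  assumes t: "0 \<le> t" "t < 1"
  shows "integrable M (\<lambda>\<omega>. max_mean (sqrt (1 - t)) (above_min (\<lambda>u. B u \<omega>) t))"
    and "(\<integral>\<omega>. max_mean (sqrt (1 - t)) (above_min (\<lambda>u. B u \<omega>) t) \<partial>M) \<le> (\<integral>\<omega>. max_drop (\<lambda>u. B u \<omega>) 0 1 \<partial>M) + 1"
    and "\<omega> \<in> space M \<Longrightarrow> 0 \<le> max_mean (sqrt (1 - t)) (above_min (\<lambda>u. B u \<omega>) t)"
proof -
  let ?x = "\<lambda>\<omega>. above_min (\<lambda>u. B u \<omega>) t" and ?D = "\<lambda>\<omega>. max_mean (sqrt (1 - t)) (above_min (\<lambda>u. B u \<omega>) t)"
  have xi: "integrable M ?x" using t by (intro above_min_integrable) auto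
  have x0: "0 \<le> ?x \<omega>" if "\<omega> \<in> space M" for \<omega>
    using t that by (intro path_above_min_nonneg path_cont) auto
  have D0: "0 \<le> ?D \<omega>" "?D \<omega> \<le> ?x \<omega> + 1" if "\<omega> \<in> space M" for \<omega>
    using max_mean_le[of "sqrt (1 - t)" "?x \<omega>"] max_mean_ge_self[of "sqrt (1 - t)" "?x \<omega>"] x0[OF that] t
    by (auto intro: order_trans)
  then show "\<omega> \<in> space M \<Longrightarrow> 0 \<le> ?D \<omega>" by simp
  have i1: "integrable M (\<lambda>\<omega>. ?x \<omega> + 1)" using xi by simp
  have [measurable]: "?x \<in> borel_measurable M" using xi by simp
  show i: "integrable M ?D"
  proof (rule Bochner_Integration.integrable_bound[OF i1])
    show "AE \<omega> in M. norm (?D \<omega>) \<le> norm (?x \<omega> + 1)"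
    proof (rule AE_I2)
      fix \<omega> assume "\<omega> \<in> space M" then show "norm (?D \<omega>) \<le> norm (?x \<omega> + 1)"
        using D0[of \<omega>] x0[of \<omega>] by simp
    qed
  qed measurable
  have "(\<integral>\<omega>. ?D \<omega> \<partial>M) \<le> (\<integral>\<omega>. ?x \<omega> + 1 \<partial>M)"
    using D0 by (intro integral_mono i i1) auto
  also have "\<dots> = (\<integral>\<omega>. ?x \<omega> \<partial>M) + 1" using xi by (simp add: prob_space)
  finally show "(\<integral>\<omega>. ?D \<omega> \<partial>M) \<le> (\<integral>\<omega>. max_drop (\<lambda>u. B u \<omega>) 0 1 \<partial>M) + 1"
    using above_min_integrable(2)[of t] t by simp
qed

lemma integrable_bounded_mult:
  fixes V :: "'a \<Rightarrow> complex" and U :: "'a \<Rightarrow> real"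
  assumes V: "V \<in> borel_measurable M" "\<And>\<omega>. norm (V \<omega>) \<le> 1" and U: "integrable M U"
  shows "integrable M (\<lambda>\<omega>. V \<omega> * of_real (U \<omega>))"
proof (rule Bochner_Integration.integrable_bound[OF U])
  show "AE \<omega> in M. norm (V \<omega> * of_real (U \<omega>)) \<le> norm (U \<omega>)"
    using V(2) by (auto simp: norm_mult intro!: mult_left_le_one_le)
qed (use V U in measurable)

lemma indep_integral_zero:
  fixes V :: "'a \<Rightarrow> complex"
  assumes t: "0 \<le> t" "t \<le> 1" and V: "V \<in> borel_measurable (past t)" and U: "U \<in> borel_measurable (future t)"
    and Vi: "integrable M V" and Ui: "integrable M U"
  shows "integrable M (\<lambda>\<omega>. V \<omega> * of_real (U \<omega>))"
    and "(\<integral>\<omega>. U \<omega> \<partial>M) = 0 \<Longrightarrow> (\<integral>\<omega>. V \<omega> * of_real (U \<omega>) \<partial>M) = 0"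
proof -
  have U': "(\<lambda>\<omega>. complex_of_real (U \<omega>)) \<in> borel_measurable (future t)"
    by (rule measurable_compose[OF U complex_of_real_measurable])
  have Ui': "integrable M (\<lambda>\<omega>. complex_of_real (U \<omega>))" using Ui by (rule integrable_of_real)
  show "integrable M (\<lambda>\<omega>. V \<omega> * of_real (U \<omega>))"
    by (rule indep_integral(2)[OF t V U' Vi Ui'])
  show "(\<integral>\<omega>. V \<omega> * of_real (U \<omega>) \<partial>M) = 0" if "(\<integral>\<omega>. U \<omega> \<partial>M) = 0"
    using indep_integral(1)[OF t V U' Vi Ui'] that by simp
qed

text \<open>By the recursion for \<open>above_min\<close>, the weight is \<open>B 1 - B t\<close>
  plus the maximum of the present state and the future drop. The first term has mean zero against
  \<open>V\<close>; in the second the state is frozen and the drop integrated out.\<close>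

lemma above_min_martingale:
  fixes V :: "'a \<Rightarrow> complex"
  assumes t: "0 \<le> t" "t < 1" and V: "V \<in> borel_measurable (past t)" "\<And>\<omega>. norm (V \<omega>) \<le> 1"
  shows "(\<integral>\<omega>. V \<omega> * of_real (above_min (\<lambda>u. B u \<omega>) 1) \<partial>M) =
     (\<integral>\<omega>. V \<omega> * of_real (max_mean (sqrt (1 - t)) (above_min (\<lambda>u. B u \<omega>) t)) \<partial>M)"
proof -
  let ?S = "\<lambda>\<omega>. max_drop (\<lambda>u. B u \<omega>) t 1" and ?x = "\<lambda>\<omega>. above_min (\<lambda>u. B u \<omega>) t"
  \<comment> \<open>The drop is padded with a dummy complex component, so that both independent
    arguments have the type \<open>complex \<times> real\<close>.\<close>
  let ?f = "\<lambda>p q :: complex \<times> real. fst p * complex_of_real (max (snd p) (snd q))"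
  have t': "0 \<le> t" "t \<le> 1" using t by auto
  have VM [measurable]: "V \<in> borel_measurable M" using V(1) t' by (intro past_measurable[of _ t])
  have S_fut: "?S \<in> borel_measurable (future t)" using t by (intro max_drop_future) auto
  have S [measurable]: "?S \<in> borel_measurable M" using t by (intro max_drop_measurable) auto
  have x_past: "?x \<in> borel_measurable (past t)" using t' by (rule above_min_past)
  have xi: "integrable M ?x" using t' by (rule above_min_integrable)
  have Si: "integrable M ?S" using t by (intro max_drop_integrable) auto
  have Bi: "integrable M (\<lambda>\<omega>. B 1 \<omega> - B t \<omega>)" using t by (intro B_integrable) auto
  have Vi: "integrable M V" using V(2) VM by (intro integrable_const_bound[of _ 1]) auto
  have z: "(\<integral>\<omega>. V \<omega> * of_real (B 1 \<omega> - B t \<omega>) \<partial>M) = 0"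
    using t by (intro indep_integral_zero(2)[OF t' V(1) _ Vi Bi] increment_mean B_future) auto
  have x0: "0 \<le> ?x \<omega>" if "\<omega> \<in> space M" for \<omega>
    using t that by (intro path_above_min_nonneg path_cont) auto
  have mi: "integrable M (\<lambda>\<omega>. max (?x \<omega>) (?S \<omega>))" using xi Si by (rule integrable_max)
  have "(\<integral>\<omega>. V \<omega> * of_real (above_min (\<lambda>u. B u \<omega>) 1) \<partial>M) =
      (\<integral>\<omega>. V \<omega> * of_real (B 1 \<omega> - B t \<omega>) + V \<omega> * of_real (max (?x \<omega>) (?S \<omega>)) \<partial>M)"
  proof (intro Bochner_Integration.integral_cong refl)
    fix \<omega> assume "\<omega> \<in> space M"
    then have "above_min (\<lambda>u. B u \<omega>) 1 = B 1 \<omega> - B t \<omega> + max (?x \<omega>) (?S \<omega>)"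
      using t by (intro above_min_step path_cont) auto
    then show "V \<omega> * of_real (above_min (\<lambda>u. B u \<omega>) 1) =
       V \<omega> * of_real (B 1 \<omega> - B t \<omega>) + V \<omega> * of_real (max (?x \<omega>) (?S \<omega>))"
      by (simp only: of_real_add distrib_left)
  qed
  also have "\<dots> = (\<integral>\<omega>. V \<omega> * of_real (max (?x \<omega>) (?S \<omega>)) \<partial>M)"
    by (subst Bochner_Integration.integral_add[OF integrable_bounded_mult[OF VM V(2) Bi] integrable_bounded_mult[OF VM V(2) mi]])
      (simp only: z add_0)
  also have "\<dots> = (\<integral>\<omega>. ?f (V \<omega>, ?x \<omega>) (0, ?S \<omega>) \<partial>M)" by simp
  also have "\<dots> = (\<integral>\<omega>. (\<integral>\<omega>'. ?f (V \<omega>, ?x \<omega>) (0, ?S \<omega>') \<partial>M) \<partial>M)"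
  proof (rule indep_var_integral_freeze)
    show "indep_var (borel \<Otimes>\<^sub>M borel) (\<lambda>\<omega>. (V \<omega>, ?x \<omega>)) (borel \<Otimes>\<^sub>M borel) (\<lambda>\<omega>. (0, ?S \<omega>))"
      by (intro indep_var_past_future[OF t'] measurable_Pair V(1) x_past S_fut measurable_const) simp
    show "case_prod ?f \<in> borel_measurable ((borel \<Otimes>\<^sub>M borel) \<Otimes>\<^sub>M (borel \<Otimes>\<^sub>M borel))"
      by measurable
    show "integrable M (\<lambda>\<omega>. ?f (V \<omega>, ?x \<omega>) (0, ?S \<omega>))"
      using integrable_bounded_mult[OF VM V(2) mi] by simp
  qed
  also have "\<dots> = (\<integral>\<omega>. V \<omega> * of_real (max_mean (sqrt (1 - t)) (?x \<omega>)) \<partial>M)"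
  proof (intro Bochner_Integration.integral_cong refl)
    fix \<omega> assume "\<omega> \<in> space M"
    then show "(\<integral>\<omega>'. ?f (V \<omega>, ?x \<omega>) (0, ?S \<omega>') \<partial>M) =
        V \<omega> * of_real (max_mean (sqrt (1 - t)) (?x \<omega>))"
      using expectation_max_max_drop[OF t x0] by simp
  qed
  finally show ?thesis .
qed

end

section \<open>Expansion over a short time step\<close>

lemma exp_minus_taylor:
  fixes y :: real
  assumes "0 \<le> y" shows "\<bar>1 - exp (- y) - y\<bar> \<le> y\<^sup>2"
proof -
  have "1 - y \<le> exp (- y)" using exp_ge_add_one_self[of "- y"] by simp
  moreover have "exp (- y) \<le> 1 - y + y\<^sup>2"
  proof -
    have "1 + y \<le> exp y" by (rule exp_ge_add_one_self)
    then have "exp (- y) \<le> inverse (1 + y)"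
      using assms by (simp add: exp_minus le_imp_inverse_le)
    also have "\<dots> \<le> 1 - y + y\<^sup>2"
    proof -
      \<comment> \<open>The product equals \<open>1 + y ^ 3\<close>.\<close>
      have "1 \<le> (1 - y + y\<^sup>2) * (1 + y)"
        using assms by (simp add: algebra_simps power2_eq_square)
      then show ?thesis using assms by (simp add: inverse_eq_divide divide_le_eq)
    qed
    finally show ?thesis .
  qed
  ultimately show ?thesis by (simp add: abs_le_iff)
qed

text \<open>The cubic bound is meant for the factor \<open>D\<close>, the quadratic one for the
  factor \<open>D' - D\<close>, which supplies the missing order of smallness itself.\<close>

lemma iexp_taylor:
  fixes \<theta> :: real
  shows "norm (iexp \<theta> - 1 - \<i> * \<theta> + \<theta>\<^sup>2 / 2) \<le> \<bar>\<theta>\<bar> ^ 3" "norm (iexp \<theta> - 1 - \<i> * \<theta> + \<theta>\<^sup>2 / 2) \<le> \<theta>\<^sup>2"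
proof -
  have eq: "(\<Sum>k\<le>2. (\<i> * \<theta>) ^ k / fact k) = 1 + \<i> * \<theta> - \<theta>\<^sup>2 / 2"
  proof -
    have "(\<Sum>k\<le>2. F k) = F 0 + F 1 + F 2" for F :: "nat \<Rightarrow> complex"
      by (simp add: numeral_2_eq_2)
    then show ?thesis by (simp add: power_mult_distrib)
  qed
  have "norm (iexp \<theta> - 1 - \<i> * \<theta> + \<theta>\<^sup>2 / 2) = norm (iexp \<theta> - (\<Sum>k\<le>2. (\<i> * \<theta>) ^ k / fact k))"
    unfolding eq by (simp add: algebra_simps)
  moreover have "norm (iexp \<theta> - (\<Sum>k\<le>2. (\<i> * \<theta>) ^ k / fact k)) \<le> \<bar>\<theta>\<bar> ^ 3 / 6"
    using iexp_approx1[of \<theta> 2] by (simp add: eval_nat_numeral)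
  moreover have "\<bar>\<theta>\<bar> ^ 3 / 6 \<le> \<bar>\<theta>\<bar> ^ 3" by simp
  moreover have "norm (iexp \<theta> - (\<Sum>k\<le>2. (\<i> * \<theta>) ^ k / fact k)) \<le> \<theta>\<^sup>2"
    using iexp_approx2[of \<theta> 2] by simp
  ultimately show "norm (iexp \<theta> - 1 - \<i> * \<theta> + \<theta>\<^sup>2 / 2) \<le> \<bar>\<theta>\<bar> ^ 3" "norm (iexp \<theta> - 1 - \<i> * \<theta> + \<theta>\<^sup>2 / 2) \<le> \<theta>\<^sup>2"
    by linarith+
qed

text \<open>One summand for each of the nine remainders in \<open>one_step_error\<close>, in the
  order in which they occur there.\<close>

definition step_const :: "real \<Rightarrow> real \<Rightarrow> real" where
  "step_const e l = 27 * l ^ 3 / e ^ 3 + 27 * l\<^sup>2 / e ^ 3 + 27 * l\<^sup>2 / e ^ 3 + 18 * l / e\<^sup>2 + 2 * l / e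
     + 18 * l / e ^ 3 + 2 * l\<^sup>2 / e + 4 * l\<^sup>2 / e\<^sup>2 + l ^ 4"

lemma step_const_nonneg: "0 < e \<Longrightarrow> 0 \<le> l \<Longrightarrow> 0 \<le> step_const e l"
  by (auto simp: step_const_def intro!: add_nonneg_nonneg)

text \<open>One step of the expansion. The terms \<open>\<Delta> D\<close>, \<open>g (\<Delta>\<^sup>2 - h)\<close> and \<open>(\<Delta>\<^sup>2 - h) D\<close> have mean zero
  given the past, and \<open>D' - D\<close> is a martingale increment; the drift \<open>c = g / D\<close> is exactly what cancels the
  remaining term \<open>\<i> \<lambda> h g\<close>.\<close>

lemma one_step_error:
  fixes h e l \<Delta> C D D' g c \<rho> lam :: real
  assumes h: "0 < h" "h \<le> 1" and e: "0 < e" "e \<le> 1" and D: "0 \<le> D" and g: "0 \<le> g" "g \<le> 1" "c * D = g"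
    and rho: "h \<le> \<rho>\<^sup>2" "h \<le> \<rho>" "\<bar>\<Delta>\<bar> \<le> \<rho>" "0 \<le> C" "C \<le> 2 / e * h"
    "\<bar>C - h * c\<bar> \<le> 18 / e ^ 3 * \<rho> ^ 3" "\<bar>D' - D - g * \<Delta>\<bar> \<le> 6 / e * \<rho>\<^sup>2" "\<bar>D' - D\<bar> \<le> 3 / e * \<rho>"
  shows "norm (iexp (lam * (\<Delta> - C)) * D' - exp (- (lam\<^sup>2 * h / 2)) * D
    - (of_real (D' - D) + \<i> * of_real (lam * \<Delta> * D) + \<i> * of_real (lam * g * (\<Delta>\<^sup>2 - h)) - of_real (lam\<^sup>2 / 2 * (\<Delta>\<^sup>2 - h) * D)))
    \<le> step_const e \<bar>lam\<bar> * (\<rho> ^ 3 * (1 + D))"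
proof -
  define l where "l = \<bar>lam\<bar>"
  define \<theta> where "\<theta> = lam * (\<Delta> - C)"
  define E where "E = iexp \<theta> - 1 - \<i> * \<theta> + \<theta>\<^sup>2 / 2"
  define e2 where "e2 = D' - D - g * \<Delta>"
  define y where "y = lam\<^sup>2 * h / 2"
  have l0: "0 \<le> l" "lam\<^sup>2 = l\<^sup>2" by (auto simp: l_def)
  have rho0: "0 \<le> \<rho>" using rho(2) h by linarith
  have e1: "1 \<le> 1 / e" using e by simp
  have rho_e: "\<rho> \<le> \<rho> / e" using mult_left_mono[OF e1 rho0] by simp
  have C1: "C \<le> 2 / e * \<rho>" using rho(5) mult_left_mono[OF rho(2), of "2 / e"] e by simp
  have C2: "C \<le> 2 / e * \<rho>\<^sup>2" using rho(5) mult_left_mono[OF rho(1), of "2 / e"] e by simp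
  have "\<bar>\<Delta> - C\<bar> \<le> 3 / e * \<rho>" using rho(3,4) C1 rho_e by (simp add: abs_le_iff)
  then have th: "\<bar>\<theta>\<bar> \<le> l * (3 / e * \<rho>)"
    unfolding \<theta>_def abs_mult l_def by (intro mult_left_mono) auto
  have th2: "\<theta>\<^sup>2 \<le> 9 * l\<^sup>2 / e\<^sup>2 * \<rho>\<^sup>2"
    using power_mono[OF th, of 2] by (simp add: power_mult_distrib power_divide ac_simps)
  have th3: "\<bar>\<theta>\<bar> ^ 3 \<le> 27 * l ^ 3 / e ^ 3 * \<rho> ^ 3"
    using power_mono[OF th, of 3] by (simp add: power_mult_distrib power_divide ac_simps)
  have E: "norm E \<le> \<bar>\<theta>\<bar> ^ 3" "norm E \<le> \<theta>\<^sup>2" unfolding E_def by (rule iexp_taylor)+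
  have p3: "\<rho> ^ 3 = \<rho>\<^sup>2 * \<rho>" "0 \<le> \<rho> ^ 3" "\<rho> ^ 3 = \<rho> * \<rho>\<^sup>2" using rho0 by (auto simp: power3_eq_cube power2_eq_square)
  let ?err = "iexp \<theta> * D' - exp (- y) * D
    - (of_real (D' - D) + \<i> * of_real (lam * \<Delta> * D) + \<i> * of_real (lam * g * (\<Delta>\<^sup>2 - h)) - of_real (lam\<^sup>2 / 2 * (\<Delta>\<^sup>2 - h) * D))"
  \<comment> \<open>The exponential is expanded and multiplied by \<open>D + (D' - D)\<close>, with
    \<open>D' - D = g * \<Delta> + e2\<close> in the linear term. Besides small products this leaves
    \<open>lam * g * h - lam * C * D\<close>, and \<open>g = c * D\<close> turns it into
    \<open>- lam * (C - h * c) * D\<close>.\<close>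
  have "?err = E * D + E * (D' - D) - of_real (\<theta>\<^sup>2 / 2 * (D' - D)) + \<i> * of_real (\<theta> * e2) - \<i> * of_real (lam * g * C * \<Delta>)
      - \<i> * of_real (lam * (C - h * c) * D) + of_real (l\<^sup>2 * (\<Delta> * C) * D) - of_real (l\<^sup>2 / 2 * C\<^sup>2 * D)
      + of_real ((1 - exp (- y) - y) * D)"
    unfolding E_def e2_def y_def \<theta>_def l0(2)[symmetric] using g(3)[symmetric]
    by (simp add: field_simps power2_eq_square)
  also have "norm \<dots> \<le> norm (E * D) + norm (E * (D' - D)) + \<bar>\<theta>\<^sup>2 / 2 * (D' - D)\<bar> + \<bar>\<theta> * e2\<bar> + \<bar>lam * g * C * \<Delta>\<bar>
      + \<bar>lam * (C - h * c) * D\<bar> + \<bar>l\<^sup>2 * (\<Delta> * C) * D\<bar> + \<bar>l\<^sup>2 / 2 * C\<^sup>2 * D\<bar> + \<bar>(1 - exp (- y) - y) * D\<bar>"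
  proof -
    have "norm (\<i> * of_real r) = \<bar>r\<bar>" for r :: real by (simp add: norm_mult)
    then show ?thesis
      by (intro norm_triangle_le norm_triangle_le_diff add_mono) (simp_all only: norm_of_real order_refl)
  qed
  also have "\<dots> \<le> 27 * l ^ 3 / e ^ 3 * \<rho> ^ 3 * D + 27 * l\<^sup>2 / e ^ 3 * \<rho> ^ 3 + 27 * l\<^sup>2 / e ^ 3 * \<rho> ^ 3 + 18 * l / e\<^sup>2 * \<rho> ^ 3
      + 2 * l / e * \<rho> ^ 3 + 18 * l / e ^ 3 * \<rho> ^ 3 * D + 2 * l\<^sup>2 / e * \<rho> ^ 3 * D + 4 * l\<^sup>2 / e\<^sup>2 * \<rho> ^ 3 * D + l ^ 4 * \<rho> ^ 3 * D"
  proof (intro add_mono)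
    show "norm (E * D) \<le> 27 * l ^ 3 / e ^ 3 * \<rho> ^ 3 * D"
    proof -
      have "norm (E * D) = norm E * D" using D by (simp add: norm_mult)
      also have "\<dots> \<le> 27 * l ^ 3 / e ^ 3 * \<rho> ^ 3 * D"
        using order_trans[OF E(1) th3] D by (rule mult_right_mono)
      finally show ?thesis .
    qed
    have ED: "\<theta>\<^sup>2 * \<bar>D' - D\<bar> \<le> 9 * l\<^sup>2 / e\<^sup>2 * \<rho>\<^sup>2 * (3 / e * \<rho>)"
      using th2 rho(8) by (intro mult_mono) auto
    have ED': "9 * l\<^sup>2 / e\<^sup>2 * \<rho>\<^sup>2 * (3 / e * \<rho>) = 27 * l\<^sup>2 / e ^ 3 * \<rho> ^ 3"
      by (simp add: power2_eq_square power3_eq_cube)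
    have "norm (E * (D' - D)) = norm E * \<bar>D' - D\<bar>" 
      by (simp only: norm_mult of_real_diff[symmetric] norm_of_real)
    also have "\<dots> \<le> \<theta>\<^sup>2 * \<bar>D' - D\<bar>" using E(2) by (intro mult_right_mono) auto
    finally show "norm (E * (D' - D)) \<le> 27 * l\<^sup>2 / e ^ 3 * \<rho> ^ 3"
      using ED unfolding ED' by (rule order_trans)
    have "\<bar>\<theta>\<^sup>2 / 2 * (D' - D)\<bar> \<le> \<theta>\<^sup>2 * \<bar>D' - D\<bar>"
      unfolding abs_mult by (intro mult_right_mono) auto
    then show "\<bar>\<theta>\<^sup>2 / 2 * (D' - D)\<bar> \<le> 27 * l\<^sup>2 / e ^ 3 * \<rho> ^ 3"
      using ED unfolding ED' by (rule order_trans)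
    have "\<bar>\<theta> * e2\<bar> \<le> l * (3 / e * \<rho>) * (6 / e * \<rho>\<^sup>2)"
      unfolding abs_mult e2_def using th rho(7) l0 by (intro mult_mono) auto
    also have "\<dots> = 18 * l / e\<^sup>2 * \<rho> ^ 3" by (simp add: power2_eq_square power3_eq_cube)
    finally show "\<bar>\<theta> * e2\<bar> \<le> 18 * l / e\<^sup>2 * \<rho> ^ 3" .
    have "\<bar>lam * g * C * \<Delta>\<bar> = l * g * C * \<bar>\<Delta>\<bar>" using g rho(4) by (simp add: abs_mult l_def)
    also have "\<dots> \<le> l * 1 * (2 / e * \<rho>\<^sup>2) * \<rho>"
      using l0 g rho(3,4) C2 e by (intro mult_mono) auto
    finally show "\<bar>lam * g * C * \<Delta>\<bar> \<le> 2 * l / e * \<rho> ^ 3"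
      by (simp add: power2_eq_square power3_eq_cube ac_simps)
    have "\<bar>lam * (C - h * c) * D\<bar> \<le> l * (18 / e ^ 3 * \<rho> ^ 3) * D"
      unfolding abs_mult l_def[symmetric] using l0 rho(6) D e p3(2) by (intro mult_mono) auto
    then show "\<bar>lam * (C - h * c) * D\<bar> \<le> 18 * l / e ^ 3 * \<rho> ^ 3 * D"
      by (simp add: ac_simps)
    have "\<bar>l\<^sup>2 * (\<Delta> * C) * D\<bar> \<le> l\<^sup>2 * (\<rho> * (2 / e * \<rho>\<^sup>2)) * D"
      unfolding abs_mult using l0 rho(3,4) C2 D e rho0 by (intro mult_mono) auto
    then show "\<bar>l\<^sup>2 * (\<Delta> * C) * D\<bar> \<le> 2 * l\<^sup>2 / e * \<rho> ^ 3 * D"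
      by (simp add: power2_eq_square power3_eq_cube ac_simps)
    \<comment> \<open>\<open>C\<close> is of second order; one factor is bounded by
      \<open>\<rho>\<close> only, so that the product has exactly the order
      \<open>\<rho> ^ 3\<close> of the other remainders.\<close>
    have "C * C \<le> (2 / e * \<rho>) * (2 / e * \<rho>\<^sup>2)" using C1 C2 rho(4) rho0 e by (intro mult_mono) auto
    then have "l\<^sup>2 / 2 * C\<^sup>2 * D \<le> l\<^sup>2 / 2 * ((2 / e * \<rho>) * (2 / e * \<rho>\<^sup>2)) * D"
      unfolding power2_eq_square[of C] using D by (intro mult_right_mono mult_left_mono) auto
    also have "\<dots> \<le> l\<^sup>2 * ((2 / e * \<rho>) * (2 / e * \<rho>\<^sup>2)) * D"
      using D rho0 e by (intro mult_right_mono) auto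
    also have "\<dots> = 4 * l\<^sup>2 / e\<^sup>2 * \<rho> ^ 3 * D" by (simp add: power2_eq_square power3_eq_cube)
    finally show "\<bar>l\<^sup>2 / 2 * C\<^sup>2 * D\<bar> \<le> 4 * l\<^sup>2 / e\<^sup>2 * \<rho> ^ 3 * D"
      using D by (simp add: abs_mult)
    have "h * h \<le> \<rho> * \<rho>\<^sup>2" using rho h rho0 by (intro mult_mono) auto
    have "y = l\<^sup>2 * h / 2" by (simp add: y_def l0)
    then have "y\<^sup>2 = l ^ 4 / 4 * (h * h)"
      by (simp only: power2_eq_square) (simp add: eval_nat_numeral)
    also have "\<dots> \<le> l ^ 4 * (h * h)" using h by (intro mult_right_mono) auto
    also have "\<dots> \<le> l ^ 4 * \<rho> ^ 3" unfolding p3(3) using \<open>h * h \<le> \<rho> * \<rho>\<^sup>2\<close> l0 by (intro mult_left_mono) auto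
    finally have "y\<^sup>2 \<le> l ^ 4 * \<rho> ^ 3" .
    moreover have "\<bar>1 - exp (- y) - y\<bar> \<le> y\<^sup>2" using h by (intro exp_minus_taylor) (auto simp: y_def)
    ultimately have "\<bar>1 - exp (- y) - y\<bar> \<le> l ^ 4 * \<rho> ^ 3" by linarith
    then show "\<bar>(1 - exp (- y) - y) * D\<bar> \<le> l ^ 4 * \<rho> ^ 3 * D"
      unfolding abs_mult using D by (simp only: abs_of_nonneg mult_right_mono)
  qed
  also have "\<dots> \<le> step_const e l * (\<rho> ^ 3 * (1 + D))"
  proof -
    have K1: "a * \<rho> ^ 3 * D \<le> a * (\<rho> ^ 3 * (1 + D))" if "0 \<le> a" for a
      using that p3(2) by (simp add: algebra_simps)
    have K2: "a * \<rho> ^ 3 \<le> a * (\<rho> ^ 3 * (1 + D))" if "0 \<le> a" for a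
      using that p3(2) D by (simp add: algebra_simps)
    show ?thesis
      unfolding step_const_def distrib_right
      by (intro add_mono K1 K2) (use l0 e in auto)
  qed
  finally show ?thesis by (simp add: \<theta>_def y_def l_def)
qed

text \<open>The inequality \<open>(x + y) ^ 3 \<le> 4 * (x ^ 3 + y ^ 3)\<close> is used twice;
  \<open>a\<close> and \<open>b\<close> pass through both uses, which makes 16.\<close>

lemma power3_sum_le:
  fixes a b c :: real
  assumes "0 \<le> a" "0 \<le> b" "0 \<le> c"
  shows "(a + b + c) ^ 3 \<le> 16 * a ^ 3 + 16 * b ^ 3 + 4 * c ^ 3"
proof -
  have two: "(x + y) ^ 3 \<le> 4 * (x ^ 3 + y ^ 3)" if "0 \<le> x" "0 \<le> y" for x y :: real
  proof -
    have "0 \<le> 3 * (x + y) * (x - y)\<^sup>2" using that by simp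
    also have "\<dots> = 4 * (x ^ 3 + y ^ 3) - (x + y) ^ 3"
      by (simp add: power2_eq_square power3_eq_cube algebra_simps)
    finally show ?thesis by simp
  qed
  show ?thesis using two[of "a + b" c] two[of a b] assms by simp
qed

section \<open>Size of the oscillation and mean error of one step\<close>

context brownian_from_0
begin

text \<open>Rises of \<open>B\<close> are drops of \<open>- B\<close>, so the reflection principle
  also covers the largest rise.\<close>

lemma brownian_from_0_uminus: "brownian_from_0 M (\<lambda>u \<omega>. - B u \<omega>)"
proof
  show "- B 0 \<omega> = 0" if "\<omega> \<in> space M" for \<omega> using B_0[OF that] by simp
  show "brownian_motion M (\<lambda>u \<omega>. - B u \<omega>)"
    unfolding brownian_motion_def
  proof (intro conjI allI impI)
    show "prob_space M" by unfold_locales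
    show "continuous_process M (\<lambda>u \<omega>. - B u \<omega>)"
      using bm by (auto simp: brownian_motion_def continuous_process_def intro!: continuous_intros)
    show "AE \<omega> in M. - B 0 \<omega> = 0" using bm by (simp add: brownian_motion_def)
    fix n :: nat and \<tau> :: "nat \<Rightarrow> real"
    assume \<tau>: "(\<forall>i\<le>n. \<tau> i \<in> {0..1}) \<and> (\<forall>i<n. \<tau> i \<le> \<tau> (Suc i))"
    then have "indep_vars (\<lambda>_. borel) (\<lambda>i \<omega>. B (\<tau> (Suc i)) \<omega> - B (\<tau> i) \<omega>) {..<n}"
      using bm by (simp add: brownian_motion_def)
    then have "indep_vars (\<lambda>_. borel) (\<lambda>i \<omega>. - (B (\<tau> (Suc i)) \<omega> - B (\<tau> i) \<omega>)) {..<n}"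
      by (rule indep_vars_compose2) measurable
    then show "indep_vars (\<lambda>_. borel) (\<lambda>i \<omega>. - B (\<tau> (Suc i)) \<omega> - - B (\<tau> i) \<omega>) {..<n}"
      by (simp add: algebra_simps)
  next
    fix s t :: real assume "0 \<le> s \<and> s < t \<and> t \<le> 1"
    then have "distributed M lborel (\<lambda>\<omega>. 0 + (- 1) * (B t \<omega> - B s \<omega>)) (normal_density (0 + (- 1) * 0) (\<bar>- 1\<bar> * sqrt (t - s)))"
      by (intro normal_density_affine B_increment) auto
    then show "distributed M lborel (\<lambda>\<omega>. - B t \<omega> - - B s \<omega>) (normal_density 0 (sqrt (t - s)))"
      by simp
  qed
qed

text \<open>The bound \<open>\<rho>\<close> of \<open>path_step\<close> as a random
  variable.\<close>

definition oscillation :: "real \<Rightarrow> real \<Rightarrow> 'a \<Rightarrow> real" where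
  "oscillation t h \<omega> = max_drop (\<lambda>u. B u \<omega>) t (t + h) + max_drop (\<lambda>u. - B u \<omega>) t (t + h) + sqrt h"

lemma oscillation_future:
  assumes "0 \<le> t" "0 < h" "t + h \<le> 1"
  shows "oscillation t h \<in> borel_measurable (future t)"
proof -
  have [measurable]: "(\<lambda>\<omega>. max_drop (\<lambda>u. B u \<omega>) t (t + h)) \<in> borel_measurable (future t)"
    using assms by (intro max_drop_future) auto
  have [measurable]: "(\<lambda>\<omega>. max_drop (\<lambda>u. - B u \<omega>) t (t + h)) \<in> borel_measurable (future t)"
  proof (rule borel_measurable_max_drop)
    fix u assume "u \<in> {t..t + h}"
    then have "(\<lambda>\<omega>. B u \<omega> - B t \<omega>) \<in> borel_measurable (future t)"
      using assms by (intro B_future) auto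
    then show "(\<lambda>\<omega>. - B t \<omega> - - B u \<omega>) \<in> borel_measurable (future t)" by simp
  qed (use assms in \<open>auto intro!: continuous_intros B_continuous\<close>)
  show ?thesis unfolding oscillation_def[abs_def] by measurable
qed

text \<open>Largest drop and largest rise have the third absolute moment of a normal increment, at
  most \<open>2 * sqrt h ^ 3\<close>. With the weights of \<open>power3_sum_le\<close> this gives 68
  = 16 * 2 + 16 * 2 + 4.\<close>

lemma oscillation_cube:
  assumes t: "0 \<le> t" "0 < h" "t + h \<le> 1"
  shows "integrable M (\<lambda>\<omega>. oscillation t h \<omega> ^ 3)"
    and "(\<integral>\<omega>. oscillation t h \<omega> ^ 3 \<partial>M) \<le> 68 * sqrt h ^ 3"
    and "\<omega> \<in> space M \<Longrightarrow> 0 \<le> oscillation t h \<omega>"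
proof -
  interpret neg: brownian_from_0 M "\<lambda>u \<omega>. - B u \<omega>" by (rule brownian_from_0_uminus)
  let ?S = "\<lambda>\<omega>. max_drop (\<lambda>u. B u \<omega>) t (t + h)" and ?S' = "\<lambda>\<omega>. max_drop (\<lambda>u. - B u \<omega>) t (t + h)"
  have th: "0 \<le> t" "t < t + h" "t + h \<le> 1" using t by auto
  have i: "integrable M (\<lambda>\<omega>. ?S \<omega> ^ 3)" "integrable M (\<lambda>\<omega>. ?S' \<omega> ^ 3)"
    using max_drop_power_integrable[OF th, of 3] neg.max_drop_power_integrable[OF th, of 3] by auto
  have e: "(\<integral>\<omega>. ?S \<omega> ^ 3 \<partial>M) \<le> 2 * sqrt h ^ 3" "(\<integral>\<omega>. ?S' \<omega> ^ 3 \<partial>M) \<le> 2 * sqrt h ^ 3"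
    using max_drop_power_integral[OF th, of 3] neg.max_drop_power_integral[OF th, of 3]
      increment_cube[OF th] neg.increment_cube[OF th] by auto
  have S0: "0 \<le> ?S \<omega>" "0 \<le> ?S' \<omega>" if "\<omega> \<in> space M" for \<omega>
    using that t by (auto intro!: max_drop_nonneg continuous_intros B_continuous)
  show osc0: "\<omega> \<in> space M \<Longrightarrow> 0 \<le> oscillation t h \<omega>" for \<omega>
    using S0[of \<omega>] t by (auto simp: oscillation_def)
  have le: "oscillation t h \<omega> ^ 3 \<le> 16 * ?S \<omega> ^ 3 + 16 * ?S' \<omega> ^ 3 + 4 * sqrt h ^ 3" if "\<omega> \<in> space M" for \<omega>
    unfolding oscillation_def using S0[OF that] t by (intro power3_sum_le) auto
  have ib: "integrable M (\<lambda>\<omega>. 16 * ?S \<omega> ^ 3 + 16 * ?S' \<omega> ^ 3 + 4 * sqrt h ^ 3)" using i by simp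
  have [measurable]: "oscillation t h \<in> borel_measurable M"
    using t by (intro future_measurable[OF oscillation_future]) auto
  show io: "integrable M (\<lambda>\<omega>. oscillation t h \<omega> ^ 3)"
  proof (rule Bochner_Integration.integrable_bound[OF ib])
    show "AE \<omega> in M. norm (oscillation t h \<omega> ^ 3) \<le> norm (16 * ?S \<omega> ^ 3 + 16 * ?S' \<omega> ^ 3 + 4 * sqrt h ^ 3)"
    proof (rule AE_I2)
      fix \<omega> assume \<omega>: "\<omega> \<in> space M"
      have "0 \<le> oscillation t h \<omega> ^ 3" using osc0[OF \<omega>] by simp
      then show "norm (oscillation t h \<omega> ^ 3) \<le> norm (16 * ?S \<omega> ^ 3 + 16 * ?S' \<omega> ^ 3 + 4 * sqrt h ^ 3)"
        using le[OF \<omega>] unfolding real_norm_def by linarith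
    qed
  qed measurable
  have "(\<integral>\<omega>. oscillation t h \<omega> ^ 3 \<partial>M) \<le> (\<integral>\<omega>. 16 * ?S \<omega> ^ 3 + 16 * ?S' \<omega> ^ 3 + 4 * sqrt h ^ 3 \<partial>M)"
    by (rule integral_mono[OF io ib le])
  also have "\<dots> = 16 * (\<integral>\<omega>. ?S \<omega> ^ 3 \<partial>M) + 16 * (\<integral>\<omega>. ?S' \<omega> ^ 3 \<partial>M) + 4 * sqrt h ^ 3"
    using i by (simp add: prob_space)
  finally show "(\<integral>\<omega>. oscillation t h \<omega> ^ 3 \<partial>M) \<le> 68 * sqrt h ^ 3" using e by linarith
qed

text \<open>The one-step expansion is integrated against an arbitrary bounded factor
  \<open>V\<close> from the past: up to order \<open>h powr (3/2)\<close>, the weighted increment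
  behaves like a normal variable of variance \<open>h\<close> whatever has happened before.\<close>

lemma innovation_step:
  fixes V :: "'a \<Rightarrow> complex" and lam :: real
  assumes t: "0 \<le> t" "0 < h" "h \<le> 1" "t + h < 1" and e: "0 < e" "e \<le> 1" "e \<le> sqrt (1 - (t + h))"
    and V: "V \<in> borel_measurable (past t)" "\<And>\<omega>. norm (V \<omega>) \<le> 1"
  shows "norm ((\<integral>\<omega>. V \<omega> * iexp (lam * (innovation (\<lambda>u. B u \<omega>) (t + h) - innovation (\<lambda>u. B u \<omega>) t)) *
        of_real (above_min (\<lambda>u. B u \<omega>) 1) \<partial>M)
      - exp (- (lam\<^sup>2 * h / 2)) * (\<integral>\<omega>. V \<omega> * of_real (above_min (\<lambda>u. B u \<omega>) 1) \<partial>M))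
    \<le> step_const e \<bar>lam\<bar> * (68 * sqrt h ^ 3 * (2 + (\<integral>\<omega>. max_drop (\<lambda>u. B u \<omega>) 0 1 \<partial>M)))"
proof -
  define D D' where "D \<omega> = max_mean (sqrt (1 - t)) (above_min (\<lambda>u. B u \<omega>) t)"
    and "D' \<omega> = max_mean (sqrt (1 - (t + h))) (above_min (\<lambda>u. B u \<omega>) (t + h))" for \<omega>
  define g where "g \<omega> = abs_prob (above_min (\<lambda>u. B u \<omega>) t / sqrt (1 - t))" for \<omega>
  define \<Delta> C where "\<Delta> \<omega> = B (t + h) \<omega> - B t \<omega>" and "C \<omega> = drift_integral (\<lambda>u. B u \<omega>) t (t + h)" for \<omega>
  define F where "F \<omega> = iexp (lam * (innovation (\<lambda>u. B u \<omega>) (t + h) - innovation (\<lambda>u. B u \<omega>) t))" for \<omega>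
  let ?K = "step_const e \<bar>lam\<bar>" and ?\<rho> = "oscillation t h"
  have th: "0 \<le> t" "t \<le> 1" "0 \<le> t + h" "t + h \<le> 1" "t < 1" "t \<le> t + h" "t < t + h" using t by auto
  have K0: "0 \<le> ?K" using e by (intro step_const_nonneg) auto
  have x0: "0 \<le> above_min (\<lambda>u. B u \<omega>) t" if "\<omega> \<in> space M" for \<omega>
    using th that by (intro path_above_min_nonneg path_cont) auto
  have D0: "0 \<le> D \<omega>" if "\<omega> \<in> space M" for \<omega>
    unfolding D_def using th that by (intro max_mean_above_min_integrable(3)) auto
  have xm: "(\<lambda>\<omega>. above_min (\<lambda>u. B u \<omega>) t) \<in> borel_measurable (past t)" using th by (intro above_min_past) auto
  have D_past: "D \<in> borel_measurable (past t)" unfolding D_def[abs_def] by (rule measurable_compose[OF xm]) measurable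
  have g_past: "g \<in> borel_measurable (past t)" unfolding g_def[abs_def] by (rule measurable_compose[OF xm]) measurable
  have Di: "integrable M D" unfolding D_def[abs_def] using th by (intro max_mean_above_min_integrable) auto
  have D'i: "integrable M D'" unfolding D'_def[abs_def] using t by (intro max_mean_above_min_integrable) auto
  have D_E: "(\<integral>\<omega>. D \<omega> \<partial>M) \<le> (\<integral>\<omega>. max_drop (\<lambda>u. B u \<omega>) 0 1 \<partial>M) + 1"
    unfolding D_def[abs_def] using th by (intro max_mean_above_min_integrable) auto
  have g01: "0 \<le> g \<omega>" "g \<omega> \<le> 1" if "\<omega> \<in> space M" for \<omega>
    unfolding g_def using x0[OF that] th by (auto intro!: abs_prob_bounds)
  have V_past': "V \<in> borel_measurable (past (t + h))" using V(1) th(6) by (rule past_mono)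
  have VM: "V \<in> borel_measurable M" using V(1) th(2) by (rule past_measurable)
  have F_past: "F \<in> borel_measurable (past (t + h))"
  proof -
    have [measurable]: "(\<lambda>\<omega>. innovation (\<lambda>u. B u \<omega>) (t + h)) \<in> borel_measurable (past (t + h))"
      by (rule innovation_past[OF th(3,4)])
    have [measurable]: "(\<lambda>\<omega>. innovation (\<lambda>u. B u \<omega>) t) \<in> borel_measurable (past (t + h))"
      by (rule past_mono[OF innovation_past[OF th(1,2)] th(6)])
    show ?thesis unfolding F_def[abs_def] by measurable
  qed
  have VF: "(\<lambda>\<omega>. V \<omega> * F \<omega>) \<in> borel_measurable (past (t + h))" "norm (V \<omega> * F \<omega>) \<le> 1" for \<omega>
  proof -
    show "(\<lambda>\<omega>. V \<omega> * F \<omega>) \<in> borel_measurable (past (t + h))"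
      by (intro borel_measurable_times V_past' F_past)
    show "norm (V \<omega> * F \<omega>) \<le> 1" using V(2)[of \<omega>] by (simp add: norm_mult F_def)
  qed
  have VFM: "(\<lambda>\<omega>. V \<omega> * F \<omega>) \<in> borel_measurable M" using VF(1) th(4) by (rule past_measurable)
  have mart1: "(\<integral>\<omega>. V \<omega> * F \<omega> * of_real (above_min (\<lambda>u. B u \<omega>) 1) \<partial>M) = (\<integral>\<omega>. V \<omega> * F \<omega> * of_real (D' \<omega>) \<partial>M)"
    unfolding D'_def using t by (intro above_min_martingale VF) auto
  have mart2: "(\<integral>\<omega>. V \<omega> * of_real (above_min (\<lambda>u. B u \<omega>) 1) \<partial>M) = (\<integral>\<omega>. V \<omega> * of_real (D \<omega>) \<partial>M)"
    unfolding D_def using th by (intro above_min_martingale V) auto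
  have mart3: "(\<integral>\<omega>. V \<omega> * of_real (above_min (\<lambda>u. B u \<omega>) 1) \<partial>M) = (\<integral>\<omega>. V \<omega> * of_real (D' \<omega>) \<partial>M)"
    unfolding D'_def using t by (intro above_min_martingale V_past' V(2)) auto
  have iVF: "integrable M (\<lambda>\<omega>. V \<omega> * F \<omega> * of_real (D' \<omega>))" by (rule integrable_bounded_mult[OF VFM VF(2) D'i])
  have iVD: "integrable M (\<lambda>\<omega>. V \<omega> * of_real (D \<omega>))" by (rule integrable_bounded_mult[OF VM V(2) Di])
  have iVD': "integrable M (\<lambda>\<omega>. V \<omega> * of_real (D' \<omega>))" by (rule integrable_bounded_mult[OF VM V(2) D'i])
  have VD_past: "(\<lambda>\<omega>. V \<omega> * of_real (D \<omega>)) \<in> borel_measurable (past t)"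
    by (intro borel_measurable_times V(1) measurable_compose[OF D_past complex_of_real_measurable])
  have Vg_past: "(\<lambda>\<omega>. V \<omega> * of_real (g \<omega>)) \<in> borel_measurable (past t)"
    by (intro borel_measurable_times V(1) measurable_compose[OF g_past complex_of_real_measurable])
  have iVg: "integrable M (\<lambda>\<omega>. V \<omega> * of_real (g \<omega>))"
  proof (rule integrable_const_bound[of _ 1])
    show "AE \<omega> in M. norm (V \<omega> * of_real (g \<omega>)) \<le> 1"
    proof (rule AE_I2)
      fix \<omega> assume "\<omega> \<in> space M"
      then show "norm (V \<omega> * of_real (g \<omega>)) \<le> 1"
        using V(2)[of \<omega>] g01[of \<omega>] by (simp add: norm_mult mult_le_one)
    qed
  qed (rule past_measurable[OF Vg_past th(2)])
  have \<Delta>_fut: "\<Delta> \<in> borel_measurable (future t)" unfolding \<Delta>_def[abs_def] using th by (intro B_future) auto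
  then have \<Delta>2_fut: "(\<lambda>\<omega>. (\<Delta> \<omega>)\<^sup>2 - h) \<in> borel_measurable (future t)" by measurable
  have i\<Delta>: "integrable M \<Delta>" unfolding \<Delta>_def[abs_def] using th by (intro B_integrable) auto
  have i\<Delta>2: "integrable M (\<lambda>\<omega>. (\<Delta> \<omega>)\<^sup>2 - h)"
    using increment_power_integrable[OF th(1,7,4), of 2] by (simp add: \<Delta>_def)
  have E\<Delta>: "(\<integral>\<omega>. \<Delta> \<omega> \<partial>M) = 0" unfolding \<Delta>_def by (rule increment_mean[OF th(1,7,4)])
  have E\<Delta>2: "(\<integral>\<omega>. (\<Delta> \<omega>)\<^sup>2 - h \<partial>M) = 0"
    using increment_square[OF th(1,7,4)] increment_power_integrable[OF th(1,7,4), of 2]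
    by (simp add: \<Delta>_def prob_space)
  note z1 = indep_integral_zero[OF th(1,2) VD_past \<Delta>_fut iVD i\<Delta>]
  note z2 = indep_integral_zero[OF th(1,2) Vg_past \<Delta>2_fut iVg i\<Delta>2]
  note z3 = indep_integral_zero[OF th(1,2) VD_past \<Delta>2_fut iVD i\<Delta>2]
  \<comment> \<open>The leading part of the expansion. Its integral vanishes: the first bracket by
    the martingale property, each other term because a centred future factor is independent of its
    past factor.\<close>
  define Q where "Q \<omega> = (V \<omega> * of_real (D' \<omega>) - V \<omega> * of_real (D \<omega>)) + (\<i> * lam) * (V \<omega> * of_real (D \<omega>) * of_real (\<Delta> \<omega>))
      + (\<i> * lam) * (V \<omega> * of_real (g \<omega>) * of_real ((\<Delta> \<omega>)\<^sup>2 - h))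
      - of_real (lam\<^sup>2 / 2) * (V \<omega> * of_real (D \<omega>) * of_real ((\<Delta> \<omega>)\<^sup>2 - h))" for \<omega>
  note i1 = Bochner_Integration.integrable_diff[OF iVD' iVD]
  note i2 = integrable_mult_right[OF z1(1), of "\<i> * lam"]
  note i3 = integrable_mult_right[OF z2(1), of "\<i> * lam"]
  note i4 = integrable_mult_right[OF z3(1), of "of_real (lam\<^sup>2 / 2)"]
  note i12 = Bochner_Integration.integrable_add[OF i1 i2]
  note i123 = Bochner_Integration.integrable_add[OF i12 i3]
  have iQ: "integrable M Q"
    unfolding Q_def[abs_def] by (rule Bochner_Integration.integrable_diff[OF i123 i4])
  have EQ: "(\<integral>\<omega>. Q \<omega> \<partial>M) = 0"
    unfolding Q_def
    by (simp only: Bochner_Integration.integral_diff[OF i123 i4] Bochner_Integration.integral_add[OF i12 i3]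
      Bochner_Integration.integral_add[OF i1 i2] Bochner_Integration.integral_diff[OF iVD' iVD]
      integral_mult_right_zero z1(2)[OF E\<Delta>] z2(2)[OF E\<Delta>2] z3(2)[OF E\<Delta>2] mart2[symmetric] mart3[symmetric]) simp
  define R where "R \<omega> = V \<omega> * F \<omega> * of_real (D' \<omega>) - exp (- (lam\<^sup>2 * h / 2)) * (V \<omega> * of_real (D \<omega>)) - Q \<omega>" for \<omega>
  note i5 = integrable_mult_right[OF iVD, of "of_real (exp (- (lam\<^sup>2 * h / 2)))"]
  note i6 = Bochner_Integration.integrable_diff[OF iVF i5]
  have ER: "(\<integral>\<omega>. R \<omega> \<partial>M) = (\<integral>\<omega>. V \<omega> * F \<omega> * of_real (D' \<omega>) \<partial>M) - exp (- (lam\<^sup>2 * h / 2)) * (\<integral>\<omega>. V \<omega> * of_real (D \<omega>) \<partial>M)"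
    unfolding R_def
    by (simp only: Bochner_Integration.integral_diff[OF i6 iQ] Bochner_Integration.integral_diff[OF iVF i5] EQ integral_mult_right_zero) simp
  have bound: "norm (R \<omega>) \<le> ?K * (?\<rho> \<omega> ^ 3 * (1 + D \<omega>))" if \<omega>: "\<omega> \<in> space M" for \<omega>
  proof -
    have inn: "innovation (\<lambda>u. B u \<omega>) (t + h) - innovation (\<lambda>u. B u \<omega>) t = \<Delta> \<omega> - C \<omega>"
      unfolding \<Delta>_def C_def using th by (intro innovation_diff path_cont \<omega>) auto
    have dr: "drift t (above_min (\<lambda>u. B u \<omega>) t) * D \<omega> = g \<omega>"
      using max_mean_ge[of "sqrt (1 - t)" "above_min (\<lambda>u. B u \<omega>) t"] x0[OF \<omega>] th
      by (auto simp: drift_def D_def g_def)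
    note ps = path_step[OF path_cont[OF \<omega>] t e, folded oscillation_def, folded D_def D'_def g_def \<Delta>_def C_def]
    have err: "norm (iexp (lam * (\<Delta> \<omega> - C \<omega>)) * D' \<omega> - exp (- (lam\<^sup>2 * h / 2)) * D \<omega>
    - (of_real (D' \<omega> - D \<omega>) + \<i> * of_real (lam * \<Delta> \<omega> * D \<omega>) + \<i> * of_real (lam * g \<omega> * ((\<Delta> \<omega>)\<^sup>2 - h)) - of_real (lam\<^sup>2 / 2 * ((\<Delta> \<omega>)\<^sup>2 - h) * D \<omega>)))
    \<le> ?K * (?\<rho> \<omega> ^ 3 * (1 + D \<omega>))"
      by (rule one_step_error[OF t(2,3) e(1,2) D0[OF \<omega>] g01[OF \<omega>] dr ps])
    have eq: "R \<omega> = V \<omega> * (iexp (lam * (\<Delta> \<omega> - C \<omega>)) * D' \<omega> - exp (- (lam\<^sup>2 * h / 2)) * D \<omega>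
    - (of_real (D' \<omega> - D \<omega>) + \<i> * of_real (lam * \<Delta> \<omega> * D \<omega>) + \<i> * of_real (lam * g \<omega> * ((\<Delta> \<omega>)\<^sup>2 - h)) - of_real (lam\<^sup>2 / 2 * ((\<Delta> \<omega>)\<^sup>2 - h) * D \<omega>)))"
      unfolding R_def Q_def F_def inn by (simp add: field_simps)
    have nv: "norm (V \<omega> * z) \<le> norm z" for z
      using V(2)[of \<omega>] by (simp add: norm_mult mult_left_le_one_le)
    show ?thesis unfolding eq by (rule order_trans[OF nv err])
  qed
  have rho_fut: "(\<lambda>\<omega>. ?\<rho> \<omega> ^ 3) \<in> borel_measurable (future t)"
    using oscillation_future[of t h] th t by measurable
  have D1_past: "(\<lambda>\<omega>. 1 + D \<omega>) \<in> borel_measurable (past t)" using D_past by measurable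
  have D1i: "integrable M (\<lambda>\<omega>. 1 + D \<omega>)" using Di by simp
  have rho_i: "integrable M (\<lambda>\<omega>. ?\<rho> \<omega> ^ 3)" "(\<integral>\<omega>. ?\<rho> \<omega> ^ 3 \<partial>M) \<le> 68 * sqrt h ^ 3"
    using th t by (auto intro!: oscillation_cube)
  \<comment> \<open>The cube of the oscillation belongs to the future and \<open>1 + D\<close> to
    the past, so the mean of the error bound factorises; the mean of \<open>1 + D\<close> is bounded
    uniformly in \<open>t\<close>.\<close>
  note ind = indep_integral[OF th(1,2) D1_past rho_fut D1i rho_i(1)]
  have iK: "integrable M (\<lambda>\<omega>. ?K * (?\<rho> \<omega> ^ 3 * (1 + D \<omega>)))"
    using integrable_mult_right[OF ind(2), of ?K] by (simp add: mult.commute)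
  have iR: "integrable M R" unfolding R_def[abs_def] by (rule Bochner_Integration.integrable_diff[OF i6 iQ])
  have "norm (\<integral>\<omega>. R \<omega> \<partial>M) \<le> (\<integral>\<omega>. norm (R \<omega>) \<partial>M)" by (rule integral_norm_bound)
  also have "\<dots> \<le> (\<integral>\<omega>. ?K * (?\<rho> \<omega> ^ 3 * (1 + D \<omega>)) \<partial>M)"
    by (rule integral_mono[OF integrable_norm[OF iR] iK bound])
  also have "(\<integral>\<omega>. ?K * (?\<rho> \<omega> ^ 3 * (1 + D \<omega>)) \<partial>M) = ?K * ((\<integral>\<omega>. 1 + D \<omega> \<partial>M) * (\<integral>\<omega>. ?\<rho> \<omega> ^ 3 \<partial>M))"
    unfolding ind(1)[symmetric] by (simp add: mult.commute)
  also have "\<dots> \<le> ?K * ((2 + (\<integral>\<omega>. max_drop (\<lambda>u. B u \<omega>) 0 1 \<partial>M)) * (68 * sqrt h ^ 3))"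
  proof (intro mult_left_mono mult_mono K0 rho_i)
    have "(\<integral>\<omega>. 1 + D \<omega> \<partial>M) = 1 + (\<integral>\<omega>. D \<omega> \<partial>M)" using Di by (simp add: prob_space)
    then show "(\<integral>\<omega>. 1 + D \<omega> \<partial>M) \<le> 2 + (\<integral>\<omega>. max_drop (\<lambda>u. B u \<omega>) 0 1 \<partial>M)" using D_E by linarith
    have "0 \<le> (\<integral>\<omega>. max_drop (\<lambda>u. B u \<omega>) 0 1 \<partial>M)"
      by (intro Bochner_Integration.integral_nonneg max_drop_nonneg B_continuous) auto
    then show "0 \<le> 2 + (\<integral>\<omega>. max_drop (\<lambda>u. B u \<omega>) 0 1 \<partial>M)" by simp
    show "0 \<le> (\<integral>\<omega>. ?\<rho> \<omega> ^ 3 \<partial>M)"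
      using th t by (intro Bochner_Integration.integral_nonneg zero_le_power oscillation_cube) auto
  qed
  finally show ?thesis
    unfolding ER mart1[symmetric] mart2[symmetric] F_def[symmetric] by (simp add: ac_simps F_def)
qed

end

section \<open>The law of the innovation under the change of measure\<close>

text \<open>Over \<open>n\<close> equal steps the bounds add up to a constant times
  \<open>n * (1 / n) powr (3/2)\<close>, which tends to 0.\<close>

lemma constant_of_increment_bound:
  fixes \<psi> :: "real \<Rightarrow> 'a::real_normed_vector"
  assumes ab: "a \<le> b"
    and inc: "\<And>t h. a \<le> t \<Longrightarrow> 0 < h \<Longrightarrow> t + h \<le> b \<Longrightarrow> norm (\<psi> (t + h) - \<psi> t) \<le> K * sqrt h ^ 3"
  shows "\<psi> b = \<psi> a"
proof (cases "a = b")
  case False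
  with ab have ab': "a < b" by simp
  have bound: "norm (\<psi> b - \<psi> a) \<le> real (Suc n) * (K * sqrt ((b - a) / real (Suc n)) ^ 3)" for n
  proof -
    define h where "h = (b - a) / real (Suc n)"
    have h: "0 < h" "a + real (Suc n) * h = b" using ab' by (auto simp: h_def simp del: of_nat_Suc)
    let ?g = "\<lambda>i. \<psi> (a + real i * h)"
    have "norm (\<psi> b - \<psi> a) = norm (\<Sum>i<Suc n. ?g (Suc i) - ?g i)"
    proof -
      have "(\<Sum>i<Suc n. ?g (Suc i) - ?g i) = ?g (Suc n) - ?g 0" by (rule sum_lessThan_telescope)
      then show ?thesis by (simp only: h(2)) simp
    qed
    also have "\<dots> \<le> (\<Sum>i<Suc n. norm (?g (Suc i) - ?g i))" by (rule norm_sum)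
    also have "\<dots> \<le> (\<Sum>i<Suc n. K * sqrt h ^ 3)"
    proof (intro sum_mono)
      fix i assume i: "i \<in> {..<Suc n}"
      then have "real (Suc i) * h \<le> real (Suc n) * h" using h by (intro mult_right_mono) auto
      then have "a + real i * h + h \<le> b" using h(2) by (simp add: algebra_simps)
      then have "norm (\<psi> (a + real i * h + h) - \<psi> (a + real i * h)) \<le> K * sqrt h ^ 3"
        using h by (intro inc) auto
      then show "norm (?g (Suc i) - ?g i) \<le> K * sqrt h ^ 3" by (simp add: algebra_simps)
    qed
    finally show ?thesis by (simp add: h_def)
  qed
  have "(\<lambda>n. real (Suc n) * (K * sqrt ((b - a) / real (Suc n)) ^ 3)) \<longlonglongrightarrow> 0"
  proof -
    have "real (Suc n) * (K * sqrt ((b - a) / real (Suc n)) ^ 3) = K * (b - a) * sqrt ((b - a) / real (Suc n))" for n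
    proof -
      have "sqrt ((b - a) / real (Suc n)) ^ 3 = (b - a) / real (Suc n) * sqrt ((b - a) / real (Suc n))"
        using ab' by (simp only: power3_eq_cube real_sqrt_mult_self) simp
      then show ?thesis by (simp del: of_nat_Suc)
    qed
    moreover have "(\<lambda>n. K * (b - a) * sqrt ((b - a) / real (Suc n))) \<longlonglongrightarrow> K * (b - a) * sqrt 0"
      by (intro tendsto_intros) real_asymp
    ultimately show ?thesis by (simp only: real_sqrt_zero mult_zero_right)
  qed
  then have "norm (\<psi> b - \<psi> a) \<le> 0"
    by (rule LIMSEQ_le_const) (use bound in auto)
  then show ?thesis by simp
qed simp

section \<open>Characteristic function and finite-dimensional laws of the innovation\<close>

context brownian_from_0
begin

abbreviation inn :: "real \<Rightarrow> 'a \<Rightarrow> real" where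
  "inn t \<omega> \<equiv> innovation (\<lambda>u. B u \<omega>) t"

abbreviation weight :: "'a \<Rightarrow> real" where
  "weight \<omega> \<equiv> above_min (\<lambda>u. B u \<omega>) 1"

lemma inn_measurable: "0 \<le> t \<Longrightarrow> t \<le> 1 \<Longrightarrow> inn t \<in> borel_measurable M"
  by (rule past_measurable[OF innovation_past])

lemma weight_nonneg: "\<omega> \<in> space M \<Longrightarrow> 0 \<le> weight \<omega>"
  by (intro path_above_min_nonneg path_cont) auto

lemma weight_integrable: "integrable M weight"
  by (rule above_min_integrable) auto

text \<open>The mean is that of the largest drop on [0,1], hence \<open>max_mean 1 0\<close>, which
  is at least 1/2.\<close>

lemma weight_expectation_pos: "0 < (\<integral>\<omega>. weight \<omega> \<partial>M)"
proof -
  have "(\<integral>\<omega>. weight \<omega> \<partial>M) = (\<integral>\<omega>. max_drop (\<lambda>u. B u \<omega>) 0 1 \<partial>M)"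
    by (rule above_min_integrable(3)) auto
  also have "\<dots> = (\<integral>\<omega>. max 0 (max_drop (\<lambda>u. B u \<omega>) 0 1) \<partial>M)"
    by (intro Bochner_Integration.integral_cong refl) (intro max_absorb2[symmetric] max_drop_nonneg B_continuous; simp)
  also have "\<dots> = max_mean (sqrt (1 - 0)) 0" by (rule expectation_max_max_drop) auto
  also have "\<dots> > 0" using max_mean_ge[of 1 0] by simp
  finally show ?thesis .
qed

text \<open>Multiplied by \<open>exp (lam\<^sup>2 * (t - s) / 2)\<close>, the left-hand side has
  increments of order \<open>h powr (3/2)\<close> and is therefore constant in \<open>t\<close>; at
  \<open>t = s\<close> it is the weighted mass of \<open>A\<close>.\<close>

lemma innovation_char:
  fixes lam :: real
  assumes s: "0 \<le> s" "s \<le> t" "t \<le> 1" and A: "A \<in> sets (past s)"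
  shows "(\<integral>\<omega>. indicator A \<omega> * iexp (lam * (inn t \<omega> - inn s \<omega>)) * of_real (weight \<omega>) \<partial>M) =
    complex_of_real (exp (- (lam\<^sup>2 * (t - s) / 2))) * (\<integral>\<omega>. indicator A \<omega> * complex_of_real (weight \<omega>) \<partial>M)"
proof (cases "s = 1")
  case True
  then show ?thesis using s by simp
next
  case False
  with s have s1: "s < 1" by simp
  \<comment> \<open>The exponential accumulated up to time \<open>t\<close> is known at time
    \<open>t\<close>, so together with the indicator it is an admissible past factor for the next
    step.\<close>
  define V where "V t \<omega> = indicator A \<omega> * iexp (lam * (inn t \<omega> - inn s \<omega>))" for t \<omega>
  define \<Phi> where "\<Phi> t = (\<integral>\<omega>. V t \<omega> * of_real (weight \<omega>) \<partial>M)" for t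
  define \<psi> where "\<psi> t = complex_of_real (exp (lam\<^sup>2 * (t - s) / 2)) * \<Phi> t" for t
  have V_past: "V t \<in> borel_measurable (past t)" if t: "s \<le> t" "t \<le> 1" for t
  proof -
    have [measurable]: "inn t \<in> borel_measurable (past t)"
      by (rule innovation_past) (use s t in auto)
    have [measurable]: "inn s \<in> borel_measurable (past t)"
      by (rule past_mono[OF innovation_past]) (use s t in auto)
    have "(indicator A :: 'a \<Rightarrow> complex) \<in> borel_measurable (past s)" using A by simp
    then have [measurable]: "(indicator A :: 'a \<Rightarrow> complex) \<in> borel_measurable (past t)"
      by (rule past_mono[OF _ t(1)])
    show ?thesis unfolding V_def[abs_def] by measurable
  qed
  have V1: "norm (V t \<omega>) \<le> 1" for t \<omega> by (simp add: V_def norm_mult indicator_def)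
  have const: "\<psi> b = \<psi> s" if b: "s \<le> b" "b < 1" for b
  proof (rule constant_of_increment_bound[OF b(1)])
    \<comment> \<open>The constant of a step deteriorates as time 1 approaches; fixing
      \<open>b < 1\<close> makes it uniform over all steps inside \<open>{s..b}\<close>.\<close>
    define e where "e = sqrt (1 - b)"
    let ?c = "step_const e \<bar>lam\<bar> * (68 * (2 + (\<integral>\<omega>. max_drop (\<lambda>u. B u \<omega>) 0 1 \<partial>M)))"
    fix t h :: real assume t: "s \<le> t" "0 < h" "t + h \<le> b"
    have e: "0 < e" "e \<le> 1" "e \<le> sqrt (1 - (t + h))" using b s t by (auto simp: e_def)
    have VV: "V t \<omega> * iexp (lam * (inn (t + h) \<omega> - inn t \<omega>)) = V (t + h) \<omega>" for \<omega>
      unfolding V_def by (simp add: exp_add[symmetric] algebra_simps)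
    have step: "norm (\<Phi> (t + h) - complex_of_real (exp (- (lam\<^sup>2 * h / 2))) * \<Phi> t) \<le> ?c * sqrt h ^ 3"
      using innovation_step[OF _ t(2) _ _ e V_past V1, of lam] s t b
      unfolding VV \<Phi>_def by (simp add: mult.commute mult.left_commute)
    have "\<psi> (t + h) - \<psi> t = complex_of_real (exp (lam\<^sup>2 * (t + h - s) / 2)) * (\<Phi> (t + h) - complex_of_real (exp (- (lam\<^sup>2 * h / 2))) * \<Phi> t)"
    proof -
      have "lam\<^sup>2 * (t - s) / 2 = lam\<^sup>2 * (t + h - s) / 2 + - (lam\<^sup>2 * h / 2)" by (simp add: field_simps)
      then have ee: "exp (lam\<^sup>2 * (t - s) / 2) = exp (lam\<^sup>2 * (t + h - s) / 2) * exp (- (lam\<^sup>2 * h / 2))"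
        by (simp only: exp_add)
      show ?thesis unfolding \<psi>_def ee by (simp only: of_real_mult right_diff_distrib mult.assoc)
    qed
    then have "norm (\<psi> (t + h) - \<psi> t) = exp (lam\<^sup>2 * (t + h - s) / 2) * norm (\<Phi> (t + h) - complex_of_real (exp (- (lam\<^sup>2 * h / 2))) * \<Phi> t)"
      by (simp only: norm_mult norm_of_real) simp
    also have "\<dots> \<le> exp (lam\<^sup>2 / 2) * (?c * sqrt h ^ 3)"
    proof (intro mult_mono step)
      have "lam\<^sup>2 * (t + h - s) \<le> lam\<^sup>2 * 1" using s t b by (intro mult_left_mono) auto
      then show "exp (lam\<^sup>2 * (t + h - s) / 2) \<le> exp (lam\<^sup>2 / 2)" by simp
    qed auto
    finally show "norm (\<psi> (t + h) - \<psi> t) \<le> (exp (lam\<^sup>2 / 2) * ?c) * sqrt h ^ 3"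
      by (simp only: mult.assoc)
  qed
  have \<psi>s: "\<psi> s = (\<integral>\<omega>. indicator A \<omega> * complex_of_real (weight \<omega>) \<partial>M)"
    by (simp add: \<psi>_def \<Phi>_def V_def)
  have "\<psi> t = \<psi> s"
  proof (cases "t < 1")
    case True then show ?thesis by (rule const[OF s(2)])
  next
    case False
    then have t1: "t = 1" using s by linarith
    \<comment> \<open>Times in \<open>{s..<1}\<close> tending to 1. Constancy is known along them,
      and continuity of the innovation together with domination by the weight carries it to the
      limit.\<close>
    define b where "b n = 1 - (1 - s) / real (Suc n)" for n
    have b: "s \<le> b n" "b n < 1" for n
    proof -
      have "(1 - s) / real (Suc n) \<le> (1 - s) / 1" using s1 by (intro divide_left_mono) auto
      then show "s \<le> b n" by (simp add: b_def)
      show "b n < 1" using s1 by (simp add: b_def)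
    qed
    have blim: "b \<longlonglongrightarrow> 1" unfolding b_def[abs_def] by real_asymp
    have "(\<lambda>n. \<Phi> (b n)) \<longlonglongrightarrow> \<Phi> 1"
      unfolding \<Phi>_def
    proof (rule integral_dominated_convergence[OF _ _ weight_integrable])
      have weight: "weight \<in> borel_measurable M" using weight_integrable by simp
      have VM: "(\<lambda>\<omega>. V r \<omega> * of_real (weight \<omega>)) \<in> borel_measurable M" if "s \<le> r" "r \<le> 1" for r
        by (intro borel_measurable_times past_measurable[OF V_past[OF that] that(2)] measurable_compose[OF weight complex_of_real_measurable])
      show "(\<lambda>\<omega>. V 1 \<omega> * of_real (weight \<omega>)) \<in> borel_measurable M"
        using s1 by (intro VM) auto
      show "(\<lambda>\<omega>. V (b n) \<omega> * of_real (weight \<omega>)) \<in> borel_measurable M" for n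
        using b[of n] by (intro VM) auto
      show "AE \<omega> in M. norm (V (b n) \<omega> * of_real (weight \<omega>)) \<le> weight \<omega>" for n
      proof (rule AE_I2)
        fix \<omega> assume "\<omega> \<in> space M"
        then show "norm (V (b n) \<omega> * of_real (weight \<omega>)) \<le> weight \<omega>"
          using mult_right_mono[OF V1[of "b n" \<omega>], of "weight \<omega>"] weight_nonneg[of \<omega>] by (simp add: norm_mult)
      qed
      show "AE \<omega> in M. (\<lambda>n. V (b n) \<omega> * of_real (weight \<omega>)) \<longlonglongrightarrow> V 1 \<omega> * of_real (weight \<omega>)"
      proof (rule AE_I2)
        fix \<omega> assume "\<omega> \<in> space M"
        note cont = innovation_continuous[OF path_cont[OF this]]
        have "b n \<in> {0..1}" for n using b[of n] s by auto
        then have "(\<lambda>n. inn (b n) \<omega>) \<longlonglongrightarrow> inn 1 \<omega>"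
          by (intro continuous_on_tendsto_compose[OF cont blim]) auto
        then show "(\<lambda>n. V (b n) \<omega> * of_real (weight \<omega>)) \<longlonglongrightarrow> V 1 \<omega> * of_real (weight \<omega>)"
          unfolding V_def by (intro tendsto_intros)
      qed
    qed
    then have "(\<lambda>n. \<psi> (b n)) \<longlonglongrightarrow> \<psi> 1"
      unfolding \<psi>_def by (intro tendsto_intros blim) auto
    moreover have "\<psi> (b n) = \<psi> s" for n by (rule const[OF b])
    ultimately show ?thesis using t1 by (simp add: LIMSEQ_const_iff)
  qed
  then have "complex_of_real (exp (lam\<^sup>2 * (t - s) / 2)) * \<Phi> t = (\<integral>\<omega>. indicator A \<omega> * complex_of_real (weight \<omega>) \<partial>M)"
    unfolding \<psi>s by (simp add: \<psi>_def)
  then have "complex_of_real (exp (- (lam\<^sup>2 * (t - s) / 2))) * (complex_of_real (exp (lam\<^sup>2 * (t - s) / 2)) * \<Phi> t) =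
      complex_of_real (exp (- (lam\<^sup>2 * (t - s) / 2))) * (\<integral>\<omega>. indicator A \<omega> * complex_of_real (weight \<omega>) \<partial>M)" by simp
  then show ?thesis
    unfolding mult.assoc[symmetric] of_real_mult[symmetric] exp_add[symmetric] by (simp add: \<Phi>_def V_def)
qed

text \<open>Restricting the weight to \<open>A\<close> and normalising gives a probability measure
  under which the increment has a Gaussian characteristic function, the same for every
  \<open>A\<close>. One identity thus contains both the law of the increment and its independence of
  the past.\<close>

lemma innovation_law:
  assumes s: "0 \<le> s" "s < t" "t \<le> 1" and A: "A \<in> sets (past s)" and E: "E \<in> sets borel"
  shows "(\<integral>\<omega>. indicator A \<omega> * indicator E (inn t \<omega> - inn s \<omega>) * weight \<omega> \<partial>M) =
    (\<integral>\<omega>. indicator A \<omega> * weight \<omega> \<partial>M) * measure (centred_normal (t - s)) E"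
proof -
  let ?X = "\<lambda>\<omega>. inn t \<omega> - inn s \<omega>"
  define q where "q = (\<integral>\<omega>. indicator A \<omega> * weight \<omega> \<partial>M)"
  have [measurable]: "?X \<in> borel_measurable M"
    using s by (intro borel_measurable_diff inn_measurable) auto
  have [measurable]: "weight \<in> borel_measurable M" using weight_integrable by simp
  have AM [measurable]: "A \<in> sets M"
  proof -
    have "(indicator A :: 'a \<Rightarrow> real) \<in> borel_measurable (past s)" using A by simp
    then have "(indicator A :: 'a \<Rightarrow> real) \<in> borel_measurable M" by (rule past_measurable) (use s in auto)
    moreover have "A \<subseteq> space M" using sets.sets_into_space[OF A] by simp
    ultimately show ?thesis by (simp add: borel_measurable_indicator_iff Int_absorb2)
  qed
  have Ai: "integrable M (\<lambda>\<omega>. indicator A \<omega> * weight \<omega>)"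
    using integrable_mult_indicator[OF AM weight_integrable] by simp
  have AEi: "integrable M (\<lambda>\<omega>. indicator A \<omega> * indicator E (?X \<omega>) * weight \<omega>)"
  proof (rule Bochner_Integration.integrable_bound[OF Ai])
    show "(\<lambda>\<omega>. indicator A \<omega> * indicator E (?X \<omega>) * weight \<omega>) \<in> borel_measurable M"
      using E by measurable
  qed (auto simp: indicator_def)
  have q0: "0 \<le> q" unfolding q_def by (intro Bochner_Integration.integral_nonneg mult_nonneg_nonneg weight_nonneg) auto
  show ?thesis
  \<comment> \<open>Without weighted mass on \<open>A\<close> there is nothing to normalise, and
    both sides are 0.\<close>
  proof (cases "q = 0")
    case True
    have "(\<integral>\<omega>. indicator A \<omega> * indicator E (?X \<omega>) * weight \<omega> \<partial>M) \<le> q"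
      unfolding q_def using weight_nonneg by (intro integral_mono AEi Ai) (auto simp: indicator_def)
    moreover have "0 \<le> (\<integral>\<omega>. indicator A \<omega> * indicator E (?X \<omega>) * weight \<omega> \<partial>M)"
      by (intro Bochner_Integration.integral_nonneg mult_nonneg_nonneg weight_nonneg) auto
    ultimately show ?thesis using True by (simp add: q_def)
  next
    case False
    with q0 have q: "0 < q" by simp
    let ?w = "\<lambda>\<omega>. indicator A \<omega> * weight \<omega> / q"
    have w0: "AE \<omega> in M. 0 \<le> ?w \<omega>"
      using weight_nonneg q by (intro AE_I2 divide_nonneg_pos mult_nonneg_nonneg) auto
    have wi: "integrable M ?w" using Ai by simp
    have [measurable]: "?w \<in> borel_measurable M" by measurable
    define Q where "Q = density M (\<lambda>\<omega>. ennreal (?w \<omega>))"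
    interpret Q: prob_space Q
    proof
      have "emeasure Q (space Q) = (\<integral>\<^sup>+\<omega>. ennreal (?w \<omega>) \<partial>M)"
        unfolding Q_def by (subst emeasure_density) (auto intro!: nn_integral_cong)
      also have "\<dots> = ennreal (\<integral>\<omega>. ?w \<omega> \<partial>M)" by (rule nn_integral_eq_integral[OF wi w0])
      also have "(\<integral>\<omega>. ?w \<omega> \<partial>M) = 1" using q by (simp add: q_def)
      finally show "emeasure Q (space Q) = 1" by simp
    qed
    have Qint: "(\<integral>\<omega>. f \<omega> \<partial>Q) = (\<integral>\<omega>. ?w \<omega> *\<^sub>R f \<omega> \<partial>M)" if "f \<in> borel_measurable M" for f :: "'a \<Rightarrow> 'c::{banach, second_countable_topology}"
      unfolding Q_def using that w0 by (intro integral_density) auto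
    have v: "0 < sqrt (t - s)" using s by simp
    \<comment> \<open>The increment is standardised, because uniqueness is applied with the
      characteristic function of the standard normal law.\<close>
    let ?Y = "\<lambda>\<omega>. (?X \<omega> - 0) / sqrt (t - s)"
    have XQ: "?X \<in> borel_measurable Q" by (simp add: Q_def)
    have YQ [measurable]: "?Y \<in> borel_measurable Q" using XQ by measurable
    have distr: "distr Q borel ?Y = std_normal_distribution"
    proof (rule Levy_uniqueness)
      show "real_distribution (distr Q borel ?Y)" by (rule Q.real_distribution_distr[OF YQ])
      show "real_distribution std_normal_distribution" by (rule real_dist_normal_dist)
      show "char (distr Q borel ?Y) = char std_normal_distribution"
      proof
        fix l :: real
        let ?lam = "l / sqrt (t - s)"
        have im: "(\<lambda>\<omega>. iexp (?lam * ?X \<omega>)) \<in> borel_measurable M" by measurable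
        have "char (distr Q borel ?Y) l = (\<integral>\<omega>. iexp (?lam * ?X \<omega>) \<partial>Q)"
          unfolding char_def by (subst integral_distr[OF YQ]) (auto simp: field_simps)
        also have "\<dots> = (\<integral>\<omega>. (indicator A \<omega> * iexp (?lam * ?X \<omega>) * of_real (weight \<omega>)) / q \<partial>M)"
          unfolding Qint[OF im]
          by (intro Bochner_Integration.integral_cong refl) (simp add: scaleR_conv_of_real indicator_def)
        also have "\<dots> = (\<integral>\<omega>. indicator A \<omega> * iexp (?lam * ?X \<omega>) * of_real (weight \<omega>) \<partial>M) / q"
          by (rule integral_divide_zero)
        also have "\<dots> = complex_of_real (exp (- (?lam\<^sup>2 * (t - s) / 2))) * (\<integral>\<omega>. indicator A \<omega> * complex_of_real (weight \<omega>) \<partial>M) / q"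
          using s by (subst innovation_char[OF s(1) _ s(3) A]) auto
        also have "(\<integral>\<omega>. indicator A \<omega> * complex_of_real (weight \<omega>) \<partial>M) = complex_of_real q"
          unfolding q_def integral_complex_of_real[symmetric]
          by (intro Bochner_Integration.integral_cong refl) (simp add: indicator_def)
        also have "?lam\<^sup>2 * (t - s) / 2 = l\<^sup>2 / 2" using s by (simp add: power_divide)
        finally show "char (distr Q borel ?Y) l = char std_normal_distribution l"
          using q by (simp add: char_std_normal_distribution)
      qed
    qed
    have "distributed Q lborel ?Y std_normal_density"
      unfolding distributed_def
    proof (intro conjI)
      have "distr Q lborel ?Y = distr Q borel ?Y" by (rule distr_cong) auto
      then show "distr Q lborel ?Y = std_normal_distribution" using distr by simp
    qed (use YQ in auto)
    then have D: "distributed Q lborel ?X (normal_density 0 (sqrt (t - s)))"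
      by (subst Q.normal_standard_normal_convert[OF v])
    have "(\<integral>\<omega>. indicator A \<omega> * indicator E (?X \<omega>) * weight \<omega> \<partial>M) = q * (\<integral>\<omega>. ?w \<omega> *\<^sub>R indicator E (?X \<omega>) \<partial>M)"
      using q by (subst integral_mult_right_zero[symmetric]) (simp add: ac_simps)
    also have "(\<integral>\<omega>. ?w \<omega> *\<^sub>R indicator E (?X \<omega>) \<partial>M) = (\<integral>\<omega>. indicator E (?X \<omega>) \<partial>Q :: real)"
      by (intro Qint[symmetric] measurable_compose[OF _ borel_measurable_indicator[OF E]]) measurable
    also have "\<dots> = (\<integral>x. indicator E x \<partial>distr Q lborel ?X)"
      using XQ E by (subst integral_distr) auto
    also have "\<dots> = measure (centred_normal (t - s)) E"
      using s E by (simp add: distributed_distr_eq_density[OF D] centred_normal_def)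
    finally show ?thesis by (simp add: q_def)
  qed
qed

text \<open>Induction on the number of increments: the condition on the earlier ones is an event in
  the past of the last interval, where \<open>innovation_law\<close> splits off one factor.\<close>

lemma innovation_product:
  assumes \<tau>: "\<And>i. i \<le> n \<Longrightarrow> \<tau> i \<in> {0..1}" "\<And>i. i < n \<Longrightarrow> \<tau> i \<le> \<tau> (Suc i)"
    and E: "\<And>i. i < n \<Longrightarrow> E i \<in> sets borel"
  shows "(\<integral>\<omega>. indicator {\<omega> \<in> space M. \<forall>i\<in>{..<n}. inn (\<tau> (Suc i)) \<omega> - inn (\<tau> i) \<omega> \<in> E i} \<omega> * weight \<omega> \<partial>M) =
    (\<integral>\<omega>. weight \<omega> \<partial>M) * (\<Prod>i<n. measure (centred_normal (\<tau> (Suc i) - \<tau> i)) (E i))"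
  using assms
proof (induction n)
  case 0
  have "(\<integral>\<omega>. indicator {\<omega> \<in> space M. \<forall>i\<in>{..<0::nat}. inn (\<tau> (Suc i)) \<omega> - inn (\<tau> i) \<omega> \<in> E i} \<omega> * weight \<omega> \<partial>M) = (\<integral>\<omega>. weight \<omega> \<partial>M)"
    by (intro Bochner_Integration.integral_cong) auto
  then show ?case by simp
next
  case (Suc n)
  let ?A = "{\<omega> \<in> space M. \<forall>i\<in>{..<n}. inn (\<tau> (Suc i)) \<omega> - inn (\<tau> i) \<omega> \<in> E i}"
  let ?A' = "{\<omega> \<in> space M. \<forall>i\<in>{..<Suc n}. inn (\<tau> (Suc i)) \<omega> - inn (\<tau> i) \<omega> \<in> E i}"
  let ?X = "\<lambda>\<omega>. inn (\<tau> (Suc n)) \<omega> - inn (\<tau> n) \<omega>"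
  have IH: "(\<integral>\<omega>. indicator ?A \<omega> * weight \<omega> \<partial>M) = (\<integral>\<omega>. weight \<omega> \<partial>M) * (\<Prod>i<n. measure (centred_normal (\<tau> (Suc i) - \<tau> i)) (E i))"
    using Suc.prems by (intro Suc.IH) auto
  have \<tau>n: "0 \<le> \<tau> n" "\<tau> n \<le> \<tau> (Suc n)" "\<tau> (Suc n) \<le> 1"
    using Suc.prems(1)[of n] Suc.prems(1)[of "Suc n"] Suc.prems(2)[of n] by auto
  have mono: "\<tau> i \<le> \<tau> n" if "i \<le> n" for i
    using that
  proof (induction rule: inc_induct)
    case (step j)
    then show ?case using Suc.prems(2)[of j] by simp
  qed simp
  have A: "?A \<in> sets (past (\<tau> n))"
  proof -
    have "{\<omega> \<in> space (past (\<tau> n)). \<forall>i\<in>{..<n}. inn (\<tau> (Suc i)) \<omega> - inn (\<tau> i) \<omega> \<in> E i} \<in> sets (past (\<tau> n))"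
    proof (intro sets.sets_Collect_finite_All)
      fix i assume i: "i \<in> {..<n}"
      have "inn (\<tau> j) \<in> borel_measurable (past (\<tau> n))" if "j \<le> n" for j
      proof (rule past_mono[OF innovation_past mono[OF that]])
        show "0 \<le> \<tau> j" "\<tau> j \<le> 1" using Suc.prems(1)[of j] that by auto
      qed
      then have "(\<lambda>\<omega>. inn (\<tau> (Suc i)) \<omega> - inn (\<tau> i) \<omega>) \<in> borel_measurable (past (\<tau> n))"
        using i by (intro borel_measurable_diff) auto
      then show "{\<omega> \<in> space (past (\<tau> n)). inn (\<tau> (Suc i)) \<omega> - inn (\<tau> i) \<omega> \<in> E i} \<in> sets (past (\<tau> n))"
        using i Suc.prems(3)[of i] by (intro sets_Collect_mem[where T=borel]) auto
    qed simp
    then show ?thesis by simp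
  qed
  have "(\<integral>\<omega>. indicator ?A' \<omega> * weight \<omega> \<partial>M) = (\<integral>\<omega>. indicator ?A \<omega> * indicator (E n) (?X \<omega>) * weight \<omega> \<partial>M)"
    by (intro Bochner_Integration.integral_cong refl) (auto simp: indicator_def lessThan_Suc)
  also have "\<dots> = (\<integral>\<omega>. indicator ?A \<omega> * weight \<omega> \<partial>M) * measure (centred_normal (\<tau> (Suc n) - \<tau> n)) (E n)"
  proof (cases "\<tau> n = \<tau> (Suc n)")
    case False
    then show ?thesis using \<tau>n Suc.prems(3)[of n] by (intro innovation_law A) auto
  next
    \<comment> \<open>Repeated times are allowed: then the increment is 0, and
      \<open>centred_normal 0\<close> is the Dirac mass at 0.\<close>
    case True
    then show ?thesis using Suc.prems(3)[of n] by (auto simp: centred_normal_def measure_return indicator_def)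
  qed
  finally show ?case unfolding IH by (simp add: ac_simps)
qed

end

section \<open>Transfer to the process\<close>

lemma mspace_C01_iff: "p \<in> mspace C01 \<longleftrightarrow> p \<in> extensional {0..1} \<and> continuous_on {0..1} p"
proof -
  have "compactin (top_of_set {0..1}) (topspace (top_of_set {0..1::real}))"
    by (simp add: compactin_subtopology)
  from compactin_mspace_cfunspace[OF this, of euclidean_metric]
  show ?thesis by (auto simp: C01_def)
qed

lemma dist_C01_le:
  assumes "f \<in> mspace C01" "g \<in> mspace C01" "u \<in> {0..1}"
  shows "dist (f u) (g u) \<le> mdist C01 f g"
  using mdist_cfunspace_imp_mdist_le[of f "top_of_set {0..1}" euclidean_metric g "mdist C01 f g" u] assms
  by (simp add: C01_def)

lemma space_C01_borel [simp]: "space C01_borel = mspace C01"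
  by (simp add: C01_borel_def space_measure_of_conv)

text \<open>Evaluation is continuous for the supremum metric: if \<open>a < p u\<close>, the ball
  around \<open>p\<close> of radius \<open>p u - a\<close> stays inside the set.\<close>

lemma eval_C01_measurable:
  assumes u: "u \<in> {0..1}" shows "(\<lambda>p. p u) \<in> borel_measurable C01_borel"
proof (rule borel_measurable_iff_greater[THEN iffD2], rule allI)
  fix a
  interpret Metric_space "mspace C01" "mdist C01" by simp
  have "openin (mtopology_of C01) {p \<in> mspace C01. a < p u}"
    unfolding mtopology_of_def openin_mtopology
  proof (intro conjI allI impI)
    fix p assume p: "p \<in> {p \<in> mspace C01. a < p u}"
    have "mball p (p u - a) \<subseteq> {p \<in> mspace C01. a < p u}"
    proof
      fix r assume "r \<in> mball p (p u - a)"
      then have r: "r \<in> mspace C01" "mdist C01 p r < p u - a" by auto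
      have "dist (p u) (r u) < p u - a" using dist_C01_le[of p r u] p r u by simp
      then show "r \<in> {p \<in> mspace C01. a < p u}" using r by (auto simp: dist_real_def)
    qed
    then show "\<exists>r>0. mball p r \<subseteq> {p \<in> mspace C01. a < p u}" using p by (intro exI[of _ "p u - a"]) auto
  qed auto
  moreover have "{U. openin (mtopology_of C01) U} \<subseteq> Pow (mspace C01)"
    using openin_subset[of "mtopology_of C01"] by auto
  ultimately have "{p \<in> mspace C01. a < p u} \<in> sets C01_borel"
    unfolding C01_borel_def by (subst sets_measure_of) auto
  then show "{p \<in> space C01_borel. a < p u} \<in> sets C01_borel" by simp
qed

lemma above_min_cong:
  assumes "\<And>u. u \<in> {0..t} \<Longrightarrow> f u = g u + c" "0 \<le> t" shows "above_min f t = above_min g t"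
proof -
  have "max_drop f 0 t = max_drop (\<lambda>u. g u + c) 0 t" using assms by (intro max_drop_cong) auto
  then show ?thesis using assms by (simp add: above_min_def max_drop_def)
qed

text \<open>Used with \<open>c = 0\<close> for the restriction of a path to \<open>{0..1}\<close>,
  and with \<open>c = B 0 \<omega>\<close> for a Brownian motion that starts at 0 only almost
  surely.\<close>

lemma innovation_cong:
  assumes "\<And>u. u \<in> {0..t} \<Longrightarrow> f u = g u + c" "0 \<le> t" shows "innovation f t = innovation g t"
proof -
  have "drift_integral f 0 t = drift_integral g 0 t"
    unfolding drift_integral_def
  proof (rule set_lebesgue_integral_cong)
    show "\<forall>s. s \<in> {0..t} \<longrightarrow> drift s (above_min f s) = drift s (above_min g s)"
      using assms by (auto intro!: arg_cong2[where f=drift] above_min_cong)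
  qed simp
  then show ?thesis using assms by (simp add: innovation_def)
qed

definition increment_set :: "nat \<Rightarrow> (nat \<Rightarrow> real) \<Rightarrow> (nat \<Rightarrow> real set) \<Rightarrow> (real \<Rightarrow> real) set" where
  "increment_set n \<tau> E = {p \<in> mspace C01. \<forall>i\<in>{..<n}. innovation p (\<tau> (Suc i)) - innovation p (\<tau> i) \<in> E i}"

lemma increment_set_measurable:
  assumes \<tau>: "\<And>i. i \<le> n \<Longrightarrow> \<tau> i \<in> {0..1}" and E: "\<And>i. i < n \<Longrightarrow> E i \<in> sets borel"
  shows "increment_set n \<tau> E \<in> sets C01_borel"
proof -
  have inn: "(\<lambda>p. innovation (\<lambda>u. p u) t) \<in> borel_measurable C01_borel" if "t \<in> {0..1}" for t
    using that by (intro innovation_measurable[where T=1] eval_C01_measurable) (auto simp: mspace_C01_iff)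
  have "{p \<in> space C01_borel. \<forall>i\<in>{..<n}. innovation p (\<tau> (Suc i)) - innovation p (\<tau> i) \<in> E i} \<in> sets C01_borel"
  proof (intro sets.sets_Collect_finite_All)
    fix i assume "i \<in> {..<n}"
    then show "{p \<in> space C01_borel. innovation p (\<tau> (Suc i)) - innovation p (\<tau> i) \<in> E i} \<in> sets C01_borel"
      using inn[OF \<tau>[of i]] inn[OF \<tau>[of "Suc i"]] E[of i]
      by (intro sets_Collect_mem[where T=borel] borel_measurable_diff) auto
  qed simp
  then show ?thesis by (simp add: increment_set_def)
qed

lemma path01_increment_set_iff:
  assumes X: "continuous_process M X" and \<omega>: "\<omega> \<in> space M" and \<tau>: "\<And>i. i \<le> n \<Longrightarrow> \<tau> i \<in> {0..1}"
  shows "path01 X \<omega> \<in> increment_set n \<tau> E \<longleftrightarrow>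
    (\<forall>i\<in>{..<n}. innovation (\<lambda>u. X u \<omega>) (\<tau> (Suc i)) - innovation (\<lambda>u. X u \<omega>) (\<tau> i) \<in> E i)"
proof -
  have "continuous_on {0..1} (\<lambda>u. X u \<omega>)" using X \<omega> by (simp add: continuous_process_def)
  then have "path01 X \<omega> \<in> mspace C01"
    unfolding mspace_C01_iff path01_def by (auto intro: continuous_on_eq)
  moreover have "innovation (path01 X \<omega>) t = innovation (\<lambda>u. X u \<omega>) t" if "t \<in> {0..1}" for t
    using that by (intro innovation_cong[where c=0]) (auto simp: path01_def)
  ultimately show ?thesis using \<tau> by (auto simp: increment_set_def)
qed

lemma brownian_from_0_shift:
  assumes B: "brownian_motion M B"
  shows "brownian_from_0 M (\<lambda>t \<omega>. B t \<omega> - B 0 \<omega>)"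
proof -
  interpret prob_space M using B by (simp add: brownian_motion_def)
  have B0: "B 0 \<in> borel_measurable M" and Bt: "\<And>t. t \<in> {0..1} \<Longrightarrow> B t \<in> borel_measurable M"
    using B by (auto simp: brownian_motion_def continuous_process_def)
  show ?thesis
  proof
    show "brownian_motion M (\<lambda>t \<omega>. B t \<omega> - B 0 \<omega>)"
      using B B0 Bt by (auto simp: brownian_motion_def continuous_process_def intro!: continuous_intros)
  qed simp
qed

text \<open>The law of \<open>X\<close> is evaluated on the Borel set of paths whose innovation
  increments lie in the given sets. Its indicator at the path of \<open>B\<close> is the
  corresponding event for the innovation of \<open>B\<close>, to which the product formula under the
  weight applies.\<close>

lemma innovation_events:
  fixes M :: "'a measure" and N :: "'b measure"
  assumes B: "brownian_motion M B" and X: "continuous_process N X"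
    and law: "\<And>A. A \<in> sets C01_borel \<Longrightarrow>
      measure N {\<omega> \<in> space N. path01 X \<omega> \<in> A} =
        (LINT \<omega>|M. indicator A (path01 B \<omega>) *
           ((B 1 \<omega> - running_min B 1 \<omega>) / (LINT \<omega>'|M. - running_min B 1 \<omega>')))"
    and \<tau>: "\<And>i. i \<le> n \<Longrightarrow> \<tau> i \<in> {0..1}" "\<And>i. i < n \<Longrightarrow> \<tau> i \<le> \<tau> (Suc i)"
    and E: "\<And>i. i < n \<Longrightarrow> E i \<in> sets borel"
  shows "measure N {\<omega> \<in> space N. \<forall>i\<in>{..<n}. innovation (\<lambda>u. X u \<omega>) (\<tau> (Suc i)) - innovation (\<lambda>u. X u \<omega>) (\<tau> i) \<in> E i} =
    (\<Prod>i<n. measure (centred_normal (\<tau> (Suc i) - \<tau> i)) (E i))"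
proof -
  let ?B = "\<lambda>t \<omega>. B t \<omega> - B 0 \<omega>"
  interpret brownian_from_0 M ?B by (rule brownian_from_0_shift[OF B])
  have BX: "continuous_process M B" using B by (simp add: brownian_motion_def)
  then have cont: "continuous_on {0..1} (\<lambda>u. B u \<omega>)" if "\<omega> \<in> space M" for \<omega>
    using that by (simp add: continuous_process_def)
  have w: "B 1 \<omega> - running_min B 1 \<omega> = above_min (\<lambda>u. ?B u \<omega>) 1" if "\<omega> \<in> space M" for \<omega>
  proof -
    have "B 1 \<omega> - running_min B 1 \<omega> = above_min (\<lambda>u. B u \<omega>) 1"
      unfolding running_min_def using cont[OF that] by (intro above_min_eq) auto
    also have "\<dots> = above_min (\<lambda>u. ?B u \<omega>) 1" by (rule above_min_cong[where c="B 0 \<omega>"]) auto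
    finally show ?thesis .
  qed
  define m where "m = (\<integral>\<omega>. above_min (\<lambda>u. ?B u \<omega>) 1 \<partial>M)"
  have m: "0 < m" unfolding m_def by (rule weight_expectation_pos)
  \<comment> \<open>Where \<open>B 0 = 0\<close>, hence almost surely, the negative of the minimum
    is the largest drop, and its mean is that of the weight. So the given normaliser is the total
    weighted mass.\<close>
  have "(LINT \<omega>|M. - running_min B 1 \<omega>) = (LINT \<omega>|M. max_drop (\<lambda>u. ?B u \<omega>) 0 1)"
  proof (rule integral_cong_AE)
    have eq: "- running_min B 1 \<omega> = max_drop (\<lambda>u. ?B u \<omega>) 0 1 - B 0 \<omega>" if "\<omega> \<in> space M" for \<omega>
      using w[OF that] by (simp add: above_min_def)
    have [measurable]: "B 0 \<in> borel_measurable M" using BX by (auto simp: continuous_process_def)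
    have [measurable]: "(\<lambda>\<omega>. max_drop (\<lambda>u. ?B u \<omega>) 0 1) \<in> borel_measurable M" by (rule max_drop_measurable) auto
    have "(\<lambda>\<omega>. max_drop (\<lambda>u. ?B u \<omega>) 0 1 - B 0 \<omega>) \<in> borel_measurable M" by measurable
    then show "(\<lambda>\<omega>. - running_min B 1 \<omega>) \<in> borel_measurable M" by (subst measurable_cong[OF eq])
    show "(\<lambda>\<omega>. max_drop (\<lambda>u. ?B u \<omega>) 0 1) \<in> borel_measurable M" by measurable
    have "AE \<omega> in M. B 0 \<omega> = 0" using B by (simp add: brownian_motion_def)
    with AE_space show "AE \<omega> in M. - running_min B 1 \<omega> = max_drop (\<lambda>u. ?B u \<omega>) 0 1"
      by eventually_elim (use eq in simp)
  qed
  then have den: "(LINT \<omega>|M. - running_min B 1 \<omega>) = m"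
    unfolding m_def using above_min_integrable(3)[of 1] by simp
  have inn: "innovation (\<lambda>u. B u \<omega>) t = innovation (\<lambda>u. ?B u \<omega>) t" if "t \<in> {0..1}" for t \<omega>
    using that by (intro innovation_cong[where c="B 0 \<omega>"]) auto
  let ?S = "{\<omega> \<in> space M. \<forall>i\<in>{..<n}. innovation (\<lambda>u. ?B u \<omega>) (\<tau> (Suc i)) - innovation (\<lambda>u. ?B u \<omega>) (\<tau> i) \<in> E i}"
  have "path01 X \<omega> \<in> increment_set n \<tau> E \<longleftrightarrow>
      (\<forall>i\<in>{..<n}. innovation (\<lambda>u. X u \<omega>) (\<tau> (Suc i)) - innovation (\<lambda>u. X u \<omega>) (\<tau> i) \<in> E i)"
    if "\<omega> \<in> space N" for \<omega>
    using X that \<tau>(1) by (rule path01_increment_set_iff)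
  then have "{\<omega> \<in> space N. \<forall>i\<in>{..<n}. innovation (\<lambda>u. X u \<omega>) (\<tau> (Suc i)) - innovation (\<lambda>u. X u \<omega>) (\<tau> i) \<in> E i} =
      {\<omega> \<in> space N. path01 X \<omega> \<in> increment_set n \<tau> E}"
    by blast
  then have "measure N {\<omega> \<in> space N. \<forall>i\<in>{..<n}. innovation (\<lambda>u. X u \<omega>) (\<tau> (Suc i)) - innovation (\<lambda>u. X u \<omega>) (\<tau> i) \<in> E i} =
      (LINT \<omega>|M. indicator (increment_set n \<tau> E) (path01 B \<omega>) * ((B 1 \<omega> - running_min B 1 \<omega>) / m))"
    by (simp only: law[OF increment_set_measurable[OF \<tau>(1) E]] den)
  also have "\<dots> = (LINT \<omega>|M. (indicator ?S \<omega> * above_min (\<lambda>u. ?B u \<omega>) 1) / m)"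
  proof (intro Bochner_Integration.integral_cong refl)
    fix \<omega> assume \<omega>: "\<omega> \<in> space M"
    have "path01 B \<omega> \<in> increment_set n \<tau> E \<longleftrightarrow>
        (\<forall>i\<in>{..<n}. innovation (\<lambda>u. B u \<omega>) (\<tau> (Suc i)) - innovation (\<lambda>u. B u \<omega>) (\<tau> i) \<in> E i)"
      using BX \<omega> \<tau>(1) by (rule path01_increment_set_iff)
    also have "\<dots> \<longleftrightarrow> \<omega> \<in> ?S" using inn \<tau>(1) \<omega> by (simp add: Suc_leI)
    finally have "path01 B \<omega> \<in> increment_set n \<tau> E \<longleftrightarrow> \<omega> \<in> ?S" .
    then show "indicator (increment_set n \<tau> E) (path01 B \<omega>) * ((B 1 \<omega> - running_min B 1 \<omega>) / m) =
        (indicator ?S \<omega> * above_min (\<lambda>u. ?B u \<omega>) 1) / m"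
      using w[OF \<omega>] by (simp add: indicator_def)
  qed
  also have "\<dots> = (LINT \<omega>|M. indicator ?S \<omega> * above_min (\<lambda>u. ?B u \<omega>) 1) / m"
    by (rule integral_divide_zero)
  also have "\<dots> = (\<Prod>i<n. measure (centred_normal (\<tau> (Suc i) - \<tau> i)) (E i))"
  proof -
    have "(LINT \<omega>|M. indicator ?S \<omega> * above_min (\<lambda>u. ?B u \<omega>) 1) =
        m * (\<Prod>i<n. measure (centred_normal (\<tau> (Suc i) - \<tau> i)) (E i))"
      unfolding m_def using \<tau> E by (rule innovation_product)
    then show ?thesis using m by simp
  qed
  finally show ?thesis .
qed

text \<open>Taking \<open>UNIV\<close> in all coordinates but one identifies the marginals as the
  \<open>\<mu> j\<close>; then \<open>prod\<close> is the product formula that defines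
  independence.\<close>

lemma indep_vars_of_product:
  assumes "prob_space N" and X: "\<And>i. i < n \<Longrightarrow> X i \<in> borel_measurable N"
    and \<mu>: "\<And>i. i < n \<Longrightarrow> prob_space (\<mu> i)" "\<And>i. i < n \<Longrightarrow> space (\<mu> i) = UNIV"
    and prod: "\<And>E. (\<And>i. i < n \<Longrightarrow> E i \<in> sets borel) \<Longrightarrow>
      measure N {\<omega> \<in> space N. \<forall>i\<in>{..<n}. X i \<omega> \<in> E i} = (\<Prod>i<n. measure (\<mu> i) (E i))"
  shows "prob_space.indep_vars N (\<lambda>_. borel :: real measure) X {..<n::nat}"
proof -
  interpret prob_space N by fact
  show ?thesis
  \<comment> \<open>For \<open>n = 0\<close> the intersection over the coordinates is
    \<open>UNIV\<close> rather than \<open>space N\<close>, so this case stands apart.\<close>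
  proof (cases "n = 0")
    case True
    then show ?thesis by (simp add: indep_vars_def indep_sets_def)
  next
    case False
    show ?thesis
    proof (subst indep_vars_finite[where E="\<lambda>_. sets borel"])
      show "\<forall>A\<in>{..<n} \<rightarrow> sets borel. prob (\<Inter>j\<in>{..<n}. X j -` A j \<inter> space N) = (\<Prod>j<n. prob (X j -` A j \<inter> space N))"
      proof
        fix A :: "nat \<Rightarrow> real set" assume A: "A \<in> {..<n} \<rightarrow> sets borel"
        have single: "prob (X j -` A j \<inter> space N) = measure (\<mu> j) (A j)" if j: "j < n" for j
        proof -
          let ?E = "\<lambda>i. if i = j then A j else UNIV"
          have "X j -` A j \<inter> space N = {\<omega> \<in> space N. \<forall>i\<in>{..<n}. X i \<omega> \<in> ?E i}" using j by auto
          also have "prob \<dots> = (\<Prod>i<n. measure (\<mu> i) (?E i))" using A j by (intro prod) auto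
          also have "\<dots> = (\<Prod>i<n. if i = j then measure (\<mu> j) (A j) else 1)"
            using prob_space.prob_space[OF \<mu>(1)] \<mu>(2) by (intro prod.cong) auto
          also have "\<dots> = measure (\<mu> j) (A j)" using j by simp
          finally show ?thesis .
        qed
        have "(\<Inter>j\<in>{..<n}. X j -` A j \<inter> space N) = {\<omega> \<in> space N. \<forall>i\<in>{..<n}. X i \<omega> \<in> A i}"
          using False by auto
        also have "prob \<dots> = (\<Prod>i<n. measure (\<mu> i) (A i))" using A by (intro prod) auto
        finally show "prob (\<Inter>j\<in>{..<n}. X j -` A j \<inter> space N) = (\<Prod>j<n. prob (X j -` A j \<inter> space N))"
          using single by simp
      qed
      show "sets (borel :: real measure) = sigma_sets (space borel) (sets borel)" 
        by (metis sets.sigma_sets_eq)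
      show "Int_stable (sets (borel :: real measure))" by (auto simp: Int_stable_def)
    qed (use False X in \<open>auto simp: sets.sets_into_space\<close>)
  qed
qed

theorem proposition2p2:
  fixes M :: "'a measure" and N :: "'b measure"
    and B :: "real \<Rightarrow> 'a \<Rightarrow> real" and X :: "real \<Rightarrow> 'b \<Rightarrow> real"
    and c :: "real \<Rightarrow> real \<Rightarrow> real"
  assumes "brownian_motion M B"
    and "prob_space N"
    and "continuous_process N X"
    and law: "\<And>A. A \<in> sets C01_borel \<Longrightarrow>
      measure N {\<omega> \<in> space N. path01 X \<omega> \<in> A} =
        (LINT \<omega>|M. indicator A (path01 B \<omega>) *
           ((B 1 \<omega> - running_min B 1 \<omega>) / (LINT \<omega>'|M. - running_min B 1 \<omega>')))"
    and c: "\<And>t x. t \<in> {0..1} \<Longrightarrow> x \<ge> 0 \<Longrightarrow> (t, x) \<noteq> (1, 0) \<Longrightarrow> c t x = drift_formula t x"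
    and "c 1 0 \<ge> 0"
  shows "\<exists>W. brownian_motion N W \<and> solves_SDE N c X W"
proof -
  interpret N: prob_space N by fact
  note X = assms(3)
  let ?W = "\<lambda>t \<omega>. innovation (\<lambda>u. X u \<omega>) t"
  have X_cont: "continuous_on {0..1} (\<lambda>u. X u \<omega>)" if "\<omega> \<in> space N" for \<omega>
    using X that by (simp add: continuous_process_def)
  have X_meas: "X t \<in> borel_measurable N" if "t \<in> {0..1}" for t
    using X that by (simp add: continuous_process_def)
  have W_meas: "?W t \<in> borel_measurable N" if "t \<in> {0..1}" for t
    using that by (intro innovation_measurable[where T=1] X_meas X_cont) auto
  have events: "N.prob {\<omega> \<in> space N. \<forall>i\<in>{..<n}. ?W (\<tau> (Suc i)) \<omega> - ?W (\<tau> i) \<omega> \<in> E i} =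
      (\<Prod>i<n. measure (centred_normal (\<tau> (Suc i) - \<tau> i)) (E i))"
    if "\<And>i. i \<le> n \<Longrightarrow> \<tau> i \<in> {0..1}" "\<And>i. i < n \<Longrightarrow> \<tau> i \<le> \<tau> (Suc i)" "\<And>i. i < n \<Longrightarrow> E i \<in> sets borel"
    for n \<tau> E
    by (intro innovation_events[OF assms(1) X] law that)
  have cn: "prob_space (centred_normal v)" "space (centred_normal v) = UNIV" if "0 \<le> v" for v
    using real_distribution_centred_normal[OF that]
    by (auto simp: real_distribution_def centred_normal_def)
  have "brownian_motion N ?W"
    unfolding brownian_motion_def
  proof (intro conjI allI impI)
    show "prob_space N" by fact
    show "continuous_process N ?W"
      using W_meas X_cont by (auto simp: continuous_process_def intro!: innovation_continuous)
    show "AE \<omega> in N. ?W 0 \<omega> = 0"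
      using X_cont by (intro AE_I2 innovation_0)
  next
    fix n and \<tau> :: "nat \<Rightarrow> real"
    assume "(\<forall>i\<le>n. \<tau> i \<in> {0..1}) \<and> (\<forall>i<n. \<tau> i \<le> \<tau> (Suc i))"
    then have \<tau>: "\<And>i. i \<le> n \<Longrightarrow> \<tau> i \<in> {0..1}" "\<And>i. i < n \<Longrightarrow> \<tau> i \<le> \<tau> (Suc i)" by auto
    show "N.indep_vars (\<lambda>_. borel) (\<lambda>i \<omega>. ?W (\<tau> (Suc i)) \<omega> - ?W (\<tau> i) \<omega>) {..<n}"
    proof (rule indep_vars_of_product[where \<mu>="\<lambda>i. centred_normal (\<tau> (Suc i) - \<tau> i)"])
      show "(\<lambda>\<omega>. ?W (\<tau> (Suc i)) \<omega> - ?W (\<tau> i) \<omega>) \<in> borel_measurable N" if "i < n" for i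
        using that \<tau>(1)[of i] \<tau>(1)[of "Suc i"] by (intro borel_measurable_diff W_meas) auto
      show "N.prob {\<omega> \<in> space N. \<forall>i\<in>{..<n}. ?W (\<tau> (Suc i)) \<omega> - ?W (\<tau> i) \<omega> \<in> E i} =
          (\<Prod>i<n. measure (centred_normal (\<tau> (Suc i) - \<tau> i)) (E i))"
        if "\<And>i. i < n \<Longrightarrow> E i \<in> sets borel" for E
        by (intro events \<tau> that)
      show "prob_space (centred_normal (\<tau> (Suc i) - \<tau> i))" "space (centred_normal (\<tau> (Suc i) - \<tau> i)) = UNIV"
        if "i < n" for i
        using \<tau>(2)[OF that] by (auto intro!: cn)
    qed fact
  next
    fix s t :: real assume st: "0 \<le> s \<and> s < t \<and> t \<le> 1"
    let ?Z = "\<lambda>\<omega>. ?W t \<omega> - ?W s \<omega>"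
    have Z: "?Z \<in> borel_measurable N" using st by (intro borel_measurable_diff W_meas) auto
    \<comment> \<open>The partition with the single step from \<open>s\<close> to \<open>t\<close>:
      the product formula with one factor is the law of the increment.\<close>
    let ?\<tau> = "\<lambda>i::nat. if i = 0 then s else t"
    interpret C: prob_space "centred_normal (t - s)" using st by (intro cn) auto
    interpret D: prob_space "distr N lborel ?Z" using Z by (intro N.prob_space_distr) simp
    have "distr N lborel ?Z = centred_normal (t - s)"
    proof (rule measure_eqI)
      show "sets (distr N lborel ?Z) = sets (centred_normal (t - s))" by (simp add: centred_normal_def)
      fix E assume "E \<in> sets (distr N lborel ?Z)"
      then have E: "E \<in> sets borel" by simp
      have "measure (distr N lborel ?Z) E = measure N {\<omega> \<in> space N. \<forall>i\<in>{..<Suc 0}. ?W (?\<tau> (Suc i)) \<omega> - ?W (?\<tau> i) \<omega> \<in> E}"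
        using Z E by (subst measure_distr) (auto intro!: arg_cong[where f="measure N"])
      also have "\<dots> = (\<Prod>i<Suc 0. measure (centred_normal (?\<tau> (Suc i) - ?\<tau> i)) E)"
        using st E by (intro events) auto
      finally show "emeasure (distr N lborel ?Z) E = emeasure (centred_normal (t - s)) E"
        by (simp add: C.emeasure_eq_measure D.emeasure_eq_measure)
    qed
    then show "distributed N lborel ?Z (normal_density 0 (sqrt (t - s)))"
      using st Z by (simp add: distributed_def centred_normal_def)
  qed
  moreover have "solves_SDE N c X ?W"
    unfolding solves_SDE_def
  proof (rule AE_I2, rule conjI)
    fix \<omega> assume \<omega>: "\<omega> \<in> space N"
    let ?f = "\<lambda>u. X u \<omega>"
    note cont = X_cont[OF \<omega>]
    \<comment> \<open>At \<open>s = 1\<close> the values of \<open>c\<close> and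
      \<open>drift\<close> may differ, so the identification is made for earlier times.\<close>
    have eq: "c s (X s \<omega> - running_min X s \<omega>) = drift s (above_min ?f s)" if s: "0 \<le> s" "s < 1" for s
    proof -
      have "X s \<omega> - running_min X s \<omega> = above_min ?f s"
        unfolding running_min_def using s by (intro above_min_eq path_continuous[OF cont]) auto
      moreover have "0 \<le> above_min ?f s" using s by (intro path_above_min_nonneg[OF cont]) auto
      ultimately show ?thesis using s c[of s "above_min ?f s"] by (simp add: drift_formula_eq)
    qed
    define h h' where "h t s = indicator {0..t} s *\<^sub>R c s (X s \<omega> - running_min X s \<omega>)"
      and "h' t s = indicator {0..t} s *\<^sub>R drift s (above_min ?f s)" for t s
    have int: "integrable lborel (h' t)" if "t \<in> {0..1}" for t
      using drift_path_integrable[OF cont, of 0 t] that by (simp add: h'_def[abs_def] set_integrable_def)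
    \<comment> \<open>\<open>h t\<close> is the measurable function \<open>h' t\<close> altered at
      the single time 1. This yields both its measurability, \<open>c\<close> being known only
      through its values, and equality almost everywhere.\<close>
    have h_eq: "h t = (\<lambda>s. if s = 1 then h t 1 else h' t s)" if "t \<in> {0..1}" for t
      using that eq by (auto simp: h_def h'_def indicator_def fun_eq_iff)
    have AE: "AE s in lborel. h t s = h' t s" if "t \<in> {0..1}" for t
      using AE_lborel_singleton[of "1::real"]
      by eventually_elim (use fun_cong[OF h_eq[OF that]] in auto)
    have meas: "h t \<in> borel_measurable lborel" "h' t \<in> borel_measurable lborel" if "t \<in> {0..1}" for t
    proof -
      show h': "h' t \<in> borel_measurable lborel" using int[OF that] by simp
      then have "(\<lambda>s. if s = 1 then h t 1 else h' t s) \<in> borel_measurable lborel" by measurable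
      then show "h t \<in> borel_measurable lborel" by (subst h_eq[OF that])
    qed
    have "integrable lborel (h 1)"
      using int[of 1] integrable_cong_AE[OF meas(1)[of 1] meas(2)[of 1] AE[of 1]] by simp
    then show "set_integrable lborel {0..1} (\<lambda>s. c s (X s \<omega> - running_min X s \<omega>))"
      by (simp add: set_integrable_def h_def[abs_def])
    show "\<forall>t\<in>{0..1}. X t \<omega> = X 0 \<omega> + (LBINT s:{0..t}. c s (X s \<omega> - running_min X s \<omega>)) + ?W t \<omega>"
    proof
      fix t :: real assume t: "t \<in> {0..1}"
      have "(\<integral>s. h t s \<partial>lborel) = (\<integral>s. h' t s \<partial>lborel)"
        by (rule integral_cong_AE[OF meas[OF t] AE[OF t]])
      then have "(LBINT s:{0..t}. c s (X s \<omega> - running_min X s \<omega>)) = drift_integral ?f 0 t"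
        by (simp add: set_lebesgue_integral_def h_def h'_def drift_integral_def)
      then show "X t \<omega> = X 0 \<omega> + (LBINT s:{0..t}. c s (X s \<omega> - running_min X s \<omega>)) + ?W t \<omega>"
        by (simp add: innovation_def)
    qed
  qed
  ultimately show ?thesis by blast
qed

end
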